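(* Let $0<\epsilon\le1/2$ and consider the two-queue, single-server queueing system with one-slot switchover delay and symmetric Gilbert-Elliot channels with parameter $\epsilon$, with stability region $\mathbf{\Lambda}$. The Frame Based Dynamic Control (FBDC) policy is throughput-optimal asymptotically in the frame length; that is, for every $\delta>0$ there exists a frame length $T$ such that the FBDC policy with frame length $T$ stabilizes the system for all arrival rate vectors $(\lambda_1,\lambda_2)\ge 0$ with $(\lambda_1+\delta,\lambda_2+\delta)\in\mathbf{\Lambda}$.
   Context: Queueing system: time is slotted, $t\in\{0,1,\dots\}$. There are two queues and one server; $m(t)\in\{1,2\}$ is the server location in slot $t$. The arrivals $A_i(t)$ to queue $i$ are i.i.d. over $t$ with mean $\lambda_i$ and $\mathbb{E}[A_i^2(t)]\le A_{\max}^2<\infty$. The channel state $C_i(t)\in\{0,1\}$ (ON $=1$, OFF $=0$) of queue $i$ is a two-state Markov chain that changes state in every slot with probability $\epsilon$. The processes $A_1,A_2,C_1,C_2$ are independent. Knowing $(Q_1(t),Q_2(t))$ and $(C_1(t),C_2(t))$, at the beginning of slot $t$ the server chooses $a_t=1$ (stay: $m(t+1)=m(t)$) or $a_t=0$ (switch: $m(t+1)$ is the other queue). Let $D_i(t)=1$ if $m(t)=i$, $a_t=1$, $C_i(t)=1$, and $D_i(t)=0$ otherwise. Then $Q_i(t+1)=\max(Q_i(t)-D_i(t),0)+A_i(t)$, with $Q_i(0)=0$. Policies may be history-dependent and randomized (non-anticipating). The system is stable if $\limsup_{t\to\infty}\frac1t\sum_{\tau=0}^{t-1}\sum_{i}\mathbb{E}[Q_i(\tau)]<\infty$.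 The stability region $\mathbf{\Lambda}$ is the set of all arrival rate vectors $(\lambda_1,\lambda_2)$ for which some policy stabilizes the system. Saturated system (both queues always nonempty): the Markov decision process with states $\mathbf{s}=(m,C_1,C_2)\in\mathcal S=\{1,2\}\times\{0,1\}^2$, actions $a\in\mathcal A=\{0,1\}$, transition probabilities $\mathbf{P}(\mathbf{s}|\mathbf{s}',a)$ given by the dynamics above, and rewards $\overline r_i(\mathbf{s},a)=1$ if $m=i$, $C_i=1$, $a=1$, and $0$ otherwise. Let $\mathbf{X}$ be the polytope of vectors $\mathbf{x}\ge 0$ indexed by $\mathcal S\times\mathcal A$ with $\sum_{\mathbf{s},a}\mathbf{x}(\mathbf{s},a)=1$ and $\sum_a\mathbf{x}(\mathbf{s},a)=\sum_{\mathbf{s}',a}\mathbf{P}(\mathbf{s}|\mathbf{s}',a)\mathbf{x}(\mathbf{s}',a)$ for all $\mathbf{s}$, and let $\mathbf{\Lambda}_s=\{(r_1,r_2): r_i=\sum_{\mathbf{s},a}\mathbf{x}(\mathbf{s},a)\overline r_i(\mathbf{s},a),\ \mathbf{x}\in\mathbf{X}\}$. Every corner point of $\mathbf{\Lambda}_s$ is attained by a stationary deterministic policy. FBDC policy with frame length $T$: time is divided into frames of $T$ slots, the $j$th frame being $\{jT,\dots,(j+1)T-1\}$. At the beginning of frame $j$, find a corner point $(r_1^*,r_2^* )$ of $\mathbf{\Lambda}_s$ that maximizes $Q_1(jT)r_1+Q_2(jT)r_2$ over $(r_1,r_2)\in\mathbf{\Lambda}_s$, and a stationary deterministic policy $\boldsymbol\pi^*$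 for the saturated system (a map from states $(m,C_1,C_2)$ to stay/switch) attaining $(r_1^*,r_2^* )$ and whose induced Markov chain on $\mathcal{S}$ has a single recurrent class. Apply $\boldsymbol\pi^*$ in every slot of frame $j$. *)

theory Defs
  imports "HOL-Probability.Probability"
begin

(* Queues are indexed by the two-element numeral type 2, so real^2 holds queue lengths and
   rates, and bool^2 holds channel states (True = ON).  Actions are booleans: True = stay. *)

section \<open>Saturated system\<close>

text \<open>A state is the server location together with both channel states.\<close>

type_synonym state = "2 \<times> (bool ^ 2)"

definition move :: "2 \<Rightarrow> bool \<Rightarrow> 2" where
  "move m stay = (if stay then m else if m = 1 then 2 else 1)"

definition reward :: "2 \<Rightarrow> state \<Rightarrow> bool \<Rightarrow> real" where
  "reward i s a = of_bool (fst s = i \<and> snd s $ i \<and> a)"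

text \<open>\<open>trans_prob \<epsilon> s' a s\<close> is the probability of moving from \<open>s'\<close> to \<open>s\<close> under action \<open>a\<close>.\<close>

definition trans_prob :: "real \<Rightarrow> state \<Rightarrow> bool \<Rightarrow> state \<Rightarrow> real" where
  "trans_prob \<epsilon> s' a s =
     of_bool (fst s = move (fst s') a) *
     (\<Prod>i\<in>UNIV. if snd s $ i = snd s' $ i then 1 - \<epsilon> else \<epsilon>)"

definition occupation_polytope :: "real \<Rightarrow> (state \<Rightarrow> bool \<Rightarrow> real) set" where
  "occupation_polytope \<epsilon> = {x.
     (\<forall>s a. 0 \<le> x s a) \<and>
     (\<Sum>s\<in>UNIV. \<Sum>a\<in>UNIV. x s a) = 1 \<and>
     (\<forall>s. (\<Sum>a\<in>UNIV. x s a) = (\<Sum>s'\<in>UNIV. \<Sum>a\<in>UNIV. trans_prob \<epsilon> s' a s * x s' a))}"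

definition rate_vector :: "(state \<Rightarrow> bool \<Rightarrow> real) \<Rightarrow> real ^ 2" where
  "rate_vector x = (\<chi> i. \<Sum>s\<in>UNIV. \<Sum>a\<in>UNIV. x s a * reward i s a)"

definition saturated_region :: "real \<Rightarrow> (real ^ 2) set" where
  "saturated_region \<epsilon> = rate_vector ` occupation_polytope \<epsilon>"

text \<open>A stationary deterministic policy for the saturated system is a map \<open>state \<Rightarrow> bool\<close>.
  It attains \<open>r\<close> if a stationary distribution of its induced chain has reward vector \<open>r\<close>.\<close>

definition attains :: "real \<Rightarrow> (state \<Rightarrow> bool) \<Rightarrow> real ^ 2 \<Rightarrow> bool" where
  "attains \<epsilon> \<pi> r \<longleftrightarrow>
     (\<exists>x\<in>occupation_polytope \<epsilon>. (\<forall>s a. a \<noteq> \<pi> s \<longrightarrow> x s a = 0) \<and> rate_vector x = r)"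

definition induced_edges :: "real \<Rightarrow> (state \<Rightarrow> bool) \<Rightarrow> (state \<times> state) set" where
  "induced_edges \<epsilon> \<pi> = {(s', s). 0 < trans_prob \<epsilon> s' (\<pi> s') s}"

text \<open>In a finite chain the recurrent classes are the closed communicating classes, i.e. the
  nonempty sets that are exactly what is reachable from each of their members.\<close>

definition recurrent_class :: "real \<Rightarrow> (state \<Rightarrow> bool) \<Rightarrow> state set \<Rightarrow> bool" where
  "recurrent_class \<epsilon> \<pi> R \<longleftrightarrow> R \<noteq> {} \<and> (\<forall>s\<in>R. (induced_edges \<epsilon> \<pi>)\<^sup>* `` {s} = R)"


section \<open>Arrivals and channels\<close>

text \<open>Two-state Markov chain with switching probability \<open>\<epsilon>\<close> and arbitrary initial law.\<close>

definition gilbert_elliott :: "'w measure \<Rightarrow> real \<Rightarrow> (nat \<Rightarrow> 'w \<Rightarrow> bool) \<Rightarrow> bool" where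
  "gilbert_elliott M \<epsilon> C \<longleftrightarrow>
     (\<forall>t c. measure M {\<omega> \<in> space M. \<forall>s\<le>Suc t. C s \<omega> = c s} =
            measure M {\<omega> \<in> space M. \<forall>s\<le>t. C s \<omega> = c s} *
            (if c (Suc t) = c t then 1 - \<epsilon> else \<epsilon>))"

datatype source = Arrivals "2" | Channel "2" | Coins

text \<open>The coins \<open>U t\<close> are the external randomness used by randomized policies.
  \<open>indep_processes\<close> makes the processes jointly independent, each viewed as one random
  element of path space.  It also provides measurability of \<open>C\<close>.\<close>

locale queueing_system = prob_space M
  for M :: "'w measure" +
  fixes \<epsilon> :: real
    and rate :: "real ^ 2"
    and A :: "2 \<Rightarrow> nat \<Rightarrow> 'w \<Rightarrow> real"
    and C :: "2 \<Rightarrow> nat \<Rightarrow> 'w \<Rightarrow> bool"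
    and U :: "nat \<Rightarrow> 'w \<Rightarrow> real"
  assumes arrivals_nonneg: "\<And>i t \<omega>. \<omega> \<in> space M \<Longrightarrow> 0 \<le> A i t \<omega>"
    and arrivals_indep: "\<And>i. indep_vars (\<lambda>_. borel) (A i) UNIV"
    and arrivals_ident: "\<And>i t. distr M borel (A i t) = distr M borel (A i 0)"
    and arrivals_mean: "\<And>i t. expectation (A i t) = rate $ i"
    and arrivals_second_moment:
      "\<exists>A\<^sub>m\<^sub>a\<^sub>x. \<forall>i t. integrable M (\<lambda>\<omega>. (A i t \<omega>)\<^sup>2) \<and>
                   expectation (\<lambda>\<omega>. (A i t \<omega>)\<^sup>2) \<le> A\<^sub>m\<^sub>a\<^sub>x\<^sup>2"
    and channels: "\<And>i. gilbert_elliott M \<epsilon> (C i)"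
    and coins_indep: "indep_vars (\<lambda>_. borel) U UNIV"
    and coins_uniform: "\<And>t. distr M borel (U t) = uniform_measure lborel {0..1}"
    and indep_processes:
      "indep_vars (\<lambda>_. \<Pi>\<^sub>M t\<in>UNIV. borel)
         (\<lambda>k \<omega> t. case k of Arrivals i \<Rightarrow> A i t \<omega>
                          | Channel i \<Rightarrow> of_bool (C i t \<omega>)
                          | Coins \<Rightarrow> U t \<omega>) UNIV"


section \<open>Policies and queue dynamics\<close>

text \<open>The observation in a slot consists of the server location, the channel states and the
  queue lengths.  Past actions are recovered from the sequence of server locations.\<close>

type_synonym observation = "state \<times> (real ^ 2)"

definition observation_space :: "observation measure" where
  "observation_space = count_space UNIV \<Otimes>\<^sub>M borel"

text \<open>\<open>\<phi> t h\<close> is the probability of staying in slot \<open>t\<close> given the observations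
  \<open>h 0, \<dots>, h t\<close>.\<close>

type_synonym policy = "nat \<Rightarrow> (nat \<Rightarrow> observation) \<Rightarrow> real"

definition admissible :: "policy \<Rightarrow> bool" where
  "admissible \<phi> \<longleftrightarrow>
     (\<forall>t. \<phi> t \<in> borel_measurable (\<Pi>\<^sub>M s\<in>{..t}. observation_space) \<and>
          (\<forall>h\<in>space (\<Pi>\<^sub>M s\<in>{..t}. observation_space). 0 \<le> \<phi> t h \<and> \<phi> t h \<le> 1))"

text \<open>\<open>history \<phi> m\<^sub>0 a c u t\<close> is the observation sequence on \<open>{..t}\<close> (undefined elsewhere) for
  one realization \<open>a\<close>, \<open>c\<close>, \<open>u\<close> of arrivals, channels and coins and initial location \<open>m\<^sub>0\<close>.\<close>

primrec history ::
  "policy \<Rightarrow> 2 \<Rightarrow> (2 \<Rightarrow> nat \<Rightarrow> real) \<Rightarrow> (2 \<Rightarrow> nat \<Rightarrow> bool) \<Rightarrow> (nat \<Rightarrow> real)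
     \<Rightarrow> nat \<Rightarrow> (nat \<Rightarrow> observation)" where
  "history \<phi> m\<^sub>0 a c u 0 = (\<lambda>_. undefined)(0 := ((m\<^sub>0, \<chi> i. c i 0), 0))"
| "history \<phi> m\<^sub>0 a c u (Suc t) =
     (let h = history \<phi> m\<^sub>0 a c u t;
          s = fst (h t);
          q = snd (h t);
          stay = (u t < \<phi> t h)
      in h(Suc t := ((move (fst s) stay, \<chi> i. c i (Suc t)),
                     \<chi> i. max (q $ i - reward i s stay) 0 + a i t)))"

definition queue_length ::
  "policy \<Rightarrow> 2 \<Rightarrow> (2 \<Rightarrow> nat \<Rightarrow> 'w \<Rightarrow> real) \<Rightarrow> (2 \<Rightarrow> nat \<Rightarrow> 'w \<Rightarrow> bool) \<Rightarrow> (nat \<Rightarrow> 'w \<Rightarrow> real)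
     \<Rightarrow> 2 \<Rightarrow> nat \<Rightarrow> 'w \<Rightarrow> real" where
  "queue_length \<phi> m\<^sub>0 A C U i t \<omega> =
     snd (history \<phi> m\<^sub>0 (\<lambda>i t. A i t \<omega>) (\<lambda>i t. C i t \<omega>) (\<lambda>t. U t \<omega>) t t) $ i"

definition queues_stable ::
  "'w measure \<Rightarrow> policy \<Rightarrow> 2 \<Rightarrow> (2 \<Rightarrow> nat \<Rightarrow> 'w \<Rightarrow> real) \<Rightarrow> (2 \<Rightarrow> nat \<Rightarrow> 'w \<Rightarrow> bool)
     \<Rightarrow> (nat \<Rightarrow> 'w \<Rightarrow> real) \<Rightarrow> bool" where
  "queues_stable M \<phi> m\<^sub>0 A C U \<longleftrightarrow>
     limsup (\<lambda>t. (\<Sum>\<tau><t. \<Sum>i\<in>UNIV. \<integral>\<^sup>+\<omega>. ennreal (queue_length \<phi> m\<^sub>0 A C U i \<tau> \<omega>) \<partial>M)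
                 / of_nat t) < \<infinity>"

text \<open>The sample space consists of the paths of (arrivals, channels, coins).  Stability
  depends only on the joint law of these processes, so this choice loses no system.  The
  arrival law with the given mean, the initial channel law and the initial server location
  are existentially quantified, which gives the largest candidate for the region.\<close>

type_synonym sample = "nat \<Rightarrow> (real ^ 2) \<times> (bool ^ 2) \<times> real"

definition stability_region :: "real \<Rightarrow> (real ^ 2) set" where
  "stability_region \<epsilon> =
     {rate. \<exists>(M :: sample measure) A C U m\<^sub>0 \<phi>.
        queueing_system M \<epsilon> rate A C U \<and> admissible \<phi> \<and> queues_stable M \<phi> m\<^sub>0 A C U}"


section \<open>Frame based dynamic control\<close>

definition fbdc_choice :: "real \<Rightarrow> real ^ 2 \<Rightarrow> (state \<Rightarrow> bool) \<Rightarrow> bool" where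
  "fbdc_choice \<epsilon> q \<pi> \<longleftrightarrow>
     (\<exists>r. r extreme_point_of saturated_region \<epsilon> \<and>
          (\<forall>r'\<in>saturated_region \<epsilon>. q \<bullet> r' \<le> q \<bullet> r) \<and>
          attains \<epsilon> \<pi> r) \<and>
     (\<exists>!R. recurrent_class \<epsilon> \<pi> R)"

text \<open>Ties between corner points and between policies may be broken arbitrarily, and
  differently in each frame, as long as the choice depends measurably on the queue lengths.
  With frame length \<open>T\<close>, slot \<open>t\<close> lies in frame \<open>t div T\<close>, which starts in slot
  \<open>T * (t div T)\<close>.\<close>

definition fbdc_policy :: "real \<Rightarrow> nat \<Rightarrow> policy \<Rightarrow> bool" where
  "fbdc_policy \<epsilon> T \<phi> \<longleftrightarrow>
     (\<exists>sel :: nat \<Rightarrow> real ^ 2 \<Rightarrow> state \<Rightarrow> bool.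
        (\<forall>j. sel j \<in> borel \<rightarrow>\<^sub>M count_space UNIV) \<and>
        (\<forall>j q. (\<forall>i. 0 \<le> q $ i) \<longrightarrow> fbdc_choice \<epsilon> q (sel j q)) \<and>
        \<phi> = (\<lambda>t h. of_bool (sel (t div T) (snd (h (T * (t div T)))) (fst (h t)))))"

end

theory Submission
  imports Defs
begin

text \<open>
The stability region is compared with the frame policy through the saturated region, a convex
polygon.  A policy that stabilizes the queues spends fractions of time in the pairs of state and
action that, along a subsequence of horizons with bounded mean backlog, converge to a point of the
occupation polytope.  What leaves a queue is at most what its server could have served, so the
arrival rates are dominated by the rate vector of that point.  Hence, if the rates with slack
\<open>\<delta>\<close> are stabilizable and \<open>q\<close> is a vector of queue lengths, every rate vector \<open>r\<close> of the saturated
region that maximizes \<open>q \<bullet> r\<close> satisfies \<open>q \<bullet> (\<lambda> + \<delta>) \<le> q \<bullet> r\<close>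
(\<open>stability_region_dominated\<close>).

The frame policy really serves at nearly this maximal rate.  The policy of a frame has a single
recurrent class, so its chain has one stationary distribution, all time averages converge to it
from every initial state, and since there are finitely many policies and states one frame length
makes the average reward \<open>\<delta>/2\<close>-close to the attained rate in all cases
(\<open>ex_good_frame_length\<close>).  The length does not depend on the arrival rates.  Convergence is
obtained by compactness from \<open>time_average_limit_point\<close>, the same lemma that handles
the arbitrary policy above, so no mixing rate is estimated.

With the Lyapunov function \<open>\<Sum>i. Q\<^sub>i\<^sup>2\<close> sampled at the frame boundaries, the
drift over a frame of length \<open>T\<close> is at most \<open>B - T * \<delta> * \<Sum>i. Q\<^sub>i\<close>.  Weighted with the queue
lengths, the service of a frame exceeds its arrivals by at least \<open>T * \<delta>/2 * \<Sum>i. Q\<^sub>i\<close>, which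
enters the square twice, and the squares of arrivals and services are absorbed in \<open>B\<close> by the
second moment bound (\<open>frame_service\<close>, \<open>frame_drift\<close>).  Summing over frames bounds the average backlog.

Two facts about randomness carry these estimates.  Given the history and the coin, the next state
follows the transition law of the saturated system (\<open>controlled_markov\<close>), because only finitely
many channel paths lead up to a slot and the channels are independent of arrivals and coins.  And
arrivals from slot \<open>t\<close> onwards are independent of the history up to \<open>t\<close>
(\<open>future_arrivals_independent\<close>).

Existence of the frame policy needs, for every weight, an optimal corner that is attained by a
deterministic policy with a single recurrent class.  Counting dimensions shows that extreme points
of the occupation polytope are deterministic.  Only the policy that never switches has several
recurrent classes, and an extreme point using it lives at one location, so switching at the other
location repairs it (\<open>ex_fbdc_choice\<close>).
\<close>

(* States are pairs; keeping quantifiers over states whole lets facts about a state apply as stated. *)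
declare split_paired_All [simp del] split_paired_Ex [simp del]

section \<open>Geometry of the saturated region\<close>

lemma trans_prob_nonneg:
  assumes "0 < \<epsilon>" "\<epsilon> < 1"
  shows "0 \<le> trans_prob \<epsilon> s' a s"
  using assms by (auto simp: trans_prob_def intro!: mult_nonneg_nonneg prod_nonneg)

lemma trans_prob_pos_iff:
  assumes "0 < \<epsilon>" "\<epsilon> < 1"
  shows "0 < trans_prob \<epsilon> s' a s \<longleftrightarrow> fst s = move (fst s') a"
proof -
  have "0 < (\<Prod>i\<in>UNIV. if snd s $ i = snd s' $ i then 1 - \<epsilon> else \<epsilon>)"
    using assms by (intro prod_pos) auto
  then show ?thesis by (auto simp: trans_prob_def)
qed

lemma sum_channel_prob:
  "(\<Sum>c'\<in>UNIV. \<Prod>i\<in>UNIV. if (c' :: bool ^ 2) $ i = c $ i then 1 - \<epsilon> else \<epsilon>) = (1::real)"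
proof -
  have "(\<Sum>c'\<in>UNIV. \<Prod>i\<in>UNIV. if (c' :: bool ^ 2) $ i = c $ i then 1 - \<epsilon> else \<epsilon>)
      = (\<Sum>g\<in>UNIV. \<Prod>i\<in>UNIV. if (g :: 2 \<Rightarrow> bool) i = c $ i then 1 - \<epsilon> else \<epsilon>)"
    by (rule sum.reindex_bij_witness[of _ vec_lambda vec_nth]) auto
  also have "\<dots> = (\<Prod>i\<in>UNIV. \<Sum>b\<in>UNIV. if b = c $ i then 1 - \<epsilon> else \<epsilon>)"
    using prod_sum_PiE[of "UNIV :: 2 set" "\<lambda>_. UNIV :: bool set"
        "\<lambda>i b. if b = c $ i then 1 - \<epsilon> else \<epsilon>"]
    by (simp add: PiE_UNIV_domain)
  also have "\<dots> = (\<Prod>i\<in>(UNIV :: 2 set). 1)"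
    by (intro prod.cong refl) (auto simp: UNIV_bool)
  finally show ?thesis by simp
qed

lemma sum_trans_prob: "(\<Sum>s\<in>UNIV. trans_prob \<epsilon> s' a s) = 1"
proof -
  have "(\<Sum>s\<in>UNIV. trans_prob \<epsilon> s' a s) = (\<Sum>m\<in>UNIV. \<Sum>c\<in>UNIV. trans_prob \<epsilon> s' a (m, c))"
    by (simp add: sum.cartesian_product UNIV_Times_UNIV)
  also have "\<dots> = (\<Sum>m\<in>UNIV. of_bool (m = move (fst s') a))"
    by (simp add: trans_prob_def sum_channel_prob flip: sum_distrib_left)
  also have "\<dots> = 1" by (simp add: of_bool_def)
  finally show ?thesis .
qed

text \<open>Occupation measures as points of a Euclidean space, so that compactness and the existence of
extreme points of compact convex sets are available.\<close>

definition occ :: "real ^ (state \<times> bool) \<Rightarrow> state \<Rightarrow> bool \<Rightarrow> real" where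
  "occ v s a = v $ (s, a)"

definition balance_defect :: "real \<Rightarrow> (state \<Rightarrow> bool \<Rightarrow> real) \<Rightarrow> state \<Rightarrow> real" where
  "balance_defect \<epsilon> x s =
     (\<Sum>a\<in>UNIV. x s a) - (\<Sum>s'\<in>UNIV. \<Sum>a\<in>UNIV. trans_prob \<epsilon> s' a s * x s' a)"

definition total_mass :: "(state \<Rightarrow> bool \<Rightarrow> real) \<Rightarrow> real" where
  "total_mass x = (\<Sum>s\<in>UNIV. \<Sum>a\<in>UNIV. x s a)"

definition occ_vectors :: "real \<Rightarrow> (real ^ (state \<times> bool)) set" where
  "occ_vectors \<epsilon> = {v. occ v \<in> occupation_polytope \<epsilon>}"

lemma occ_vectors_iff:
  "v \<in> occ_vectors \<epsilon> \<longleftrightarrow>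
     (\<forall>k. 0 \<le> v $ k) \<and> total_mass (occ v) = 1 \<and> (\<forall>s. balance_defect \<epsilon> (occ v) s = 0)"
  by (auto simp: occ_vectors_def occupation_polytope_def total_mass_def balance_defect_def occ_def)

lemma occ_surj: "occ (\<chi> k. x (fst k) (snd k)) = x"
  by (auto simp: occ_def fun_eq_iff)

lemma saturated_region_eq: "saturated_region \<epsilon> = (\<lambda>v. rate_vector (occ v)) ` occ_vectors \<epsilon>"
proof -
  have "occupation_polytope \<epsilon> = occ ` occ_vectors \<epsilon>"
    unfolding occ_vectors_def by (auto simp: image_iff) (metis occ_surj)
  then show ?thesis unfolding saturated_region_def by (simp add: image_image)
qed

lemma linear_rate_vector: "linear (\<lambda>v. rate_vector (occ v))"
  by (rule linearI)
     (auto simp: rate_vector_def occ_def vec_eq_iff algebra_simps sum.distrib sum_distrib_left)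

lemma linear_balance_defect: "linear (\<lambda>v. balance_defect \<epsilon> (occ v) s)"
  by (rule linearI)
     (auto simp: balance_defect_def occ_def algebra_simps sum.distrib sum_distrib_left)

lemma linear_total_mass: "linear (\<lambda>v. total_mass (occ v))"
  by (rule linearI) (auto simp: total_mass_def occ_def algebra_simps sum.distrib sum_distrib_left)

lemma total_mass_eq_sum: "total_mass (occ v) = (\<Sum>k\<in>UNIV. v $ k)"
  by (simp add: total_mass_def occ_def sum.cartesian_product)

lemma convex_occ_vectors: "convex (occ_vectors \<epsilon>)"
proof (rule convexI)
  fix v w and u t :: real
  assume *: "v \<in> occ_vectors \<epsilon>" "w \<in> occ_vectors \<epsilon>" "0 \<le> u" "0 \<le> t" "u + t = 1"
  have "balance_defect \<epsilon> (occ (u *\<^sub>R v + t *\<^sub>R w)) s = 0" for s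
    using * by (simp add: linear_add[OF linear_balance_defect] linear_cmul[OF linear_balance_defect]
        occ_vectors_iff)
  moreover have "total_mass (occ (u *\<^sub>R v + t *\<^sub>R w)) = 1"
    using * by (simp add: linear_add[OF linear_total_mass] linear_cmul[OF linear_total_mass]
        occ_vectors_iff)
  ultimately show "u *\<^sub>R v + t *\<^sub>R w \<in> occ_vectors \<epsilon>"
    using * by (auto simp: occ_vectors_iff)
qed

lemma closed_occ_vectors: "closed (occ_vectors \<epsilon>)"
proof -
  have "occ_vectors \<epsilon> = {v. \<forall>k. 0 \<le> v $ k} \<inter> {v. total_mass (occ v) = 1} \<inter>
      (\<Inter>s. {v. balance_defect \<epsilon> (occ v) s = 0})"
    by (auto simp: occ_vectors_iff)
  moreover have "closed {v. \<forall>k. 0 \<le> (v :: real ^ (state \<times> bool)) $ k}"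
    by (intro closed_Collect_all closed_Collect_le continuous_intros)
  moreover have "closed {v. total_mass (occ v) = 1}"
    by (intro closed_Collect_eq linear_continuous_on continuous_intros
        linear_conv_bounded_linear[THEN iffD1] linear_total_mass)
  moreover have "closed {v. balance_defect \<epsilon> (occ v) s = 0}" for s
    by (intro closed_Collect_eq linear_continuous_on continuous_intros
        linear_conv_bounded_linear[THEN iffD1] linear_balance_defect)
  ultimately show ?thesis by (auto intro!: closed_Int closed_INT)
qed

lemma occ_vector_component_le_1:
  assumes "v \<in> occ_vectors \<epsilon>"
  shows "v $ k \<le> 1"
proof -
  have "v $ k \<le> (\<Sum>k\<in>UNIV. v $ k)"
    using assms by (intro member_le_sum) (auto simp: occ_vectors_iff)
  then show ?thesis using assms by (simp add: occ_vectors_iff total_mass_eq_sum)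
qed

lemma compact_occ_vectors: "compact (occ_vectors \<epsilon>)"
proof -
  have "occ_vectors \<epsilon> \<subseteq> cbox 0 1"
    by (auto simp: mem_box_cart occ_vector_component_le_1) (simp add: occ_vectors_iff)
  then have "bounded (occ_vectors \<epsilon>)" by (rule bounded_subset[OF bounded_cbox])
  then show ?thesis using closed_occ_vectors by (simp add: compact_eq_bounded_closed)
qed

lemma occ_vectors_nonempty: "occ_vectors \<epsilon> \<noteq> {}"
proof -
  let ?x = "\<lambda>(s::state) a. of_bool (fst s = 1 \<and> a) / (4 :: real)"
  have c4: "card (UNIV :: (bool ^ 2) set) = 4" by simp
  have split: "(\<Sum>s\<in>UNIV. f s) = (\<Sum>m\<in>UNIV. \<Sum>c\<in>UNIV. f (m, c))" for f :: "state \<Rightarrow> real"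
    by (simp add: sum.cartesian_product UNIV_Times_UNIV)
  have sym: "trans_prob \<epsilon> s' a s = of_bool (fst s = move (fst s') a) *
      (\<Prod>i\<in>UNIV. if snd s' $ i = snd s $ i then 1 - \<epsilon> else \<epsilon>)" for s' a s
    unfolding trans_prob_def by (intro arg_cong2[where f="(*)"] prod.cong) auto
  have "?x \<in> occupation_polytope \<epsilon>"
    unfolding occupation_polytope_def
  proof (intro CollectI conjI allI)
    fix s :: state
    show "(\<Sum>a\<in>UNIV. ?x s a) = (\<Sum>s'\<in>UNIV. \<Sum>a\<in>UNIV. trans_prob \<epsilon> s' a s * ?x s' a)"
      by (simp add: split UNIV_bool sum_2 sym move_def sum_channel_prob flip: sum_divide_distrib sum_distrib_left)
  qed (auto simp: split UNIV_bool sum_2 c4)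
  then show ?thesis unfolding occ_vectors_def using occ_surj[of ?x] by (metis (mono_tags, lifting) empty_iff mem_Collect_eq)
qed

lemma convex_saturated_region: "convex (saturated_region \<epsilon>)"
  unfolding saturated_region_eq by (rule convex_linear_image[OF linear_rate_vector convex_occ_vectors])

lemma compact_saturated_region: "compact (saturated_region \<epsilon>)"
  unfolding saturated_region_eq
  by (intro compact_continuous_image compact_occ_vectors linear_continuous_on
      linear_conv_bounded_linear[THEN iffD1] linear_rate_vector)

lemma saturated_region_nonempty: "saturated_region \<epsilon> \<noteq> {}"
  unfolding saturated_region_eq using occ_vectors_nonempty by auto

text \<open>The maximizers of a linear functional form a face, which is compact and convex, and extreme points
of a face are extreme in the whole region.\<close>

lemma ex_optimal_extreme_point:
  "\<exists>r. r extreme_point_of saturated_region \<epsilon> \<and> (\<forall>r'\<in>saturated_region \<epsilon>. q \<bullet> r' \<le> q \<bullet> r)"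
proof -
  obtain r0 where r0: "r0 \<in> saturated_region \<epsilon>" "\<forall>r'\<in>saturated_region \<epsilon>. q \<bullet> r' \<le> q \<bullet> r0"
    using continuous_attains_sup[OF compact_saturated_region saturated_region_nonempty,
        of _ "(\<bullet>) q"] continuous_on_inner[OF continuous_on_const continuous_on_id]
    by metis
  let ?F = "saturated_region \<epsilon> \<inter> {r. q \<bullet> r = q \<bullet> r0}"
  have "compact ?F" "convex ?F" "?F \<noteq> {}"
    using r0 by (auto intro!: compact_Int_closed compact_saturated_region closed_hyperplane
        convex_Int convex_saturated_region convex_hyperplane)
  then obtain r where r: "r extreme_point_of ?F"
    using extreme_point_exists_convex by metis
  have "r extreme_point_of saturated_region \<epsilon>"
    by (rule extreme_point_of_face[THEN iffD1, THEN conjunct1, OF _ r])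
       (use r0 in \<open>auto intro!: face_of_Int_supporting_hyperplane_le convex_saturated_region\<close>)
  moreover have "q \<bullet> r = q \<bullet> r0" using r by (auto simp: extreme_point_of_def)
  ultimately show ?thesis using r0(2) by auto
qed

text \<open>The occupation vectors with rate \<open>r\<close> form a face, because a segment through one of them is
mapped to a segment through the extreme point \<open>r\<close>, hence to \<open>r\<close> alone.\<close>

lemma extreme_point_lifts:
  assumes "r extreme_point_of saturated_region \<epsilon>"
  shows "\<exists>v. v extreme_point_of occ_vectors \<epsilon> \<and> rate_vector (occ v) = r"
proof -
  let ?G = "occ_vectors \<epsilon> \<inter> (\<lambda>v. rate_vector (occ v)) -` {r}"
  have cont: "continuous_on UNIV (\<lambda>v. rate_vector (occ v))"
    by (intro linear_continuous_on linear_conv_bounded_linear[THEN iffD1] linear_rate_vector)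
  have "compact ?G"
    by (intro compact_Int_closed compact_occ_vectors closed_vimage cont) auto
  moreover have "convex ?G"
    by (intro convex_Int convex_occ_vectors convex_linear_vimage linear_rate_vector) auto
  moreover have "?G \<noteq> {}"
    using assms by (auto simp: extreme_point_of_def saturated_region_eq)
  ultimately obtain v where v: "v extreme_point_of ?G"
    using extreme_point_exists_convex by metis
  have "v \<notin> open_segment a b" if "a \<in> occ_vectors \<epsilon>" "b \<in> occ_vectors \<epsilon>" for a b
  proof
    assume "v \<in> open_segment a b"
    then obtain u where ab: "a \<noteq> b" and u: "0 < u" "u < 1" "v = (1 - u) *\<^sub>R a + u *\<^sub>R b"
      by (auto simp: in_segment)
    let ?R = "\<lambda>v. rate_vector (occ v)"
    have R: "r = (1 - u) *\<^sub>R ?R a + u *\<^sub>R ?R b"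
      using v u by (auto simp: extreme_point_of_def linear_add[OF linear_rate_vector]
          linear_cmul[OF linear_rate_vector])
    have in_region: "?R a \<in> saturated_region \<epsilon>" "?R b \<in> saturated_region \<epsilon>"
      using that by (auto simp: saturated_region_eq)
    have "r \<notin> open_segment (?R a) (?R b)"
      using assms in_region by (auto simp: extreme_point_of_def)
    then have eq: "?R a = ?R b"
      using R u by (auto simp: in_segment)
    then have "?R a = r" using R by (simp flip: scaleR_add_left)
    then have "a \<in> ?G" "b \<in> ?G" using eq that by auto
    then show False using v \<open>v \<in> open_segment a b\<close> by (auto simp: extreme_point_of_def)
  qed
  then show ?thesis using v by (auto simp: extreme_point_of_def)
qed

lemma sum_balance_defect: "(\<Sum>s\<in>UNIV. balance_defect \<epsilon> x s) = 0"
proof -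
  have "(\<Sum>s\<in>UNIV. \<Sum>s'\<in>UNIV. \<Sum>a\<in>UNIV. trans_prob \<epsilon> s' a s * x s' a)
      = (\<Sum>s'\<in>UNIV. \<Sum>a\<in>UNIV. \<Sum>s\<in>UNIV. trans_prob \<epsilon> s' a s * x s' a)"
    by (subst sum.swap) (intro sum.cong refl sum.swap)
  also have "\<dots> = (\<Sum>s'\<in>UNIV. \<Sum>a\<in>UNIV. x s' a)"
    by (simp add: sum_trans_prob flip: sum_distrib_right)
  finally show ?thesis by (simp add: balance_defect_def sum_subtractf)
qed

text \<open>Moving from \<open>v\<close> by a small multiple of \<open>d\<close> in either direction stays in the polytope, since
\<open>d\<close> preserves the equations and vanishes where the inequalities are tight.\<close>

lemma perturbed_occ_vector:
  assumes v: "v \<in> occ_vectors \<epsilon>" and d: "d \<noteq> 0"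
    and supp: "\<And>k. v $ k = 0 \<Longrightarrow> d $ k = 0"
    and mass: "total_mass (occ d) = 0" and bal: "\<And>s. balance_defect \<epsilon> (occ d) s = 0"
  shows "\<not> v extreme_point_of occ_vectors \<epsilon>"
proof
  assume ext: "v extreme_point_of occ_vectors \<epsilon>"
  let ?S = "{k. v $ k \<noteq> 0}"
  obtain k0 where "d $ k0 \<noteq> 0" using d by (auto simp: vec_eq_iff)
  then have ne: "?S \<noteq> {}" using supp by blast
  (* Every coordinate of t * d is then in absolute value at most the smallest positive coordinate of v. *)
  define t where "t = Min ((\<lambda>k. v $ k) ` ?S) / (norm d)"
  have vpos: "0 < v $ k" if "k \<in> ?S" for k
    using v that by (simp add: occ_vectors_iff less_le)
  have "0 < Min ((\<lambda>k. v $ k) ` ?S)" using ne vpos by (subst Min_gr_iff) auto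
  then have t: "0 < t" using d by (simp add: t_def)
  have bound: "t * \<bar>d $ k\<bar> \<le> v $ k" for k
  proof (cases "k \<in> ?S")
    case True
    have "t * \<bar>d $ k\<bar> \<le> t * norm d"
      using t by (intro mult_left_mono component_le_norm_cart) auto
    also have "\<dots> = Min ((\<lambda>k. v $ k) ` ?S)" using d by (simp add: t_def)
    also have "\<dots> \<le> v $ k" using True by (intro Min_le) auto
    finally show ?thesis .
  next
    case False then show ?thesis using supp by auto
  qed
  have mem: "v + u *\<^sub>R d \<in> occ_vectors \<epsilon>" if u: "\<bar>u\<bar> = t" for u
    unfolding occ_vectors_iff
  proof (intro conjI allI)
    fix k
    have "\<bar>u * d $ k\<bar> \<le> v $ k" using bound[of k] u by (simp add: abs_mult)
    then show "0 \<le> (v + u *\<^sub>R d) $ k" by (simp add: abs_le_iff)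
  qed (use v mass bal in \<open>auto simp: occ_vectors_iff linear_add[OF linear_balance_defect]
        linear_cmul[OF linear_balance_defect] linear_add[OF linear_total_mass]
        linear_cmul[OF linear_total_mass]\<close>)
  have "v + t *\<^sub>R d \<noteq> v + (- t) *\<^sub>R d"
    using d t by (auto simp: vec_eq_iff)
  then have "midpoint (v + t *\<^sub>R d) (v + (- t) *\<^sub>R d) \<in> open_segment (v + t *\<^sub>R d) (v + (- t) *\<^sub>R d)"
    by simp
  moreover have "midpoint (v + t *\<^sub>R d) (v + (- t) *\<^sub>R d) = v"
    by (simp add: midpoint_def flip: scaleR_add_left)
  ultimately have "v \<in> open_segment (v + t *\<^sub>R d) (v + (- t) *\<^sub>R d)" by (simp only:)
  moreover have "v + t *\<^sub>R d \<in> occ_vectors \<epsilon>" "v + (- t) *\<^sub>R d \<in> occ_vectors \<epsilon>"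
    using t by (intro mem; simp)+
  ultimately show False using ext[unfolded extreme_point_of_def] by blast
qed


text \<open>A state without mass receives no flow: every nonnegative term of the inflow of \<open>v\<close> vanishes, and
the support of \<open>d\<close> lies inside that of \<open>v\<close>.\<close>

lemma balance_defect_outside_support:
  assumes v: "v \<in> occ_vectors \<epsilon>" and \<epsilon>: "0 < \<epsilon>" "\<epsilon> < 1"
    and supp: "\<And>k. v $ k = 0 \<Longrightarrow> d $ k = 0"
    and s: "\<And>a. v $ (s, a) = 0"
  shows "balance_defect \<epsilon> (occ d) s = 0"
proof -
  have "(\<Sum>s'\<in>UNIV. \<Sum>a\<in>UNIV. trans_prob \<epsilon> s' a s * occ v s' a) = 0"
  proof -
    have "balance_defect \<epsilon> (occ v) s = 0" using v by (simp add: occ_vectors_iff)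
    moreover have "(\<Sum>a\<in>UNIV. occ v s a) = 0" using s by (simp add: occ_def)
    ultimately show ?thesis by (simp only: balance_defect_def)
  qed
  moreover have nn: "0 \<le> trans_prob \<epsilon> s' a s * occ v s' a" for s' a
    using v \<epsilon> by (auto simp: occ_vectors_iff occ_def intro!: mult_nonneg_nonneg trans_prob_nonneg)
  ultimately have z: "trans_prob \<epsilon> s' a s * occ v s' a = 0" for s' a
    by (simp add: sum_nonneg_eq_0_iff sum_nonneg)
  have "trans_prob \<epsilon> s' a s * occ d s' a = 0" for s' a
    using z[of s' a] supp[of "(s', a)"] by (auto simp: occ_def)
  moreover have "occ d s a = 0" for a using supp s by (simp add: occ_def)
  ultimately show ?thesis by (simp only: balance_defect_def sum.neutral_const diff_self)
qed

lemma dim_coordinate_subspace: "dim {x :: real ^ 'n. \<forall>i. i \<notin> d \<longrightarrow> x $ i = 0} = card d"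
  using dim_substandard_cart[where 'a = real] unfolding dim_vec_eq .

text \<open>A basic solution has no more nonzero coordinates than independent equations.  States without mass
balance automatically, so the equations that count are those of the states in use; if one of these
used both actions, the support would be larger than the number of equations and would carry a
nonzero perturbation.\<close>

lemma extreme_occ_vector_deterministic:
  assumes ext: "v extreme_point_of occ_vectors \<epsilon>" and \<epsilon>: "0 < \<epsilon>" "\<epsilon> < 1"
  shows "v $ (s1, True) = 0 \<or> v $ (s1, False) = 0"
proof (rule ccontr)
  assume both: "\<not> ?thesis"
  have v: "v \<in> occ_vectors \<epsilon>" using ext by (auto simp: extreme_point_of_def)
  define S where "S = {k. v $ k \<noteq> 0}"
  define W where "W = {d :: real ^ (state \<times> bool). \<forall>k. k \<notin> S \<longrightarrow> d $ k = 0}"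
  define Y where "Y = {y :: real ^ state. \<forall>s. s \<notin> fst ` S \<longrightarrow> y $ s = 0}"
  (* The balance defects sum to zero, so the equation at s1 is redundant and its slot can hold the
     normalization. *)
  define L where "L d = (\<chi> s. if s = s1 then total_mass (occ d) else balance_defect \<epsilon> (occ d) s)"
    for d :: "real ^ (state \<times> bool)"
  have lin: "linear L"
    by (rule linearI)
       (auto simp: L_def vec_eq_iff linear_add[OF linear_total_mass] linear_add[OF linear_balance_defect]
         linear_cmul[OF linear_total_mass] linear_cmul[OF linear_balance_defect])
  have "L ` W \<subseteq> Y"
  proof safe
    fix d assume d: "d \<in> W"
    show "L d \<in> Y"
      unfolding Y_def
    proof (intro CollectI allI impI)
      fix s assume s: "s \<notin> fst ` S"
      have "v $ (s, a) = 0" for a using s unfolding S_def by force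
      moreover have "d $ k = 0" if "v $ k = 0" for k
        using d that unfolding W_def S_def by blast
      ultimately have "balance_defect \<epsilon> (occ d) s = 0"
        by (intro balance_defect_outside_support[OF v \<epsilon>])
      moreover have "s \<noteq> s1" using s both unfolding S_def by force
      ultimately show "L d $ s = 0" by (simp add: L_def)
    qed
  qed
  then have "dim (L ` W) \<le> dim Y" by (rule dim_subset)
  also have "\<dots> = card (fst ` S)" unfolding Y_def by (rule dim_coordinate_subspace)
  also have "\<dots> < card S"
  proof -
    have "\<not> inj_on fst S" using both unfolding S_def inj_on_def by fastforce
    then show ?thesis
      by (meson card_image_le eq_card_imp_inj_on finite le_neq_implies_less)
  qed
  also have "\<dots> = dim W" unfolding W_def by (rule dim_coordinate_subspace[symmetric])
  (* More unknowns than equations: the actions in use outnumber the states in use. *)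
  finally have less: "dim (L ` W) < dim W" .
  have subW: "subspace W" unfolding W_def by (auto simp: subspace_def)
  have "\<not> inj_on L W"
    using less dim_image_eq[OF lin, of W] span_eq_iff[THEN iffD2, OF subW] by auto
  then obtain a b where ab: "a \<in> W" "b \<in> W" "L a = L b" "a \<noteq> b" by (auto simp: inj_on_def)
  define d where "d = a - b"
  have "d \<in> W" using ab subW by (auto simp: d_def subspace_diff)
  have Ld: "L d = 0" using ab linear_diff[OF lin] by (simp add: d_def)
  have mass: "total_mass (occ d) = 0"
    using arg_cong[OF Ld, of "\<lambda>y. y $ s1"] by (simp add: L_def)
  have bal': "balance_defect \<epsilon> (occ d) s = 0" if "s \<noteq> s1" for s
    using arg_cong[OF Ld, of "\<lambda>y. y $ s"] that by (simp add: L_def)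
  have "balance_defect \<epsilon> (occ d) s1 = (\<Sum>s\<in>UNIV. balance_defect \<epsilon> (occ d) s)"
    using bal' by (subst sum.remove[of _ s1]) auto
  then have bal: "balance_defect \<epsilon> (occ d) s = 0" for s
    using bal' by (cases "s = s1") (auto simp: sum_balance_defect)
  have "d $ k = 0" if "v $ k = 0" for k using \<open>d \<in> W\<close> that unfolding W_def S_def by blast
  then show False
    using perturbed_occ_vector[OF v _ _ mass bal] ab(4) ext by (auto simp: d_def)
qed

text \<open>If the server never switches, the two locations do not communicate, so mass at both locations could
be shifted from one to the other without violating any equation.\<close>

lemma extreme_staying_vector_one_location:
  assumes ext: "v extreme_point_of occ_vectors \<epsilon>"
    and stay: "\<And>s. v $ (s, False) = 0"
  shows "\<exists>m0. \<forall>s a. fst s \<noteq> m0 \<longrightarrow> v $ (s, a) = 0"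
proof (rule ccontr)
  assume neg: "\<not> ?thesis"
  have v: "v \<in> occ_vectors \<epsilon>" using ext by (auto simp: extreme_point_of_def)
  define \<mu> where "\<mu> m = (\<Sum>k\<in>{k. fst (fst k) = m}. v $ k)" for m
  have pos: "0 < \<mu> m" for m
  proof -
    obtain m' where m': "m' \<noteq> m" using that[of "move m False"] by (auto simp: move_def split: if_splits)
    obtain s a where "fst s \<noteq> m'" "v $ (s, a) \<noteq> 0" using neg by blast
    moreover from this have "fst s = m"
      using m' exhaust_2[of m] exhaust_2[of m'] exhaust_2[of "fst s"] by auto
    ultimately show ?thesis unfolding \<mu>_def using v
      by (intro sum_pos2[where i="(s, a)"]) (auto simp: occ_vectors_iff less_le)
  qed
  (* The weights are chosen so that the masses at the two locations cancel. *)
  define \<kappa> where "\<kappa> m = (if m = 1 then \<mu> 2 else - \<mu> 1)" for m :: 2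
  define d where "d = (\<chi> k. \<kappa> (fst (fst k)) * v $ k)"
  have bal: "balance_defect \<epsilon> (occ d) s = 0" for s
  proof -
    have "trans_prob \<epsilon> s' a s * occ d s' a = \<kappa> (fst s) * (trans_prob \<epsilon> s' a s * occ v s' a)" for s' a
      using stay[of s'] by (cases a) (auto simp: trans_prob_def d_def occ_def move_def)
    moreover have "occ d s a = \<kappa> (fst s) * occ v s a" for a by (simp add: d_def occ_def)
    ultimately have "balance_defect \<epsilon> (occ d) s = \<kappa> (fst s) * balance_defect \<epsilon> (occ v) s"
      by (simp only: balance_defect_def right_diff_distrib sum_distrib_left)
    then show ?thesis using v by (simp add: occ_vectors_iff)
  qed
  have "total_mass (occ d) = (\<Sum>k\<in>{k. fst (fst k) = 1} \<union> {k. fst (fst k) = 2}. d $ k)"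
    unfolding total_mass_eq_sum using exhaust_2 by (intro sum.cong) auto
  also have "\<dots> = (\<Sum>k\<in>{k. fst (fst k) = 1}. d $ k) + (\<Sum>k\<in>{k. fst (fst k) = 2}. d $ k)"
    by (intro sum.union_disjoint) auto
  also have "\<dots> = \<mu> 2 * \<mu> 1 + (- \<mu> 1) * \<mu> 2"
    unfolding \<mu>_def sum_distrib_left
    by (intro arg_cong2[where f="(+)"] sum.cong) (auto simp: d_def \<kappa>_def \<mu>_def)
  finally have mass: "total_mass (occ d) = 0" by simp
  obtain s a where "fst s \<noteq> 1" "v $ (s, a) \<noteq> 0" using neg by blast
  then have "d $ (s, a) \<noteq> 0" using pos[of 1] by (simp add: d_def \<kappa>_def)
  then have "d \<noteq> 0" by auto
  moreover have "d $ k = 0" if "v $ k = 0" for k using that by (simp add: d_def)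
  ultimately show False using perturbed_occ_vector[OF v _ _ mass bal] ext by blast
qed

section \<open>Policies with a single recurrent class\<close>

lemma induced_edges_iff:
  assumes "0 < \<epsilon>" "\<epsilon> < 1"
  shows "(s', s) \<in> induced_edges \<epsilon> \<pi> \<longleftrightarrow> fst s = move (fst s') (\<pi> s')"
  by (simp add: induced_edges_def trans_prob_pos_iff[OF assms])

text \<open>Each recurrent class contains \<open>z\<close> and is therefore the set of states reachable from \<open>z\<close>.\<close>

lemma unique_recurrent_class_if_accessible:
  assumes acc: "\<And>s. (s, z) \<in> (induced_edges \<epsilon> \<pi>)\<^sup>*"
  shows "\<exists>!R. recurrent_class \<epsilon> \<pi> R"
proof
  let ?E = "(induced_edges \<epsilon> \<pi>)\<^sup>*"
  show "recurrent_class \<epsilon> \<pi> (?E `` {z})"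
    unfolding recurrent_class_def using acc by (auto intro: rtrancl_trans)
  fix R assume R: "recurrent_class \<epsilon> \<pi> R"
  then obtain s where "s \<in> R" by (auto simp: recurrent_class_def)
  then have "z \<in> R" using R acc[of s] by (auto simp: recurrent_class_def)
  then show "R = ?E `` {z}" using R by (auto simp: recurrent_class_def)
qed

text \<open>From any state every channel state has positive probability in the next slot, so the location is
all that matters.  A single switching state is enough to leave its location.\<close>

lemma unique_recurrent_class_if_switching:
  assumes \<epsilon>: "0 < \<epsilon>" "\<epsilon> < 1" and switch: "\<not> \<pi> s1"
  shows "\<exists>!R. recurrent_class \<epsilon> \<pi> R"
proof -
  let ?E = "induced_edges \<epsilon> \<pi>"
  (* Leaving the location of s1 is always possible through s1, so a state at the other location is
     reached from everywhere. *)
  define z where "z = (move (fst s1) False, snd s1)"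
  have edge: "(s', s) \<in> ?E" if "fst s = move (fst s') (\<pi> s')" for s' s
    using induced_edges_iff[OF \<epsilon>] that by blast
  have s1z: "(s1, z) \<in> ?E" using switch by (intro edge) (simp add: z_def)
  have z_ne: "fst z \<noteq> fst s1" by (simp add: z_def move_def)
  have sw: "move (fst s) False = (if fst s = fst s1 then fst z else fst s1)" for s :: state
    using exhaust_2[of "fst s"] exhaust_2[of "fst s1"] by (auto simp: z_def move_def)
  have dich: "fst s = fst s1 \<or> fst s = fst z" for s :: state
    using exhaust_2[of "fst s"] exhaust_2[of "fst s1"] by (auto simp: z_def move_def)
  have "(s, z) \<in> ?E\<^sup>*" for s
  proof -
    have "(s, z) \<in> ?E \<or> (s, s1) \<in> ?E"
      using dich[of s] sw[of s] z_ne
      by (cases "\<pi> s") (auto intro!: edge simp: move_def)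
    then show ?thesis
    proof
      assume "(s, s1) \<in> ?E"
      from converse_rtrancl_into_rtrancl[OF this r_into_rtrancl[OF s1z]] show ?thesis .
    qed (rule r_into_rtrancl)
  qed
  then show ?thesis by (rule unique_recurrent_class_if_accessible)
qed

text \<open>An extreme point that uses a switch somewhere yields a policy with a single recurrent class as it
stands.  One that only stays has all its mass at one location \<open>m0\<close>; the actions at the
other location are then free, and switching there makes \<open>m0\<close> absorbing.\<close>

lemma ex_fbdc_choice:
  assumes \<epsilon>: "0 < \<epsilon>" "\<epsilon> < 1"
  shows "\<exists>\<pi>. fbdc_choice \<epsilon> q \<pi>"
proof -
  obtain r where r: "r extreme_point_of saturated_region \<epsilon>"
      "\<forall>r'\<in>saturated_region \<epsilon>. q \<bullet> r' \<le> q \<bullet> r"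
    using ex_optimal_extreme_point by blast
  obtain v where v: "v extreme_point_of occ_vectors \<epsilon>" "rate_vector (occ v) = r"
    using extreme_point_lifts[OF r(1)] by blast
  obtain \<pi> where \<pi>: "\<And>s a. a \<noteq> \<pi> s \<Longrightarrow> v $ (s, a) = 0" and sw: "\<exists>s. \<not> \<pi> s"
  proof (cases "\<forall>s. v $ (s, False) = 0")
    case True
    then obtain m0 where m0: "\<forall>s a. fst s \<noteq> m0 \<longrightarrow> v $ (s, a) = 0"
      using extreme_staying_vector_one_location[OF v(1)] by blast
    have "move m0 False \<noteq> m0" by (simp add: move_def)
    then have "\<exists>s :: state. fst s \<noteq> m0"
      by (intro exI[of _ "(move m0 False, undefined)"]) simp
    moreover have "v $ (s, a) = 0" if "a \<noteq> (fst s = m0)" for s a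
      using that True m0 by (cases a) auto
    ultimately show ?thesis by (rule that[of "\<lambda>s. fst s = m0", rotated])
  next
    case False
    have det: "a \<noteq> (v $ (s, False) = 0) \<Longrightarrow> v $ (s, a) = 0" for s a
      using extreme_occ_vector_deterministic[OF v(1) \<epsilon>, of s] by (cases a) auto
    have "\<exists>s. \<not> v $ (s, False) = 0" using False by simp
    with det show ?thesis by (rule that[of "\<lambda>s. v $ (s, False) = 0"])
  qed
  have "occ v \<in> occupation_polytope \<epsilon>"
    using v(1) by (auto simp: extreme_point_of_def occ_vectors_def)
  then have "attains \<epsilon> \<pi> r"
    unfolding attains_def using \<pi> v(2) by (intro bexI[of _ "occ v"]) (auto simp: occ_def)
  moreover have "\<exists>!R. recurrent_class \<epsilon> \<pi> R"
    using sw unique_recurrent_class_if_switching[OF \<epsilon>, of \<pi>] by metis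
  ultimately show ?thesis
    unfolding fbdc_choice_def using r by (intro exI[of _ \<pi>] conjI exI[of _ r])
qed

lemma closed_set_contains_recurrent_class:
  assumes "S \<noteq> {}" and closed: "\<And>s' s. s' \<in> S \<Longrightarrow> (s', s) \<in> induced_edges \<epsilon> \<pi> \<Longrightarrow> s \<in> S"
  shows "\<exists>R\<subseteq>S. recurrent_class \<epsilon> \<pi> R"
proof -
  let ?E = "(induced_edges \<epsilon> \<pi>)\<^sup>*"
  (* A state with a smallest reachable set is recurrent. *)
  obtain s0 where s0: "s0 \<in> S" "\<And>s. s \<in> S \<Longrightarrow> card (?E `` {s0}) \<le> card (?E `` {s})"
    using ex_has_least_nat[of "\<lambda>s. s \<in> S" _ "\<lambda>s. card (?E `` {s})"] assms(1) by blast
  have sub: "?E `` {s0} \<subseteq> S"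
  proof
    fix s assume "s \<in> ?E `` {s0}"
    then have "(s0, s) \<in> ?E" by simp
    then show "s \<in> S" by (induction rule: rtrancl_induct) (use s0(1) closed in blast)+
  qed
  have "\<forall>s\<in>?E `` {s0}. ?E `` {s} = ?E `` {s0}"
  proof (rule ballI)
    fix s assume reach: "s \<in> ?E `` {s0}"
    show "?E `` {s} = ?E `` {s0}"
    proof (rule card_seteq)
      show "?E `` {s} \<subseteq> ?E `` {s0}" using reach by (auto intro: rtrancl_trans)
      show "card (?E `` {s0}) \<le> card (?E `` {s})" by (rule s0(2)) (use sub reach in auto)
    qed simp
  qed
  moreover have "?E `` {s0} \<noteq> {}" by blast
  ultimately have "recurrent_class \<epsilon> \<pi> (?E `` {s0})" unfolding recurrent_class_def by blast
  then show ?thesis using sub by blast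
qed

text \<open>The positive part of a signed invariant function is again invariant, and flow along an edge keeps
it positive.\<close>

lemma stationary_positive_part_closed:
  fixes f :: "state \<Rightarrow> real"
  assumes \<epsilon>: "0 < \<epsilon>" "\<epsilon> < 1"
    and stat: "\<And>s. f s = (\<Sum>s'\<in>UNIV. f s' * trans_prob \<epsilon> s' (\<pi> s') s)"
    and pos: "0 < f s'" and edge: "(s', s) \<in> induced_edges \<epsilon> \<pi>"
  shows "0 < f s"
proof -
  let ?g = "\<lambda>s. max (f s) 0"
  let ?P = "\<lambda>s' s. trans_prob \<epsilon> s' (\<pi> s') s"
  have nn: "0 \<le> ?g s' * ?P s' s" for s' s
    using trans_prob_nonneg[OF \<epsilon>] by simp
  (* The positive part is subinvariant; as total mass is preserved, equality holds everywhere. *)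
  have le: "?g s \<le> (\<Sum>s'\<in>UNIV. ?g s' * ?P s' s)" for s
  proof -
    have "f s \<le> (\<Sum>s'\<in>UNIV. ?g s' * ?P s' s)"
      by (subst stat) (intro sum_mono mult_right_mono trans_prob_nonneg \<epsilon>, simp)
    then show ?thesis using nn by (simp add: sum_nonneg)
  qed
  have "(\<Sum>s\<in>UNIV. \<Sum>s'\<in>UNIV. ?g s' * ?P s' s) = (\<Sum>s'\<in>UNIV. \<Sum>s\<in>UNIV. ?g s' * ?P s' s)"
    by (rule sum.swap)
  also have "\<dots> = (\<Sum>s\<in>UNIV. ?g s)"
    by (simp add: sum_trans_prob flip: sum_distrib_left)
  finally have "(\<Sum>s\<in>UNIV. (\<Sum>s'\<in>UNIV. ?g s' * ?P s' s) - ?g s) = 0"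
    by (simp add: sum_subtractf)
  then have eq: "?g s = (\<Sum>s'\<in>UNIV. ?g s' * ?P s' s)" for s
    using le by (subst (asm) sum_nonneg_eq_0_iff) auto
  have "0 < ?g s' * ?P s' s" using pos edge by (simp add: induced_edges_def)
  also have "\<dots> \<le> (\<Sum>s'\<in>UNIV. ?g s' * ?P s' s)"
    using nn by (intro member_le_sum) auto
  also have "\<dots> = ?g s" by (rule eq[symmetric])
  finally show ?thesis by auto
qed

text \<open>An invariant function with zero sum that did not vanish would be positive on one closed set and
negative on another; the two would contain different recurrent classes.\<close>

lemma stationary_difference_zero:
  fixes f :: "state \<Rightarrow> real"
  assumes \<epsilon>: "0 < \<epsilon>" "\<epsilon> < 1" and uniq: "\<exists>!R. recurrent_class \<epsilon> \<pi> R"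
    and stat: "\<And>s. f s = (\<Sum>s'\<in>UNIV. f s' * trans_prob \<epsilon> s' (\<pi> s') s)"
    and zero: "(\<Sum>s\<in>UNIV. f s) = 0"
  shows "f s = 0"
proof (rule ccontr)
  assume ne: "f s \<noteq> 0"
  have stat': "- f s = (\<Sum>s'\<in>UNIV. - f s' * trans_prob \<epsilon> s' (\<pi> s') s)" for s
  proof -
    have "(\<Sum>s'\<in>UNIV. - f s' * trans_prob \<epsilon> s' (\<pi> s') s)
        = - (\<Sum>s'\<in>UNIV. f s' * trans_prob \<epsilon> s' (\<pi> s') s)"
      by (simp add: sum_negf)
    then show ?thesis by (simp only: stat[of s, symmetric])
  qed
  have "\<exists>s. 0 < f s"
  proof (rule ccontr)
    assume "\<not> ?thesis"
    then have "\<forall>s. 0 \<le> - f s" by (auto simp: not_less)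
    then have "\<forall>s\<in>UNIV. - f s = 0"
      using zero by (subst sum_nonneg_eq_0_iff[symmetric]) (auto simp: sum_negf)
    then show False using ne by auto
  qed
  then have "\<exists>R\<subseteq>{s. 0 < f s}. recurrent_class \<epsilon> \<pi> R"
    using stationary_positive_part_closed[OF \<epsilon> stat]
    by (intro closed_set_contains_recurrent_class) simp_all
  then obtain R1 where R1: "R1 \<subseteq> {s. 0 < f s}" "recurrent_class \<epsilon> \<pi> R1" by metis
  have "\<exists>s. 0 < - f s"
  proof (rule ccontr)
    assume "\<not> ?thesis"
    then have "\<forall>s. 0 \<le> f s" by (auto simp: not_less)
    then have "\<forall>s\<in>UNIV. f s = 0"
      using zero by (subst sum_nonneg_eq_0_iff[symmetric]) auto
    then show False using ne by auto
  qed
  then have "\<exists>R\<subseteq>{s. 0 < - f s}. recurrent_class \<epsilon> \<pi> R"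
    using stationary_positive_part_closed[OF \<epsilon> stat']
    by (intro closed_set_contains_recurrent_class) simp_all
  then obtain R2 where R2: "R2 \<subseteq> {s. 0 < - f s}" "recurrent_class \<epsilon> \<pi> R2" by metis
  have "R1 = R2" using uniq R1(2) R2(2) by blast
  then have "R1 = {}" using R1(1) R2(1) by force
  then show False using R1(2) by (simp add: recurrent_class_def)
qed

lemma attained_rate_unique:
  assumes \<epsilon>: "0 < \<epsilon>" "\<epsilon> < 1" and uniq: "\<exists>!R. recurrent_class \<epsilon> \<pi> R"
    and r: "attains \<epsilon> \<pi> r" and r': "attains \<epsilon> \<pi> r'"
  shows "r = r'"
proof -
  obtain x where x: "x \<in> occupation_polytope \<epsilon>" "\<forall>s a. a \<noteq> \<pi> s \<longrightarrow> x s a = 0" "rate_vector x = r"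
    using r by (auto simp: attains_def)
  obtain y where y: "y \<in> occupation_polytope \<epsilon>" "\<forall>s a. a \<noteq> \<pi> s \<longrightarrow> y s a = 0" "rate_vector y = r'"
    using r' by (auto simp: attains_def)
  have sum_eq: "(\<Sum>a\<in>UNIV. g a * z s a) = g (\<pi> s) * z s (\<pi> s)"
    if "\<forall>s a. a \<noteq> \<pi> s \<longrightarrow> z s a = 0" for z :: "state \<Rightarrow> bool \<Rightarrow> real" and s g
    using that[rule_format, of "\<not> \<pi> s" s] by (cases "\<pi> s") (simp_all add: UNIV_bool)
  have pol: "z s (\<pi> s) = (\<Sum>s'\<in>UNIV. z s' (\<pi> s') * trans_prob \<epsilon> s' (\<pi> s') s)"
      "(\<Sum>s\<in>UNIV. z s (\<pi> s)) = 1"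
    if "z \<in> occupation_polytope \<epsilon>" "\<forall>s a. a \<noteq> \<pi> s \<longrightarrow> z s a = 0" for z s
  proof -
    have one: "(\<Sum>a\<in>UNIV. z s a) = z s (\<pi> s)" for s
      using sum_eq[OF that(2), where g="\<lambda>_. 1"] by simp
    have "(\<Sum>s\<in>UNIV. \<Sum>a\<in>UNIV. z s a) = 1"
      using that(1) unfolding occupation_polytope_def by blast
    then show "(\<Sum>s\<in>UNIV. z s (\<pi> s)) = 1" by (simp only: one)
    have "(\<Sum>a\<in>UNIV. z s a) = (\<Sum>s'\<in>UNIV. \<Sum>a\<in>UNIV. trans_prob \<epsilon> s' a s * z s' a)"
      using that(1) unfolding occupation_polytope_def by blast
    then show "z s (\<pi> s) = (\<Sum>s'\<in>UNIV. z s' (\<pi> s') * trans_prob \<epsilon> s' (\<pi> s') s)"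
      unfolding one by (subst (asm) sum_eq[OF that(2)]) (simp_all add: mult.commute)
  qed
  let ?f = "\<lambda>s. x s (\<pi> s) - y s (\<pi> s)"
  have "?f s = (\<Sum>s'\<in>UNIV. ?f s' * trans_prob \<epsilon> s' (\<pi> s') s)" for s
    using pol(1)[OF x(1,2), of s] pol(1)[OF y(1,2), of s]
    by (simp only: sum_subtractf left_diff_distrib)
  then have "?f s = 0" for s
    by (rule stationary_difference_zero[OF \<epsilon> uniq])
       (simp add: sum_subtractf pol(2)[OF x(1,2)] pol(2)[OF y(1,2)])
  then have "x s a = y s a" for s a
    using x(2) y(2) by (cases "a = \<pi> s") auto
  then have "x = y" by (simp add: fun_eq_iff)
  then show ?thesis using x(3) y(3) by simp
qed

section \<open>Time averages of controlled chains\<close>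

text \<open>The laws of state and action over time under some policy of the saturated system: the state
marginal of the next slot is obtained from the current law through the transition probabilities.\<close>

definition occupation_flow :: "real \<Rightarrow> (nat \<Rightarrow> state \<Rightarrow> bool \<Rightarrow> real) \<Rightarrow> bool" where
  "occupation_flow \<epsilon> y \<longleftrightarrow>
     (\<forall>t s a. 0 \<le> y t s a) \<and> (\<forall>t. total_mass (y t) = 1) \<and>
     (\<forall>t s. (\<Sum>a\<in>UNIV. y (Suc t) s a) = (\<Sum>s'\<in>UNIV. \<Sum>a\<in>UNIV. trans_prob \<epsilon> s' a s * y t s' a))"

definition time_average :: "(nat \<Rightarrow> state \<Rightarrow> bool \<Rightarrow> real) \<Rightarrow> nat \<Rightarrow> state \<Rightarrow> bool \<Rightarrow> real" where
  "time_average y n s a = (\<Sum>t<n. y t s a) / real n"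

lemma occupation_flow_le_1:
  assumes "occupation_flow \<epsilon> y"
  shows "(\<Sum>a\<in>UNIV. y t s a) \<le> 1" "y t s a \<le> 1"
proof -
  have nn: "0 \<le> y t s a" for s a using assms by (simp add: occupation_flow_def)
  have "(\<Sum>a\<in>UNIV. y t s a) \<le> (\<Sum>s\<in>UNIV. \<Sum>a\<in>UNIV. y t s a)"
    using nn by (intro member_le_sum[where f = "\<lambda>s. \<Sum>a\<in>UNIV. y t s a"]) (auto intro: sum_nonneg)
  also have "\<dots> = 1" using assms by (simp add: occupation_flow_def total_mass_def)
  finally show 1: "(\<Sum>a\<in>UNIV. y t s a) \<le> 1" .
  have "y t s a \<le> (\<Sum>a\<in>UNIV. y t s a)" using nn by (intro member_le_sum) auto
  then show "y t s a \<le> 1" using 1 by simp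
qed

text \<open>The balance equations of the time average telescope to a boundary term of order \<open>1 / n\<close>.\<close>

lemma balance_defect_time_average:
  assumes "occupation_flow \<epsilon> y"
  shows "balance_defect \<epsilon> (time_average y n) s
       = ((\<Sum>a\<in>UNIV. y 0 s a) - (\<Sum>a\<in>UNIV. y n s a)) / real n"
proof -
  have "(\<Sum>s'\<in>UNIV. \<Sum>a\<in>UNIV. trans_prob \<epsilon> s' a s * time_average y n s' a)
      = (\<Sum>s'\<in>UNIV. \<Sum>t<n. \<Sum>a\<in>UNIV. trans_prob \<epsilon> s' a s * y t s' a / real n)"
    unfolding time_average_def sum_divide_distrib sum_distrib_left times_divide_eq_right
    by (intro sum.cong refl sum.swap)
  also have "\<dots> = (\<Sum>t<n. \<Sum>s'\<in>UNIV. \<Sum>a\<in>UNIV. trans_prob \<epsilon> s' a s * y t s' a) / real n"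
    unfolding sum_divide_distrib by (rule sum.swap)
  also have "\<dots> = (\<Sum>t<n. \<Sum>a\<in>UNIV. y (Suc t) s a) / real n"
    using assms by (simp add: occupation_flow_def)
  finally have 1: "(\<Sum>s'\<in>UNIV. \<Sum>a\<in>UNIV. trans_prob \<epsilon> s' a s * time_average y n s' a)
      = (\<Sum>t<n. \<Sum>a\<in>UNIV. y (Suc t) s a) / real n" .
  have 2: "(\<Sum>a\<in>UNIV. time_average y n s a) = (\<Sum>t<n. \<Sum>a\<in>UNIV. y t s a) / real n"
    unfolding time_average_def sum_divide_distrib by (rule sum.swap)
  have "(\<Sum>t<n. (\<Sum>a\<in>UNIV. y t s a) - (\<Sum>a\<in>UNIV. y (Suc t) s a))
      = (\<Sum>a\<in>UNIV. y 0 s a) - (\<Sum>a\<in>UNIV. y n s a)"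
    by (rule sum_lessThan_telescope')
  then show ?thesis
    unfolding balance_defect_def 1 2 by (simp only: sum_subtractf diff_divide_distrib[symmetric])
qed

lemma total_mass_time_average:
  assumes "occupation_flow \<epsilon> y" "0 < n"
  shows "total_mass (time_average y n) = 1"
proof -
  have "total_mass (time_average y n) = (\<Sum>s\<in>UNIV. \<Sum>t<n. \<Sum>a\<in>UNIV. y t s a / real n)"
    unfolding total_mass_def time_average_def sum_divide_distrib by (intro sum.cong refl sum.swap)
  also have "\<dots> = (\<Sum>t<n. total_mass (y t)) / real n"
    unfolding total_mass_def sum_divide_distrib by (rule sum.swap)
  finally show ?thesis using assms by (simp add: occupation_flow_def)
qed

text \<open>The average up to \<open>n\<close> lies in a compact cube and violates the balance equations by at most
\<open>1 / n\<close>, so limit points along any sequence of horizons satisfy them exactly.\<close>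

lemma time_average_limit_point:
  fixes f :: "nat \<Rightarrow> nat"
  assumes y: "occupation_flow \<epsilon> y" and f: "strict_mono f"
  shows "\<exists>x\<in>occupation_polytope \<epsilon>. \<exists>g. strict_mono g \<and>
           (\<forall>s a. (\<lambda>n. time_average y (f (g n)) s a) \<longlonglongrightarrow> x s a)"
proof -
  define v where "v n = (\<chi> k. time_average y (f n) (fst k) (snd k))" for n
  have occ_v: "occ (v n) = time_average y (f n)" for n
    unfolding v_def by (rule occ_surj)
  have nn: "0 \<le> v n $ k" for n k
    using y by (auto simp: v_def time_average_def occupation_flow_def intro!: divide_nonneg_nonneg sum_nonneg)
  have "v n $ k \<le> 1" for n k
  proof -
    have "(\<Sum>t<f n. y t (fst k) (snd k)) \<le> (\<Sum>t<f n. 1)"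
      by (intro sum_mono occupation_flow_le_1[OF y])
    then show ?thesis by (simp add: v_def time_average_def divide_le_eq)
  qed
  then have "\<forall>n. v n \<in> cbox 0 1" using nn by (auto simp: mem_box_cart)
  then have "\<exists>l g. strict_mono g \<and> (v \<circ> g) \<longlonglongrightarrow> l"
    using compact_imp_seq_compact[OF compact_cbox[of 0 "1 :: real ^ (state \<times> bool)"],
        unfolded seq_compact_def, THEN spec, of v] by metis
  then obtain l g where g: "strict_mono g" and lim: "(v \<circ> g) \<longlonglongrightarrow> l" by blast
  have lim_lin: "(\<lambda>n. h (v (g n))) \<longlonglongrightarrow> h l" if "linear h" for h :: "_ \<Rightarrow> real"
    using lim bounded_linear.tendsto[of h] that by (auto simp: linear_conv_bounded_linear comp_def)
  have comp: "(\<lambda>n. v (g n) $ k) \<longlonglongrightarrow> l $ k" for k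
    using tendsto_vec_nth[OF lim, of k] by (simp add: comp_def)
  have fg: "strict_mono (f \<circ> g)" using f g by (rule strict_mono_o)
  have fg_inf: "filterlim (\<lambda>n. real (f (g n))) at_top sequentially"
    using filterlim_compose[OF filterlim_real_sequentially filterlim_subseq[OF fg]] by (simp add: comp_def)
  have "l \<in> occ_vectors \<epsilon>"
    unfolding occ_vectors_iff
  proof (intro conjI allI)
    show "0 \<le> l $ k" for k
      by (rule tendsto_lowerbound[OF comp]) (auto simp: nn)
    have "eventually (\<lambda>n. total_mass (occ (v (g n))) = 1) sequentially"
      using eventually_gt_at_top[of 0]
    proof eventually_elim
      case (elim n)
      then have "0 < f (g n)" using seq_suble[OF fg, of n] by simp
      then show ?case unfolding occ_v by (rule total_mass_time_average[OF y])
    qed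
    then have "(\<lambda>n. total_mass (occ (v (g n)))) \<longlonglongrightarrow> 1" by (rule tendsto_eventually)
    then show "total_mass (occ l) = 1"
      using lim_lin[OF linear_total_mass] LIMSEQ_unique by blast
    show "balance_defect \<epsilon> (occ l) s = 0" for s
    proof -
      have "(\<lambda>n. balance_defect \<epsilon> (occ (v (g n))) s) \<longlonglongrightarrow> 0"
      proof (rule Lim_null_comparison)
        show "(\<lambda>n. 1 / real (f (g n))) \<longlonglongrightarrow> 0"
          by (rule real_tendsto_divide_at_top[OF tendsto_const fg_inf])
        have "\<bar>(\<Sum>a\<in>UNIV. y 0 s a) - (\<Sum>a\<in>UNIV. y n s a)\<bar> \<le> 1" for n
        proof -
          have "0 \<le> (\<Sum>a\<in>UNIV. y t s a)" for t
            using y by (intro sum_nonneg) (simp add: occupation_flow_def)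
          from this[of 0] this[of n] show ?thesis
            using occupation_flow_le_1(1)[OF y, of 0 s] occupation_flow_le_1(1)[OF y, of n s] by linarith
        qed
        then show "\<forall>\<^sub>F n in sequentially. norm (balance_defect \<epsilon> (occ (v (g n))) s) \<le> 1 / real (f (g n))"
          unfolding occ_v balance_defect_time_average[OF y]
          by (simp add: abs_divide divide_right_mono)
      qed
      then show ?thesis using lim_lin[OF linear_balance_defect] LIMSEQ_unique by blast
    qed
  qed
  then have "occ l \<in> occupation_polytope \<epsilon>" by (simp add: occ_vectors_def)
  moreover have "(\<lambda>n. time_average y (f (g n)) s a) \<longlonglongrightarrow> occ l s a" for s a
    using comp[of "(s, a)"] by (simp add: v_def occ_def)
  ultimately show ?thesis using g by blast
qed

lemma tendsto_rate_vector:
  assumes "\<And>s a. (\<lambda>n. X n s a) \<longlonglongrightarrow> x s a"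
  shows "(\<lambda>n. \<Sum>s\<in>UNIV. \<Sum>a\<in>UNIV. X n s a * reward i s a) \<longlonglongrightarrow> rate_vector x $ i"
  unfolding rate_vector_def vec_lambda_beta by (intro tendsto_sum tendsto_mult_right assms)

primrec chain_dist :: "real \<Rightarrow> (state \<Rightarrow> bool) \<Rightarrow> state \<Rightarrow> nat \<Rightarrow> state \<Rightarrow> real" where
  "chain_dist \<epsilon> \<pi> s0 0 = (\<lambda>s. of_bool (s = s0))"
| "chain_dist \<epsilon> \<pi> s0 (Suc k) =
     (\<lambda>s. \<Sum>s'\<in>UNIV. chain_dist \<epsilon> \<pi> s0 k s' * trans_prob \<epsilon> s' (\<pi> s') s)"

lemma chain_dist_nonneg:
  assumes "0 < \<epsilon>" "\<epsilon> < 1"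
  shows "0 \<le> chain_dist \<epsilon> \<pi> s0 k s"
  by (induction k arbitrary: s) (auto intro!: sum_nonneg mult_nonneg_nonneg trans_prob_nonneg[OF assms])

lemma sum_chain_dist: "(\<Sum>s\<in>UNIV. chain_dist \<epsilon> \<pi> s0 k s) = 1"
proof (induction k)
  case 0 show ?case by (simp add: of_bool_def)
next
  case (Suc k)
  have "(\<Sum>s\<in>UNIV. chain_dist \<epsilon> \<pi> s0 (Suc k) s)
      = (\<Sum>s'\<in>UNIV. \<Sum>s\<in>UNIV. chain_dist \<epsilon> \<pi> s0 k s' * trans_prob \<epsilon> s' (\<pi> s') s)"
    unfolding chain_dist.simps by (rule sum.swap)
  also have "\<dots> = 1" using Suc by (simp add: sum_trans_prob flip: sum_distrib_left)
  finally show ?case .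
qed

lemma sum_at_action:
  "(\<Sum>a\<in>UNIV. g a * (if a = b then c else 0)) = g b * (c :: real)"
  for b :: bool
  by (cases b) (simp_all add: UNIV_bool)

lemma chain_dist_occupation_flow:
  assumes "0 < \<epsilon>" "\<epsilon> < 1"
  shows "occupation_flow \<epsilon> (\<lambda>t s a. if a = \<pi> s then chain_dist \<epsilon> \<pi> s0 t s else 0)"
proof -
  have one: "(\<Sum>a\<in>UNIV. if a = b then c else 0) = (c :: real)" for b :: bool and c
    using sum_at_action[of "\<lambda>_. 1" b c] by simp
  show ?thesis
    unfolding occupation_flow_def total_mass_def sum_at_action one
    using chain_dist_nonneg[OF assms] by (simp add: sum_chain_dist mult.commute)
qed

definition mean_reward :: "real \<Rightarrow> (state \<Rightarrow> bool) \<Rightarrow> state \<Rightarrow> 2 \<Rightarrow> nat \<Rightarrow> real" where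
  "mean_reward \<epsilon> \<pi> s0 i k = (\<Sum>s\<in>UNIV. chain_dist \<epsilon> \<pi> s0 k s * reward i s (\<pi> s))"

text \<open>Every limit point of the averages is a stationary law of the chain of \<open>\<pi>\<close>, and by uniqueness
its rate is \<open>r\<close>; a bounded sequence with a single limit point converges.\<close>

lemma mean_reward_average_tendsto:
  assumes \<epsilon>: "0 < \<epsilon>" "\<epsilon> < 1" and uniq: "\<exists>!R. recurrent_class \<epsilon> \<pi> R" and r: "attains \<epsilon> \<pi> r"
  shows "(\<lambda>n. (\<Sum>k<n. mean_reward \<epsilon> \<pi> s0 i k) / real n) \<longlonglongrightarrow> r $ i"
proof (rule ccontr)
  let ?X = "\<lambda>n. (\<Sum>k<n. mean_reward \<epsilon> \<pi> s0 i k) / real n"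
  define y where "y = (\<lambda>t s a. if a = \<pi> s then chain_dist \<epsilon> \<pi> s0 t s else 0)"
  have X: "?X n = (\<Sum>s\<in>UNIV. \<Sum>a\<in>UNIV. time_average y n s a * reward i s a)" for n
  proof -
    have "(\<Sum>s\<in>UNIV. \<Sum>a\<in>UNIV. time_average y n s a * reward i s a)
        = (\<Sum>s\<in>UNIV. \<Sum>a\<in>UNIV. \<Sum>t<n. y t s a * reward i s a) / real n"
      by (simp add: time_average_def sum_divide_distrib sum_distrib_right)
    also have "(\<Sum>s\<in>UNIV. \<Sum>a\<in>UNIV. \<Sum>t<n. y t s a * reward i s a)
        = (\<Sum>s\<in>UNIV. \<Sum>t<n. \<Sum>a\<in>UNIV. y t s a * reward i s a)"
      by (intro sum.cong refl sum.swap)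
    also have "\<dots> = (\<Sum>t<n. \<Sum>s\<in>UNIV. \<Sum>a\<in>UNIV. y t s a * reward i s a)"
      by (rule sum.swap)
    also have "\<dots> = (\<Sum>t<n. mean_reward \<epsilon> \<pi> s0 i t)"
      unfolding mean_reward_def y_def
      by (intro sum.cong refl) (simp only: mult.commute sum_at_action)
    finally show ?thesis ..
  qed
  assume "\<not> ?X \<longlonglongrightarrow> r $ i"
  then obtain e where e: "0 < e" "\<not> eventually (\<lambda>n. dist (?X n) (r $ i) < e) sequentially"
    by (auto simp: tendsto_iff)
  then obtain f :: "nat \<Rightarrow> nat" where f: "strict_mono f" "\<And>n. \<not> dist (?X (f n)) (r $ i) < e"
    using not_eventually_sequentiallyD by blast
  have flow: "occupation_flow \<epsilon> y"
    unfolding y_def by (rule chain_dist_occupation_flow[OF \<epsilon>])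
  obtain x g where x: "x \<in> occupation_polytope \<epsilon>" and g: "strict_mono g"
    and lim: "\<And>s a. (\<lambda>n. time_average y (f (g n)) s a) \<longlonglongrightarrow> x s a"
    using time_average_limit_point[OF flow f(1)] by blast
  have "x s a = 0" if "a \<noteq> \<pi> s" for s a
  proof -
    have "time_average y n s a = 0" for n using that by (simp add: time_average_def y_def)
    then show ?thesis using LIMSEQ_unique[OF lim[of s a]] by simp
  qed
  then have "attains \<epsilon> \<pi> (rate_vector x)"
    unfolding attains_def using x by (intro bexI[of _ x]) auto
  then have "rate_vector x = r" by (rule attained_rate_unique[OF \<epsilon> uniq _ r])
  then have "(\<lambda>n. ?X (f (g n))) \<longlonglongrightarrow> r $ i"
    unfolding X using tendsto_rate_vector[of "\<lambda>n. time_average y (f (g n))", OF lim] by simp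
  then have "eventually (\<lambda>n. dist (?X (f (g n))) (r $ i) < e) sequentially"
    using e(1) unfolding tendsto_iff by blast
  then show False using f(2) by simp
qed

text \<open>Convergence is uniform because there are only finitely many policies, initial states and queues,
and the attained rate is determined by the policy.\<close>

lemma ex_good_frame_length:
  assumes \<epsilon>: "0 < \<epsilon>" "\<epsilon> < 1" and "0 < \<eta>"
  shows "\<exists>T>0. \<forall>\<pi> r s0 i. (\<exists>!R. recurrent_class \<epsilon> \<pi> R) \<longrightarrow> attains \<epsilon> \<pi> r \<longrightarrow>
           real T * (r $ i - \<eta>) \<le> (\<Sum>k<T. mean_reward \<epsilon> \<pi> s0 i k)"
proof -
  let ?P = "\<lambda>T \<pi> s0 i. \<forall>r. (\<exists>!R. recurrent_class \<epsilon> \<pi> R) \<longrightarrow> attains \<epsilon> \<pi> r \<longrightarrow>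
           real T * (r $ i - \<eta>) \<le> (\<Sum>k<T. mean_reward \<epsilon> \<pi> s0 i k)"
  have ev: "eventually (\<lambda>T. ?P T \<pi> s0 i) sequentially" for \<pi> s0 i
  proof (cases "(\<exists>!R. recurrent_class \<epsilon> \<pi> R) \<and> (\<exists>r. attains \<epsilon> \<pi> r)")
    case True
    then obtain r where uniq: "\<exists>!R. recurrent_class \<epsilon> \<pi> R" and r: "attains \<epsilon> \<pi> r" by blast
    have "eventually (\<lambda>T. r $ i - \<eta> < (\<Sum>k<T. mean_reward \<epsilon> \<pi> s0 i k) / real T) sequentially"
      by (rule order_tendstoD[OF mean_reward_average_tendsto[OF \<epsilon> uniq r]]) (use \<open>0 < \<eta>\<close> in simp)
    then show ?thesis
      using eventually_gt_at_top[of 0]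
    proof eventually_elim
      case (elim T)
      then have le: "real T * (r $ i - \<eta>) \<le> (\<Sum>k<T. mean_reward \<epsilon> \<pi> s0 i k)"
        by (simp add: field_simps)
      show ?case
      proof (intro allI impI)
        fix r' assume "attains \<epsilon> \<pi> r'"
        then have "r' = r" using attained_rate_unique[OF \<epsilon> uniq _ r] by simp
        with le show "real T * (r' $ i - \<eta>) \<le> (\<Sum>k<T. mean_reward \<epsilon> \<pi> s0 i k)" by simp
      qed
    qed
  next
    case False
    show ?thesis
    proof (intro always_eventually allI impI)
      fix T r assume "\<exists>!R. recurrent_class \<epsilon> \<pi> R" "attains \<epsilon> \<pi> r"
      with False show "real T * (r $ i - \<eta>) \<le> (\<Sum>k<T. mean_reward \<epsilon> \<pi> s0 i k)" by metis
    qed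
  qed
  have all: "eventually (\<lambda>T. \<forall>\<pi> s0 i. ?P T \<pi> s0 i) sequentially"
    by (rule eventually_all_finite)+ (rule ev)
  have "\<exists>T. 0 < T \<and> (\<forall>\<pi> s0 i. ?P T \<pi> s0 i)"
    by (rule eventually_happens'[OF sequentially_bot eventually_conj[OF eventually_gt_at_top all]])
  then obtain T where T: "0 < T \<and> (\<forall>\<pi> s0 i. ?P T \<pi> s0 i)" ..
  show ?thesis
  proof (intro exI[of _ T] conjI allI impI)
    show "0 < T" using T by (rule conjunct1)
    show "real T * (r $ i - \<eta>) \<le> (\<Sum>k<T. mean_reward \<epsilon> \<pi> s0 i k)"
      if "\<exists>!R. recurrent_class \<epsilon> \<pi> R" "attains \<epsilon> \<pi> r" for \<pi> r s0 i
      using T[THEN conjunct2, rule_format, OF that] .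
  qed
qed

section \<open>Measurable choice of frame policies\<close>

text \<open>The rate \<open>r\<close> attained by \<open>\<pi>\<close> is unique, so the queue vectors for which \<open>\<pi>\<close> is allowed are cut
out by the closed half-spaces \<open>q \<bullet> r' \<le> q \<bullet> r\<close>.\<close>

lemma closed_fbdc_choice:
  assumes \<epsilon>: "0 < \<epsilon>" "\<epsilon> < 1"
  shows "closed {q. fbdc_choice \<epsilon> q \<pi>}"
proof (cases "\<exists>r. (\<exists>!R. recurrent_class \<epsilon> \<pi> R) \<and> attains \<epsilon> \<pi> r \<and> r extreme_point_of saturated_region \<epsilon>")
  case True
  then obtain r where r: "\<exists>!R. recurrent_class \<epsilon> \<pi> R" "attains \<epsilon> \<pi> r"
      "r extreme_point_of saturated_region \<epsilon>" by blast
  have "fbdc_choice \<epsilon> q \<pi> \<longleftrightarrow> (\<forall>r'\<in>saturated_region \<epsilon>. q \<bullet> r' \<le> q \<bullet> r)" for q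
    unfolding fbdc_choice_def using r attained_rate_unique[OF \<epsilon> r(1) r(2)] by metis
  then have "{q. fbdc_choice \<epsilon> q \<pi>} = (\<Inter>r'\<in>saturated_region \<epsilon>. {q. q \<bullet> r' \<le> q \<bullet> r})"
    by auto
  moreover have "closed {q. q \<bullet> r' \<le> q \<bullet> r}" for r'
    by (intro closed_Collect_le continuous_intros)
  ultimately show ?thesis by (simp add: closed_INT)
next
  case False
  then have "{q. fbdc_choice \<epsilon> q \<pi>} = {}" unfolding fbdc_choice_def by blast
  then show ?thesis by simp
qed

text \<open>The allowed policy with the least index in an enumeration of the countable type of policies.\<close>

lemma ex_measurable_fbdc_selection:
  assumes \<epsilon>: "0 < \<epsilon>" "\<epsilon> < 1"
  shows "\<exists>sel\<in>borel \<rightarrow>\<^sub>M count_space UNIV. \<forall>q. fbdc_choice \<epsilon> q (sel q)"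
proof
  let ?n = "\<lambda>q. LEAST n. fbdc_choice \<epsilon> q (from_nat n)"
  have "Measurable.pred borel (\<lambda>q. fbdc_choice \<epsilon> q \<pi>)" for \<pi>
    using borel_closed[OF closed_fbdc_choice[OF \<epsilon>, of \<pi>]] unfolding pred_def by simp
  then have "?n \<in> borel \<rightarrow>\<^sub>M count_space UNIV" by (intro measurable_Least)
  then show "(\<lambda>q. from_nat (?n q)) \<in> borel \<rightarrow>\<^sub>M count_space UNIV" by simp
  show "\<forall>q. fbdc_choice \<epsilon> q (from_nat (?n q))"
  proof
    fix q
    obtain \<pi> where "fbdc_choice \<epsilon> q \<pi>" using ex_fbdc_choice[OF \<epsilon>] by blast
    then have "fbdc_choice \<epsilon> q (from_nat (to_nat \<pi>))" by simp
    then show "fbdc_choice \<epsilon> q (from_nat (?n q))" by (rule LeastI)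
  qed
qed

section \<open>Histories as measurable functions of the noise\<close>

lemma measurable_countable2:
  fixes X :: "'b \<Rightarrow> 'x :: countable" and Y :: "'b \<Rightarrow> 'y :: countable"
  assumes "X \<in> N \<rightarrow>\<^sub>M count_space UNIV" "Y \<in> N \<rightarrow>\<^sub>M count_space UNIV"
  shows "(\<lambda>\<omega>. g (X \<omega>) (Y \<omega>)) \<in> N \<rightarrow>\<^sub>M count_space UNIV"
  by (rule measurable_compose_countable[OF measurable_compose_countable[OF _ assms(2)] assms(1)]) simp

lemma measurable_channel_vec:
  fixes c :: "2 \<Rightarrow> 'b \<Rightarrow> bool"
  assumes [measurable]: "\<And>i. c i \<in> N \<rightarrow>\<^sub>M count_space UNIV"
  shows "(\<lambda>\<omega>. \<chi> i. c i \<omega>) \<in> N \<rightarrow>\<^sub>M count_space UNIV"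
proof -
  have "(\<lambda>\<omega>. \<chi> i. c i \<omega>) -` {k} \<inter> space N = {\<omega> \<in> space N. \<forall>i. c i \<omega> = k $ i}" for k
    by (auto simp: vec_eq_iff)
  moreover have "{\<omega> \<in> space N. \<forall>i. c i \<omega> = k $ i} \<in> sets N" for k by measurable
  ultimately show ?thesis by (subst measurable_count_space_eq2_countable) auto
qed

lemma borel_measurable_vec_lambda:
  fixes f :: "'n :: finite \<Rightarrow> 'b \<Rightarrow> real"
  assumes "\<And>i. f i \<in> borel_measurable N"
  shows "(\<lambda>\<omega>. \<chi> i. f i \<omega>) \<in> borel_measurable N"
  using assms
  by (subst borel_measurable_euclidean_space) (auto simp: Basis_vec_def inner_axis)

text \<open>Stated for arbitrary measurable inputs, because it is used both on the sample space and on
path spaces on which part of the noise is fixed.\<close>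

lemma measurable_history:
  fixes a :: "2 \<Rightarrow> nat \<Rightarrow> 'b \<Rightarrow> real"
  assumes \<phi>: "admissible \<phi>"
    and a[measurable]: "\<And>i t. a i t \<in> borel_measurable N"
    and c[measurable]: "\<And>i t. c i t \<in> N \<rightarrow>\<^sub>M count_space UNIV"
    and u[measurable]: "\<And>t. u t \<in> borel_measurable N"
  shows "(\<lambda>\<omega>. history \<phi> m\<^sub>0 (\<lambda>i t. a i t \<omega>) (\<lambda>i t. c i t \<omega>) (\<lambda>t. u t \<omega>) t)
           \<in> N \<rightarrow>\<^sub>M (\<Pi>\<^sub>M s\<in>{..t}. observation_space)"
proof (induction t)
  case 0
  have [measurable]: "(\<lambda>\<omega>. \<chi> i. c i 0 \<omega>) \<in> N \<rightarrow>\<^sub>M count_space UNIV"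
    by (rule measurable_channel_vec) (rule c)
  have "(\<lambda>\<omega>. (m\<^sub>0, \<chi> i. c i 0 \<omega>)) \<in> N \<rightarrow>\<^sub>M count_space UNIV"
    by (rule measurable_compose[of _ _ "count_space UNIV"]) auto
  then have "(\<lambda>\<omega>. ((m\<^sub>0, \<chi> i. c i 0 \<omega>), 0)) \<in> N \<rightarrow>\<^sub>M observation_space"
    unfolding observation_space_def by (intro measurable_Pair) auto
  then show ?case
    unfolding history.simps
    by (intro measurable_fun_upd[where J = "{}"]) (auto simp: space_PiM)
next
  case (Suc t)
  define H where "H \<omega> = history \<phi> m\<^sub>0 (\<lambda>i t. a i t \<omega>) (\<lambda>i t. c i t \<omega>) (\<lambda>t. u t \<omega>) t" for \<omega>
  have H[measurable]: "H \<in> N \<rightarrow>\<^sub>M (\<Pi>\<^sub>M s\<in>{..t}. observation_space)"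
    using Suc.IH by (simp add: H_def[abs_def])
  have Ht: "(\<lambda>\<omega>. H \<omega> t) \<in> N \<rightarrow>\<^sub>M count_space UNIV \<Otimes>\<^sub>M borel"
    using measurable_compose[OF H measurable_component_singleton[of t]]
    by (simp add: observation_space_def)
  have S[measurable]: "(\<lambda>\<omega>. fst (H \<omega> t)) \<in> N \<rightarrow>\<^sub>M count_space UNIV"
    using measurable_compose[OF Ht measurable_fst] .
  have q[measurable]: "(\<lambda>\<omega>. snd (H \<omega> t)) \<in> borel_measurable N"
    using measurable_compose[OF Ht measurable_snd] .
  have "(\<lambda>\<omega>. \<phi> t (H \<omega>)) \<in> borel_measurable N"
    using \<phi> by (intro measurable_compose[OF H]) (simp add: admissible_def)
  then have stay[measurable]: "Measurable.pred N (\<lambda>\<omega>. u t \<omega> < \<phi> t (H \<omega>))" by measurable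
  have cvec: "(\<lambda>\<omega>. \<chi> i. c i (Suc t) \<omega>) \<in> N \<rightarrow>\<^sub>M count_space UNIV"
    by (rule measurable_channel_vec) (rule c)
  have "(\<lambda>\<omega>. (move (fst (fst (H \<omega> t))) (u t \<omega> < \<phi> t (H \<omega>)), \<chi> i. c i (Suc t) \<omega>)) \<in> N \<rightarrow>\<^sub>M count_space UNIV"
    by (rule measurable_countable2[OF measurable_countable2[OF S stay] cvec, of "\<lambda>m c. (m, c)"
          "\<lambda>s. move (fst s)"])
  moreover have "(\<lambda>\<omega>. reward i (fst (H \<omega> t)) (u t \<omega> < \<phi> t (H \<omega>))) \<in> borel_measurable N" for i
    using measurable_compose[OF measurable_countable2[OF S stay, of Pair], of "\<lambda>(s, b). reward i s b" borel]
    by simp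
  then have "(\<lambda>\<omega>. \<chi> i. max (snd (H \<omega> t) $ i - reward i (fst (H \<omega> t)) (u t \<omega> < \<phi> t (H \<omega>))) 0 + a i t \<omega>)
      \<in> borel_measurable N"
    by (intro borel_measurable_vec_lambda borel_measurable_add borel_measurable_max borel_measurable_diff
        measurable_compose[OF q borel_measurable_nth] a) auto
  ultimately have "(\<lambda>\<omega>. ((move (fst (fst (H \<omega> t))) (u t \<omega> < \<phi> t (H \<omega>)), \<chi> i. c i (Suc t) \<omega>),
      \<chi> i. max (snd (H \<omega> t) $ i - reward i (fst (H \<omega> t)) (u t \<omega> < \<phi> t (H \<omega>))) 0 + a i t \<omega>))
      \<in> N \<rightarrow>\<^sub>M observation_space"
    unfolding observation_space_def by (intro measurable_Pair) auto
  then show ?case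
    unfolding history.simps Let_def H_def[symmetric]
    by (intro measurable_fun_upd[where J = "{..t}"] H) auto
qed

lemma history_cong:
  assumes "\<And>i s. s < t \<Longrightarrow> a i s = a' i s" "\<And>i s. s \<le> t \<Longrightarrow> c i s = c' i s" "\<And>s. s < t \<Longrightarrow> u s = u' s"
  shows "history \<phi> m\<^sub>0 a c u t = history \<phi> m\<^sub>0 a' c' u' t"
  using assms
proof (induction t)
  case (Suc t)
  have "history \<phi> m\<^sub>0 a c u t = history \<phi> m\<^sub>0 a' c' u' t"
    using Suc.prems by (intro Suc.IH) auto
  then show ?case using Suc.prems by (simp add: Let_def)
qed simp

lemma history_stable:
  "s \<le> t \<Longrightarrow> history \<phi> m\<^sub>0 a c u t s = history \<phi> m\<^sub>0 a c u s s"
proof (induction t)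
  case (Suc t)
  then show ?case by (cases "s = Suc t") (simp_all add: Let_def)
qed simp

lemma measurable_stay:
  assumes "admissible \<phi>"
  shows "Measurable.pred ((\<Pi>\<^sub>M s\<in>{..t}. observation_space) \<Otimes>\<^sub>M borel) (\<lambda>(h, u :: real). u < \<phi> t h)"
proof -
  have [measurable]: "\<phi> t \<in> borel_measurable (\<Pi>\<^sub>M s\<in>{..t}. observation_space)"
    using assms by (simp add: admissible_def)
  show ?thesis by measurable
qed

lemma measurable_past_state:
  assumes "s \<le> t"
  shows "(\<lambda>h. fst (h s)) \<in> (\<Pi>\<^sub>M s\<in>{..t}. observation_space) \<rightarrow>\<^sub>M count_space UNIV"
    and "(\<lambda>h. snd (h s)) \<in> borel_measurable (\<Pi>\<^sub>M s\<in>{..t}. observation_space)"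
proof -
  have "(\<lambda>h. h s) \<in> (\<Pi>\<^sub>M s\<in>{..t}. observation_space) \<rightarrow>\<^sub>M count_space UNIV \<Otimes>\<^sub>M borel"
    using measurable_component_singleton[of s "{..t}" "\<lambda>_. observation_space"] assms
    by (simp add: observation_space_def)
  from measurable_compose[OF this measurable_fst] measurable_compose[OF this measurable_snd]
  show "(\<lambda>h. fst (h s)) \<in> (\<Pi>\<^sub>M s\<in>{..t}. observation_space) \<rightarrow>\<^sub>M count_space UNIV"
    "(\<lambda>h. snd (h s)) \<in> borel_measurable (\<Pi>\<^sub>M s\<in>{..t}. observation_space)" by auto
qed

lemma measurable_path_component:
  assumes "k \<in> K"
  shows "(\<lambda>w. w k s) \<in> borel_measurable (\<Pi>\<^sub>M k\<in>K. \<Pi>\<^sub>M t\<in>UNIV. borel)"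
  using measurable_compose[OF measurable_component_singleton[OF assms, of "\<lambda>_. \<Pi>\<^sub>M t\<in>UNIV. borel"]
      measurable_component_singleton[of s UNIV "\<lambda>_. borel"]] by simp

section \<open>Integrals of independent random elements\<close>

context prob_space
begin

text \<open>Fubini's theorem on the sample space: independence allows the two arguments to be sampled
separately.\<close>

lemma indep_var_nn_integral_pair:
  assumes ind: "indep_var S X T Y" and F: "F \<in> borel_measurable (S \<Otimes>\<^sub>M T)"
  shows "(\<integral>\<^sup>+\<omega>. F (X \<omega>, Y \<omega>) \<partial>M) = (\<integral>\<^sup>+\<omega>'. (\<integral>\<^sup>+\<omega>. F (X \<omega>', Y \<omega>) \<partial>M) \<partial>M)"
proof -
  have X: "X \<in> M \<rightarrow>\<^sub>M S" and Y: "Y \<in> M \<rightarrow>\<^sub>M T"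
    and eq: "distr M S X \<Otimes>\<^sub>M distr M T Y = distr M (S \<Otimes>\<^sub>M T) (\<lambda>\<omega>. (X \<omega>, Y \<omega>))"
    using ind by (auto simp: indep_var_distribution_eq)
  interpret Y: prob_space "distr M T Y" by (rule prob_space_distr[OF Y])
  have F': "F \<in> borel_measurable (distr M S X \<Otimes>\<^sub>M distr M T Y)" using F by simp
  have "(\<integral>\<^sup>+\<omega>. F (X \<omega>, Y \<omega>) \<partial>M) = integral\<^sup>N (distr M S X \<Otimes>\<^sub>M distr M T Y) F"
    unfolding eq using X Y F by (subst nn_integral_distr) auto
  also have "\<dots> = (\<integral>\<^sup>+x. \<integral>\<^sup>+y. F (x, y) \<partial>distr M T Y \<partial>distr M S X)"
    by (rule Y.nn_integral_fst[OF F', symmetric])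
  also have "\<dots> = (\<integral>\<^sup>+x. \<integral>\<^sup>+\<omega>. F (x, Y \<omega>) \<partial>M \<partial>distr M S X)"
    using F by (intro nn_integral_cong nn_integral_distr Y) (auto intro: measurable_compose_Pair1)
  also have "\<dots> = (\<integral>\<^sup>+\<omega>'. (\<integral>\<^sup>+\<omega>. F (X \<omega>', Y \<omega>) \<partial>M) \<partial>M)"
  proof (rule nn_integral_distr[OF X])
    have "(\<lambda>x. \<integral>\<^sup>+y. F (x, y) \<partial>distr M T Y) \<in> borel_measurable S"
      using F by (intro Y.borel_measurable_nn_integral_fst) auto
    also have "?this \<longleftrightarrow> (\<lambda>x. \<integral>\<^sup>+\<omega>. F (x, Y \<omega>) \<partial>M) \<in> borel_measurable S"
      using F by (intro measurable_cong nn_integral_distr Y) (auto intro: measurable_compose_Pair1)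
    finally show "(\<lambda>x. \<integral>\<^sup>+\<omega>. F (x, Y \<omega>) \<partial>M) \<in> borel_measurable (distr M S X)" by simp
  qed
  finally show ?thesis .
qed

lemma indep_var_nn_integral_mult:
  fixes f g :: "_ \<Rightarrow> ennreal"
  assumes ind: "indep_var S X T Y" and [measurable]: "f \<in> borel_measurable S" "g \<in> borel_measurable T"
  shows "(\<integral>\<^sup>+\<omega>. f (X \<omega>) * g (Y \<omega>) \<partial>M) = (\<integral>\<^sup>+\<omega>. f (X \<omega>) \<partial>M) * (\<integral>\<^sup>+\<omega>. g (Y \<omega>) \<partial>M)"
proof -
  have [measurable]: "X \<in> M \<rightarrow>\<^sub>M S" "Y \<in> M \<rightarrow>\<^sub>M T"
    using ind by (auto simp: indep_var_distribution_eq)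
  have "(\<integral>\<^sup>+\<omega>. f (X \<omega>) * g (Y \<omega>) \<partial>M) = (\<integral>\<^sup>+\<omega>'. (\<integral>\<^sup>+\<omega>. f (X \<omega>') * g (Y \<omega>) \<partial>M) \<partial>M)"
    using indep_var_nn_integral_pair[OF ind, of "\<lambda>(x, y). f x * g y"] by simp
  also have "\<dots> = (\<integral>\<^sup>+\<omega>. f (X \<omega>) \<partial>M) * (\<integral>\<^sup>+\<omega>. g (Y \<omega>) \<partial>M)"
    by (simp add: nn_integral_cmult nn_integral_multc)
  finally show ?thesis .
qed

end

section \<open>The controlled Markov property\<close>

context queueing_system
begin

text \<open>All sources of randomness as one family of real paths; the channels are coded by \<open>0\<close> and \<open>1\<close>.\<close>

definition noise :: "source \<Rightarrow> 'w \<Rightarrow> nat \<Rightarrow> real" where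
  "noise k \<omega> t = (case k of Arrivals i \<Rightarrow> A i t \<omega> | Channel i \<Rightarrow> of_bool (C i t \<omega>) | Coins \<Rightarrow> U t \<omega>)"

lemma indep_noise: "indep_vars (\<lambda>_. \<Pi>\<^sub>M t\<in>UNIV. borel) noise UNIV"
proof -
  have "noise = (\<lambda>k \<omega> t. case k of Arrivals i \<Rightarrow> A i t \<omega> | Channel i \<Rightarrow> of_bool (C i t \<omega>) | Coins \<Rightarrow> U t \<omega>)"
    by (simp add: noise_def fun_eq_iff)
  then show ?thesis using indep_processes by simp
qed

lemma noise_simps:
  "noise (Arrivals i) \<omega> t = A i t \<omega>" "noise (Channel i) \<omega> t = of_bool (C i t \<omega>)" "noise Coins \<omega> t = U t \<omega>"
  by (simp_all add: noise_def)

lemma measurable_noise: "noise k \<in> M \<rightarrow>\<^sub>M (\<Pi>\<^sub>M t\<in>UNIV. borel)"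
  using indep_noise by (auto simp: indep_vars_def)

lemma measurable_noise_component: "(\<lambda>\<omega>. noise k \<omega> t) \<in> borel_measurable M"
  using measurable_compose[OF measurable_noise measurable_component_singleton[of t]] by simp

lemma measurable_arrivals[measurable]: "A i t \<in> borel_measurable M"
  using measurable_noise_component[of "Arrivals i" t] by (simp add: noise_simps)

lemma measurable_coins[measurable]: "U t \<in> borel_measurable M"
  using measurable_noise_component[of Coins t] by (simp add: noise_simps)

lemma measurable_channels[measurable]: "C i t \<in> M \<rightarrow>\<^sub>M count_space UNIV"
proof -
  have "(\<lambda>\<omega>. (of_bool (C i t \<omega>) :: real)) \<in> borel_measurable M"
    using measurable_noise_component[of "Channel i" t] by (simp add: noise_simps)
  then have "Measurable.pred M (\<lambda>\<omega>. (of_bool (C i t \<omega>) :: real) = 1)" by measurable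
  moreover have "(of_bool b :: real) = 1 \<longleftrightarrow> b" for b by simp
  ultimately show ?thesis by simp
qed

definition obs :: "policy \<Rightarrow> 2 \<Rightarrow> nat \<Rightarrow> 'w \<Rightarrow> nat \<Rightarrow> observation" where
  "obs \<phi> m\<^sub>0 t \<omega> = history \<phi> m\<^sub>0 (\<lambda>i t. A i t \<omega>) (\<lambda>i t. C i t \<omega>) (\<lambda>t. U t \<omega>) t"

abbreviation state_at :: "policy \<Rightarrow> 2 \<Rightarrow> nat \<Rightarrow> 'w \<Rightarrow> state" where
  "state_at \<phi> m\<^sub>0 t \<omega> \<equiv> fst (obs \<phi> m\<^sub>0 t \<omega> t)"

abbreviation stays :: "policy \<Rightarrow> 2 \<Rightarrow> nat \<Rightarrow> 'w \<Rightarrow> bool" where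
  "stays \<phi> m\<^sub>0 t \<omega> \<equiv> U t \<omega> < \<phi> t (obs \<phi> m\<^sub>0 t \<omega>)"

lemma measurable_obs:
  assumes "admissible \<phi>"
  shows "obs \<phi> m\<^sub>0 t \<in> M \<rightarrow>\<^sub>M (\<Pi>\<^sub>M s\<in>{..t}. observation_space)"
  unfolding obs_def by (rule measurable_history[OF assms]) auto

lemma state_at_channel: "snd (state_at \<phi> m\<^sub>0 t \<omega>) = (\<chi> i. C i t \<omega>)"
  by (cases t) (simp_all add: obs_def Let_def)

lemma location_Suc: "fst (state_at \<phi> m\<^sub>0 (Suc t) \<omega>) = move (fst (state_at \<phi> m\<^sub>0 t \<omega>)) (stays \<phi> m\<^sub>0 t \<omega>)"
  by (simp add: obs_def Let_def)

definition channel_event :: "(2 \<Rightarrow> nat \<Rightarrow> bool) \<Rightarrow> nat \<Rightarrow> 'w set" where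
  "channel_event c n = {\<omega> \<in> space M. \<forall>i. \<forall>s\<le>n. C i s \<omega> = c i s}"

lemma channel_event_sets[measurable]: "channel_event c n \<in> sets M"
  unfolding channel_event_def by measurable

text \<open>Independence of the two channel processes.\<close>

lemma prob_channel_event:
  "prob (channel_event c n) = (\<Prod>i\<in>UNIV. prob {\<omega> \<in> space M. \<forall>s\<le>n. C i s \<omega> = c i s})"
proof -
  define B where "B k = (case k of Channel i \<Rightarrow> {x. \<forall>s\<le>n. x s = (of_bool (c i s) :: real)} | _ \<Rightarrow> {})"
    for k :: source
  have B: "B k \<in> sets (\<Pi>\<^sub>M t\<in>UNIV. borel)" for k :: source
  proof (cases k)
    case (Channel i)
    have "{x \<in> space (\<Pi>\<^sub>M t\<in>UNIV. borel). \<forall>s\<le>n. x s = of_bool (c i s)} \<in> sets (\<Pi>\<^sub>M t\<in>(UNIV :: nat set). borel :: real measure)"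
      by measurable
    then show ?thesis using Channel by (simp add: B_def space_PiM)
  qed (auto simp: B_def)
  have pre: "noise (Channel i) -` B (Channel i) \<inter> space M = {\<omega> \<in> space M. \<forall>s\<le>n. C i s \<omega> = c i s}" for i
  proof -
    have "(of_bool a :: real) = of_bool b \<longleftrightarrow> a = b" for a b by simp
    then show ?thesis by (auto simp: B_def noise_simps)
  qed
  have "prob (\<Inter>k\<in>range Channel. noise k -` B k \<inter> space M) = (\<Prod>k\<in>range Channel. prob (noise k -` B k \<inter> space M))"
    by (rule indep_varsD[OF indep_noise]) (auto simp: B)
  also have "(\<Inter>k\<in>range Channel. noise k -` B k \<inter> space M)
      = (\<Inter>i. noise (Channel i) -` B (Channel i) \<inter> space M)"
    by blast
  also have "\<dots> = channel_event c n"
    unfolding pre by (auto simp: channel_event_def)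
  also have "(\<Prod>k\<in>range Channel. prob (noise k -` B k \<inter> space M))
      = (\<Prod>i\<in>UNIV. prob {\<omega> \<in> space M. \<forall>s\<le>n. C i s \<omega> = c i s})"
    by (subst prod.reindex) (auto simp: inj_on_def pre)
  finally show ?thesis .
qed

lemma prob_channel_event_Suc:
  "prob (channel_event c (Suc n)) =
     prob (channel_event c n) * (\<Prod>i\<in>UNIV. if c i (Suc n) = c i n then 1 - \<epsilon> else \<epsilon>)"
  using channels unfolding prob_channel_event gilbert_elliott_def by (simp add: prod.distrib)

definition channel_path :: "nat \<Rightarrow> 'w \<Rightarrow> (2 \<times> nat) set" where
  "channel_path t \<omega> = {(i, s). s \<le> t \<and> C i s \<omega>}"

lemma channel_path_event:
  assumes "P \<subseteq> UNIV \<times> {..t}"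
  shows "{\<omega> \<in> space M. channel_path t \<omega> = P} = channel_event (\<lambda>i s. (i, s) \<in> P) t"
  using assms unfolding channel_event_def channel_path_def by auto

text \<open>The channel states up to \<open>t\<close> take finitely many values, so conditioning on them is a finite
decomposition; a path is coded as the set of its ON slots.\<close>

lemma nn_integral_split_channel_path:
  assumes [measurable]: "f \<in> borel_measurable M"
  shows "(\<integral>\<^sup>+\<omega>. f \<omega> \<partial>M) =
    (\<Sum>P\<in>Pow (UNIV \<times> {..t}). \<integral>\<^sup>+\<omega>. f \<omega> * indicator (channel_event (\<lambda>i s. (i, s) \<in> P) t) \<omega> \<partial>M)"
proof -
  have "(\<Sum>P\<in>Pow (UNIV \<times> {..t}). indicator (channel_event (\<lambda>i s. (i, s) \<in> P) t) \<omega>) = (1 :: ennreal)"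
    if "\<omega> \<in> space M" for \<omega>
  proof -
    have "(\<Sum>P\<in>Pow (UNIV \<times> {..t}). indicator (channel_event (\<lambda>i s. (i, s) \<in> P) t) \<omega>)
        = (\<Sum>P\<in>Pow (UNIV \<times> {..t}). if P = channel_path t \<omega> then 1 else 0 :: ennreal)"
      using that by (intro sum.cong refl) (auto simp: channel_path_event[symmetric] indicator_def)
    also have "\<dots> = 1" by (subst sum.delta) (auto simp: channel_path_def)
    finally show ?thesis .
  qed
  then have "(\<integral>\<^sup>+\<omega>. f \<omega> \<partial>M) =
      (\<integral>\<^sup>+\<omega>. (\<Sum>P\<in>Pow (UNIV \<times> {..t}). f \<omega> * indicator (channel_event (\<lambda>i s. (i, s) \<in> P) t) \<omega>) \<partial>M)"
    by (intro nn_integral_cong) (simp flip: sum_distrib_left)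
  also have "\<dots> = (\<Sum>P\<in>Pow (UNIV \<times> {..t}). \<integral>\<^sup>+\<omega>. f \<omega> * indicator (channel_event (\<lambda>i s. (i, s) \<in> P) t) \<omega> \<partial>M)"
    by (rule nn_integral_sum) auto
  finally show ?thesis .
qed

text \<open>Functions of arrivals and coins are independent of the channels.\<close>

lemma channel_event_independent:
  assumes G: "G \<in> borel_measurable (\<Pi>\<^sub>M k\<in>- range Channel. \<Pi>\<^sub>M t\<in>UNIV. borel)"
  shows "(\<integral>\<^sup>+\<omega>. G (restrict (\<lambda>k. noise k \<omega>) (- range Channel)) * indicator (channel_event c n) \<omega> \<partial>M)
       = (\<integral>\<^sup>+\<omega>. G (restrict (\<lambda>k. noise k \<omega>) (- range Channel)) \<partial>M) * prob (channel_event c n)"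
proof -
  let ?T = "\<Pi>\<^sub>M k\<in>range Channel. \<Pi>\<^sub>M t\<in>(UNIV :: nat set). (borel :: real measure)"
  have ind: "indep_var (\<Pi>\<^sub>M k\<in>- range Channel. \<Pi>\<^sub>M t\<in>UNIV. borel) (\<lambda>\<omega>. restrict (\<lambda>k. noise k \<omega>) (- range Channel))
      ?T (\<lambda>\<omega>. restrict (\<lambda>k. noise k \<omega>) (range Channel))"
    by (rule indep_var_restrict[OF indep_noise]) auto
  define B where "B = {w \<in> space ?T. \<forall>i. \<forall>s\<le>n. w (Channel i) s = of_bool (c i s)}"
  have comp: "(\<lambda>w. w (Channel i) s) \<in> borel_measurable ?T" for i s
    by (rule measurable_path_component) simp
  have B[measurable]: "B \<in> sets ?T" unfolding B_def using comp by measurable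
  have "of_bool a = (of_bool b :: real) \<longleftrightarrow> a = b" for a b by simp
  then have "indicator B (restrict (\<lambda>k. noise k \<omega>) (range Channel)) = (indicator (channel_event c n) \<omega> :: ennreal)"
    if "\<omega> \<in> space M" for \<omega>
    using that by (auto simp: B_def channel_event_def indicator_def noise_simps space_PiM)
  then have eq: "(\<integral>\<^sup>+\<omega>. g \<omega> * indicator B (restrict (\<lambda>k. noise k \<omega>) (range Channel)) \<partial>M)
      = (\<integral>\<^sup>+\<omega>. g \<omega> * indicator (channel_event c n) \<omega> \<partial>M)" for g :: "'w \<Rightarrow> ennreal"
    by (intro nn_integral_cong) simp
  show ?thesis
    using indep_var_nn_integral_mult[OF ind G, of "indicator B"] eq eq[of "\<lambda>_. 1"]
    by (simp add: emeasure_eq_measure)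
qed

text \<open>On the event that the channel path up to \<open>t\<close> is \<open>P\<close>, the integrand depends on arrivals and coins
only.  Independence then splits off the probability of the path, and the probability of the path
extended by one slot is that of \<open>P\<close> times the transition probability.\<close>

lemma next_channel:
  fixes F :: "(nat \<Rightarrow> observation) \<times> real \<Rightarrow> ennreal"
  assumes \<phi>: "admissible \<phi>" and \<epsilon>: "0 < \<epsilon>" "\<epsilon> < 1"
    and F[measurable]: "F \<in> borel_measurable ((\<Pi>\<^sub>M s\<in>{..t}. observation_space) \<Otimes>\<^sub>M borel)"
  shows "(\<integral>\<^sup>+\<omega>. F (obs \<phi> m\<^sub>0 t \<omega>, U t \<omega>) * of_bool (\<forall>i. C i (Suc t) \<omega> = c' i) \<partial>M)
    = (\<integral>\<^sup>+\<omega>. F (obs \<phi> m\<^sub>0 t \<omega>, U t \<omega>) *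
         ennreal (\<Prod>i\<in>UNIV. if c' i = C i t \<omega> then 1 - \<epsilon> else \<epsilon>) \<partial>M)"
proof -
  note obs_meas[measurable] = measurable_obs[OF \<phi>]
  let ?K = "\<Pi>\<^sub>M k\<in>- range Channel. \<Pi>\<^sub>M t\<in>(UNIV :: nat set). (borel :: real measure)"
  let ?R = "\<lambda>\<omega>. restrict (\<lambda>k. noise k \<omega>) (- range Channel)"
  let ?E = "\<lambda>P. channel_event (\<lambda>i s. (i, s) \<in> P) t"
  let ?p = "\<lambda>P. \<Prod>i\<in>UNIV. if c' i = ((i, t) \<in> P) then 1 - \<epsilon> else \<epsilon>"
  (* The value of F when the channel path up to t is P; it depends on arrivals and coins only. *)
  define G where "G P w = F (history \<phi> m\<^sub>0 (\<lambda>i t. w (Arrivals i) t) (\<lambda>i s. (i, s) \<in> P) (\<lambda>t. w Coins t) t, w Coins t)"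
    for P w
  have G[measurable]: "G P \<in> borel_measurable ?K" for P
  proof -
    have comp[measurable]: "(\<lambda>w. w k s) \<in> borel_measurable ?K" if "k \<in> - range Channel" for k s
      using that by (rule measurable_path_component)
    have [measurable]: "(\<lambda>w. w (Arrivals i) s) \<in> borel_measurable ?K"
      "(\<lambda>w. w Coins s) \<in> borel_measurable ?K" for i s
      by (auto intro!: comp)
    have [measurable]: "(\<lambda>w. history \<phi> m\<^sub>0 (\<lambda>i t. w (Arrivals i) t) (\<lambda>i s. (i, s) \<in> P) (\<lambda>t. w Coins t) t)
        \<in> ?K \<rightarrow>\<^sub>M (\<Pi>\<^sub>M s\<in>{..t}. observation_space)"
      by (rule measurable_history[OF \<phi>]) auto
    show ?thesis unfolding G_def by measurable
  qed
  have F_eq: "F (obs \<phi> m\<^sub>0 t \<omega>, U t \<omega>) = G P (?R \<omega>)" if "\<omega> \<in> ?E P" for P \<omega>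
  proof -
    have "obs \<phi> m\<^sub>0 t \<omega> = history \<phi> m\<^sub>0 (\<lambda>i t. A i t \<omega>) (\<lambda>i s. (i, s) \<in> P) (\<lambda>t. U t \<omega>) t"
      unfolding obs_def using that by (intro history_cong) (auto simp: channel_event_def)
    moreover have "Arrivals i \<in> - range Channel" "Coins \<in> - range Channel" for i by auto
    moreover have "noise (Arrivals i) \<omega> = (\<lambda>t. A i t \<omega>)" "noise Coins \<omega> = (\<lambda>t. U t \<omega>)" for i
      by (simp_all add: noise_simps fun_eq_iff)
    ultimately show ?thesis unfolding G_def by simp
  qed
  have F_meas[measurable]: "(\<lambda>\<omega>. F (obs \<phi> m\<^sub>0 t \<omega>, U t \<omega>)) \<in> borel_measurable M" by measurable
  have step: "(\<integral>\<^sup>+\<omega>. F (obs \<phi> m\<^sub>0 t \<omega>, U t \<omega>) * of_bool (\<forall>i. C i (Suc t) \<omega> = c' i) * indicator (?E P) \<omega> \<partial>M)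
      = (\<integral>\<^sup>+\<omega>. F (obs \<phi> m\<^sub>0 t \<omega>, U t \<omega>) * ennreal (\<Prod>i\<in>UNIV. if c' i = C i t \<omega> then 1 - \<epsilon> else \<epsilon>)
           * indicator (?E P) \<omega> \<partial>M)" if P: "P \<subseteq> UNIV \<times> {..t}" for P
  proof -
    (* The path P continued by the prescribed next channel state. *)
    define c where "c i s = (if s \<le> t then (i, s) \<in> P else c' i)" for i s
    have c_E: "channel_event c t = ?E P" by (auto simp: channel_event_def c_def)
    have c_Suc: "channel_event c (Suc t) = {\<omega> \<in> ?E P. \<forall>i. C i (Suc t) \<omega> = c' i}"
      by (auto simp: channel_event_def c_def le_Suc_eq)
    have p: "(\<Prod>i\<in>UNIV. if c i (Suc t) = c i t then 1 - \<epsilon> else \<epsilon>) = ?p P" by (simp add: c_def)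
    have p_nn: "0 \<le> ?p P" using \<epsilon> by (intro prod_nonneg) auto
    have "(\<integral>\<^sup>+\<omega>. F (obs \<phi> m\<^sub>0 t \<omega>, U t \<omega>) * of_bool (\<forall>i. C i (Suc t) \<omega> = c' i) * indicator (?E P) \<omega> \<partial>M)
        = (\<integral>\<^sup>+\<omega>. G P (?R \<omega>) * indicator (channel_event c (Suc t)) \<omega> \<partial>M)"
      using F_eq by (intro nn_integral_cong) (auto simp: c_Suc indicator_def)
    also have "\<dots> = (\<integral>\<^sup>+\<omega>. G P (?R \<omega>) \<partial>M) * (prob (?E P) * ?p P)"
      by (subst channel_event_independent) (simp_all add: prob_channel_event_Suc c_E p)
    also have "\<dots> = (\<integral>\<^sup>+\<omega>. G P (?R \<omega>) * indicator (?E P) \<omega> \<partial>M) * ennreal (?p P)"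
      by (subst channel_event_independent) (simp_all add: ennreal_mult p_nn mult.assoc)
    also have "\<dots> = (\<integral>\<^sup>+\<omega>. G P (?R \<omega>) * indicator (?E P) \<omega> * ennreal (?p P) \<partial>M)"
    proof (rule nn_integral_multc[symmetric])
      have "?R \<in> M \<rightarrow>\<^sub>M ?K" by (intro measurable_restrict measurable_noise)
      from measurable_compose[OF this G]
      show "(\<lambda>\<omega>. G P (?R \<omega>) * indicator (?E P) \<omega>) \<in> borel_measurable M" by measurable
    qed
    also have "\<dots> = (\<integral>\<^sup>+\<omega>. F (obs \<phi> m\<^sub>0 t \<omega>, U t \<omega>) * ennreal (\<Prod>i\<in>UNIV. if c' i = C i t \<omega> then 1 - \<epsilon> else \<epsilon>)
           * indicator (?E P) \<omega> \<partial>M)"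
    proof (intro nn_integral_cong)
      fix \<omega>
      show "G P (?R \<omega>) * indicator (?E P) \<omega> * ennreal (?p P)
          = F (obs \<phi> m\<^sub>0 t \<omega>, U t \<omega>) * ennreal (\<Prod>i\<in>UNIV. if c' i = C i t \<omega> then 1 - \<epsilon> else \<epsilon>) * indicator (?E P) \<omega>"
      proof (cases "\<omega> \<in> ?E P")
        case True
        then have "C i t \<omega> = ((i, t) \<in> P)" for i by (simp add: channel_event_def)
        then show ?thesis using F_eq[OF True] by (simp add: mult_ac)
      qed simp
    qed
    finally show ?thesis .
  qed
  show ?thesis
    by (subst (1 2) nn_integral_split_channel_path[where t = t]) (auto intro!: sum.cong step)
qed

text \<open>Given history and coin, the next location is determined, so only the channels contribute
randomness.\<close>

lemma controlled_markov_nn: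
  fixes F :: "(nat \<Rightarrow> observation) \<times> real \<Rightarrow> ennreal"
  assumes \<phi>: "admissible \<phi>" and \<epsilon>: "0 < \<epsilon>" "\<epsilon> < 1"
    and F[measurable]: "F \<in> borel_measurable ((\<Pi>\<^sub>M s\<in>{..t}. observation_space) \<Otimes>\<^sub>M borel)"
  shows "(\<integral>\<^sup>+\<omega>. F (obs \<phi> m\<^sub>0 t \<omega>, U t \<omega>) * of_bool (state_at \<phi> m\<^sub>0 (Suc t) \<omega> = s) \<partial>M)
    = (\<integral>\<^sup>+\<omega>. F (obs \<phi> m\<^sub>0 t \<omega>, U t \<omega>) *
         ennreal (trans_prob \<epsilon> (state_at \<phi> m\<^sub>0 t \<omega>) (stays \<phi> m\<^sub>0 t \<omega>) s) \<partial>M)"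
proof -
  note [measurable] = measurable_stay[OF \<phi>, of t]
  define L where "L p \<longleftrightarrow> fst s = move (fst (fst (fst p t))) (snd p < \<phi> t (fst p))" for p :: "(nat \<Rightarrow> observation) \<times> real"
  have st: "(\<lambda>p. fst (fst p t)) \<in> (\<Pi>\<^sub>M s\<in>{..t}. observation_space) \<Otimes>\<^sub>M (borel :: real measure) \<rightarrow>\<^sub>M count_space UNIV"
    using measurable_compose[OF measurable_fst measurable_past_state(1)[of t t]] by simp
  have stay: "(\<lambda>p. snd p < \<phi> t (fst p)) \<in> (\<Pi>\<^sub>M s\<in>{..t}. observation_space) \<Otimes>\<^sub>M (borel :: real measure) \<rightarrow>\<^sub>M count_space UNIV"
    using measurable_stay[OF \<phi>, of t] by (simp add: case_prod_beta')
  have L[measurable]: "Measurable.pred ((\<Pi>\<^sub>M s\<in>{..t}. observation_space) \<Otimes>\<^sub>M borel) L"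
    unfolding L_def by (rule measurable_countable2[OF st stay, of "\<lambda>s' a. fst s = move (fst s') a"])
  let ?F = "\<lambda>p. F p * of_bool (L p)"
  have F'[measurable]: "?F \<in> borel_measurable ((\<Pi>\<^sub>M s\<in>{..t}. observation_space) \<Otimes>\<^sub>M borel)" by measurable
  have split: "state_at \<phi> m\<^sub>0 (Suc t) \<omega> = s \<longleftrightarrow> L (obs \<phi> m\<^sub>0 t \<omega>, U t \<omega>) \<and> (\<forall>i. C i (Suc t) \<omega> = snd s $ i)" for \<omega>
    by (auto simp: prod_eq_iff state_at_channel location_Suc L_def vec_eq_iff)
  have "(\<integral>\<^sup>+\<omega>. F (obs \<phi> m\<^sub>0 t \<omega>, U t \<omega>) * of_bool (state_at \<phi> m\<^sub>0 (Suc t) \<omega> = s) \<partial>M)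
      = (\<integral>\<^sup>+\<omega>. ?F (obs \<phi> m\<^sub>0 t \<omega>, U t \<omega>) * of_bool (\<forall>i. C i (Suc t) \<omega> = snd s $ i) \<partial>M)"
    unfolding split of_bool_conj by (simp add: mult.assoc)
  also have "\<dots> = (\<integral>\<^sup>+\<omega>. ?F (obs \<phi> m\<^sub>0 t \<omega>, U t \<omega>) *
         ennreal (\<Prod>i\<in>UNIV. if snd s $ i = C i t \<omega> then 1 - \<epsilon> else \<epsilon>) \<partial>M)"
    by (rule next_channel[OF \<phi> \<epsilon> F'])
  also have "\<dots> = (\<integral>\<^sup>+\<omega>. F (obs \<phi> m\<^sub>0 t \<omega>, U t \<omega>) *
         ennreal (trans_prob \<epsilon> (state_at \<phi> m\<^sub>0 t \<omega>) (stays \<phi> m\<^sub>0 t \<omega>) s) \<partial>M)"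
    by (intro nn_integral_cong) (simp add: trans_prob_def L_def state_at_channel of_bool_def)
  finally show ?thesis .
qed

text \<open>Both sides are integrals of nonnegative functions; they agree as real numbers also when they are
infinite as extended ones, since both are then zero by convention.\<close>

lemma controlled_markov:
  fixes F :: "(nat \<Rightarrow> observation) \<times> real \<Rightarrow> real"
  assumes \<phi>: "admissible \<phi>" and \<epsilon>: "0 < \<epsilon>" "\<epsilon> < 1"
    and F[measurable]: "F \<in> borel_measurable ((\<Pi>\<^sub>M s\<in>{..t}. observation_space) \<Otimes>\<^sub>M borel)"
    and nn: "\<And>\<omega>. \<omega> \<in> space M \<Longrightarrow> 0 \<le> F (obs \<phi> m\<^sub>0 t \<omega>, U t \<omega>)"
  shows "expectation (\<lambda>\<omega>. F (obs \<phi> m\<^sub>0 t \<omega>, U t \<omega>) * of_bool (state_at \<phi> m\<^sub>0 (Suc t) \<omega> = s))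
    = expectation (\<lambda>\<omega>. F (obs \<phi> m\<^sub>0 t \<omega>, U t \<omega>) * trans_prob \<epsilon> (state_at \<phi> m\<^sub>0 t \<omega>) (stays \<phi> m\<^sub>0 t \<omega>) s)"
proof -
  note obs_meas[measurable] = measurable_obs[OF \<phi>]
  have F_meas[measurable]: "(\<lambda>\<omega>. F (obs \<phi> m\<^sub>0 t \<omega>, U t \<omega>)) \<in> borel_measurable M" by measurable
  have st: "(\<lambda>\<omega>. state_at \<phi> m\<^sub>0 t \<omega>) \<in> M \<rightarrow>\<^sub>M count_space UNIV" for t
    using measurable_compose[OF measurable_obs[OF \<phi>] measurable_past_state(1)[of t t]] by simp
  have stay: "(\<lambda>\<omega>. stays \<phi> m\<^sub>0 t \<omega>) \<in> M \<rightarrow>\<^sub>M count_space UNIV"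
    using measurable_compose[OF measurable_Pair[OF measurable_obs[OF \<phi>] measurable_coins] measurable_stay[OF \<phi>]] by simp
  have [measurable]: "Measurable.pred M (\<lambda>\<omega>. state_at \<phi> m\<^sub>0 (Suc t) \<omega> = s)"
    using measurable_compose[OF st[of "Suc t"], of "\<lambda>x. x = s"] by simp
  have [measurable]: "(\<lambda>\<omega>. trans_prob \<epsilon> (state_at \<phi> m\<^sub>0 t \<omega>) (stays \<phi> m\<^sub>0 t \<omega>) s) \<in> borel_measurable M"
    using measurable_compose[OF measurable_countable2[OF st stay, of Pair], of "\<lambda>(s', b). trans_prob \<epsilon> s' b s" borel] by simp
  have "(\<integral>\<^sup>+\<omega>. ennreal (F (obs \<phi> m\<^sub>0 t \<omega>, U t \<omega>) * of_bool (state_at \<phi> m\<^sub>0 (Suc t) \<omega> = s)) \<partial>M)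
     = (\<integral>\<^sup>+\<omega>. ennreal (F (obs \<phi> m\<^sub>0 t \<omega>, U t \<omega>)) * of_bool (state_at \<phi> m\<^sub>0 (Suc t) \<omega> = s) \<partial>M)"
    using nn by (intro nn_integral_cong) (auto simp: of_bool_def)
  also have "\<dots> = (\<integral>\<^sup>+\<omega>. ennreal (F (obs \<phi> m\<^sub>0 t \<omega>, U t \<omega>)) *
         ennreal (trans_prob \<epsilon> (state_at \<phi> m\<^sub>0 t \<omega>) (stays \<phi> m\<^sub>0 t \<omega>) s) \<partial>M)"
    by (rule controlled_markov_nn[OF \<phi> \<epsilon>, of "\<lambda>p. ennreal (F p)"]) measurable
  also have "\<dots> = (\<integral>\<^sup>+\<omega>. ennreal (F (obs \<phi> m\<^sub>0 t \<omega>, U t \<omega>) *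
         trans_prob \<epsilon> (state_at \<phi> m\<^sub>0 t \<omega>) (stays \<phi> m\<^sub>0 t \<omega>) s) \<partial>M)"
    using nn trans_prob_nonneg[OF \<epsilon>] by (intro nn_integral_cong) (simp add: ennreal_mult)
  finally show ?thesis
    using nn trans_prob_nonneg[OF \<epsilon>] by (subst (1 2) integral_eq_nn_integral) auto
qed

section \<open>Independence of future arrivals\<close>

lemma arrivals_nn_mean:
  assumes "integrable M (A i t)"
  shows "(\<integral>\<^sup>+\<omega>. ennreal (A i t \<omega>) \<partial>M) = ennreal (rate $ i)"
  using assms arrivals_mean[of i t] arrivals_nonneg
  by (subst nn_integral_eq_integral) auto

text \<open>Two independences are combined: between the arrivals to queue \<open>i\<close> and all other processes as
paths, and between the slots of the arrivals to queue \<open>i\<close>.\<close>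

lemma future_arrivals_independent:
  fixes G :: "(nat \<Rightarrow> observation) \<Rightarrow> ennreal"
  assumes \<phi>: "admissible \<phi>" and "t \<le> t'"
    and G[measurable]: "G \<in> borel_measurable (\<Pi>\<^sub>M s\<in>{..t}. observation_space)"
  shows "(\<integral>\<^sup>+\<omega>. G (obs \<phi> m\<^sub>0 t \<omega>) * ennreal (A i t' \<omega>) \<partial>M)
       = (\<integral>\<^sup>+\<omega>. G (obs \<phi> m\<^sub>0 t \<omega>) \<partial>M) * (\<integral>\<^sup>+\<omega>. ennreal (A i t' \<omega>) \<partial>M)"
proof -
  let ?S = "\<Pi>\<^sub>M k\<in>- {Arrivals i}. \<Pi>\<^sub>M t\<in>(UNIV :: nat set). (borel :: real measure)"
  let ?T = "\<Pi>\<^sub>M k\<in>{Arrivals i}. \<Pi>\<^sub>M t\<in>(UNIV :: nat set). (borel :: real measure)"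
  let ?X = "\<lambda>\<omega>. restrict (\<lambda>k. noise k \<omega>) (- {Arrivals i})"
  let ?Y = "\<lambda>\<omega>. restrict (\<lambda>k. noise k \<omega>) {Arrivals i}"
  have ind: "indep_var ?S ?X ?T ?Y"
    by (rule indep_var_restrict[OF indep_noise]) auto
  (* Noise assembled from two samples: arrivals to queue i from one, all other processes from the other. *)
  define w where "w p k = (if k = Arrivals i then snd p k else fst p k)"
    for p :: "(source \<Rightarrow> nat \<Rightarrow> real) \<times> (source \<Rightarrow> nat \<Rightarrow> real)" and k
  define h where "h p = history \<phi> m\<^sub>0 (\<lambda>i t. w p (Arrivals i) t) (\<lambda>i t. w p (Channel i) t = 1) (\<lambda>t. w p Coins t) t" for p
  have w_meas[measurable]: "(\<lambda>p. w p k s) \<in> borel_measurable (?S \<Otimes>\<^sub>M ?T)" for k s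
  proof (cases "k = Arrivals i")
    case True
    then show ?thesis unfolding w_def
      using measurable_compose[OF measurable_snd measurable_path_component[of k "{Arrivals i}" s]] by simp
  next
    case False
    then show ?thesis unfolding w_def
      using measurable_compose[OF measurable_fst measurable_path_component[of k "- {Arrivals i}" s]] by simp
  qed
  have [measurable]: "h \<in> ?S \<Otimes>\<^sub>M ?T \<rightarrow>\<^sub>M (\<Pi>\<^sub>M s\<in>{..t}. observation_space)"
    unfolding h_def by (rule measurable_history[OF \<phi>]) measurable
  have h_pair: "h (?X \<omega>', ?Y \<omega>) = history \<phi> m\<^sub>0 (\<lambda>j s. if j = i then A j s \<omega> else A j s \<omega>') (\<lambda>i t. C i t \<omega>') (\<lambda>t. U t \<omega>') t" for \<omega> \<omega>'
    unfolding h_def w_def by (intro history_cong) (auto simp: noise_simps)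
  have h_obs: "h (?X \<omega>, ?Y \<omega>) = obs \<phi> m\<^sub>0 t \<omega>" for \<omega>
    unfolding h_pair obs_def by (intro history_cong) auto
  have [measurable]: "?X \<in> M \<rightarrow>\<^sub>M ?S" "?Y \<in> M \<rightarrow>\<^sub>M ?T"
    by (intro measurable_restrict measurable_noise)+
  define F where "F p = G (h p) * ennreal (snd p (Arrivals i) t')" for p
  have "(\<lambda>p. snd p (Arrivals i) t') = (\<lambda>p. w p (Arrivals i) t')" by (simp add: w_def)
  then have [measurable]: "(\<lambda>p. snd p (Arrivals i) t') \<in> borel_measurable (?S \<Otimes>\<^sub>M ?T)" by simp
  have F[measurable]: "F \<in> borel_measurable (?S \<Otimes>\<^sub>M ?T)" unfolding F_def by measurable
  let ?m = "\<integral>\<^sup>+\<omega>. ennreal (A i t' \<omega>) \<partial>M"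
  (* With the other processes fixed at one sample, the history is a function of the arrivals before
     t, and the arrivals to queue i are independent over time. *)
  have inner: "(\<integral>\<^sup>+\<omega>. F (?X \<omega>', ?Y \<omega>) \<partial>M) = (\<integral>\<^sup>+\<omega>. G (h (?X \<omega>', ?Y \<omega>)) \<partial>M) * ?m" for \<omega>'
  proof -
    let ?A1 = "\<lambda>\<omega>. restrict (\<lambda>s. A i s \<omega>) {..<t}" and ?A2 = "\<lambda>\<omega>. restrict (\<lambda>s. A i s \<omega>) {t'}"
    have ind': "indep_var (\<Pi>\<^sub>M s\<in>{..<t}. borel) ?A1 (\<Pi>\<^sub>M s\<in>{t'}. borel) ?A2"
      using \<open>t \<le> t'\<close> by (intro indep_var_restrict[OF arrivals_indep]) auto
    (* Zero stands for the arrivals from slot t onwards, which the history does not use. *)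
    define g where "g x = G (history \<phi> m\<^sub>0 (\<lambda>j s. if j = i then (if s < t then x s else 0) else A j s \<omega>')
        (\<lambda>i t. C i t \<omega>') (\<lambda>t. U t \<omega>') t)" for x
    have comp: "(\<lambda>x. if j = i then (if s < t then x s else 0) else A j s \<omega>') \<in> borel_measurable (\<Pi>\<^sub>M s\<in>{..<t}. borel)" for j s
      by (cases "j = i"; cases "s < t") auto
    have g: "g \<in> borel_measurable (\<Pi>\<^sub>M s\<in>{..<t}. borel)"
      unfolding g_def
      by (rule measurable_compose[OF measurable_history[OF \<phi>, where a = "\<lambda>j s x. if j = i then (if s < t then x s else 0) else A j s \<omega>'"
              and c = "\<lambda>i t _. C i t \<omega>'" and u = "\<lambda>t _. U t \<omega>'"] G]) (auto intro: comp)
    have g_eq: "g (?A1 \<omega>) = G (h (?X \<omega>', ?Y \<omega>))" for \<omega>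
      unfolding g_def h_pair by (intro arg_cong[where f = G] history_cong) auto
    have "(\<integral>\<^sup>+\<omega>. g (?A1 \<omega>) * ennreal (?A2 \<omega> t') \<partial>M) = (\<integral>\<^sup>+\<omega>. g (?A1 \<omega>) \<partial>M) * (\<integral>\<^sup>+\<omega>. ennreal (?A2 \<omega> t') \<partial>M)"
      by (rule indep_var_nn_integral_mult[OF ind' g, of "\<lambda>x. ennreal (x t')"]) measurable
    then show ?thesis unfolding g_eq by (simp add: F_def noise_simps)
  qed
  have "(\<integral>\<^sup>+\<omega>. G (obs \<phi> m\<^sub>0 t \<omega>) * ennreal (A i t' \<omega>) \<partial>M) = (\<integral>\<^sup>+\<omega>. F (?X \<omega>, ?Y \<omega>) \<partial>M)"
    unfolding F_def h_obs by (simp add: noise_simps)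
  also have "\<dots> = (\<integral>\<^sup>+\<omega>'. (\<integral>\<^sup>+\<omega>. G (h (?X \<omega>', ?Y \<omega>)) \<partial>M) * ?m \<partial>M)"
    unfolding indep_var_nn_integral_pair[OF ind F] inner ..
  also have "\<dots> = (\<integral>\<^sup>+\<omega>'. (\<integral>\<^sup>+\<omega>. G (h (?X \<omega>', ?Y \<omega>)) \<partial>M) \<partial>M) * ?m"
    by (rule nn_integral_multc) measurable
  also have "(\<integral>\<^sup>+\<omega>'. (\<integral>\<^sup>+\<omega>. G (h (?X \<omega>', ?Y \<omega>)) \<partial>M) \<partial>M) = (\<integral>\<^sup>+\<omega>. G (h (?X \<omega>, ?Y \<omega>)) \<partial>M)"
    by (rule indep_var_nn_integral_pair[OF ind, symmetric]) measurable
  finally show ?thesis unfolding h_obs .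
qed

end

section \<open>Queue bounds and moments\<close>

lemma reward_bounds: "0 \<le> reward i s a" "reward i s a \<le> 1"
  by (simp_all add: reward_def)

context queueing_system
begin

abbreviation queue :: "policy \<Rightarrow> 2 \<Rightarrow> nat \<Rightarrow> 'w \<Rightarrow> real ^ 2" where
  "queue \<phi> m\<^sub>0 t \<omega> \<equiv> snd (obs \<phi> m\<^sub>0 t \<omega> t)"

abbreviation service :: "policy \<Rightarrow> 2 \<Rightarrow> 2 \<Rightarrow> nat \<Rightarrow> 'w \<Rightarrow> real" where
  "service \<phi> m\<^sub>0 i t \<omega> \<equiv> reward i (state_at \<phi> m\<^sub>0 t \<omega>) (stays \<phi> m\<^sub>0 t \<omega>)"

lemma queue_length_eq: "queue_length \<phi> m\<^sub>0 A C U i t \<omega> = queue \<phi> m\<^sub>0 t \<omega> $ i"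
  by (simp add: queue_length_def obs_def)

lemma queue_0: "queue \<phi> m\<^sub>0 0 \<omega> = 0"
  by (simp add: obs_def)

lemma queue_Suc:
  "queue \<phi> m\<^sub>0 (Suc t) \<omega> $ i = max (queue \<phi> m\<^sub>0 t \<omega> $ i - service \<phi> m\<^sub>0 i t \<omega>) 0 + A i t \<omega>"
  by (simp add: obs_def Let_def)

lemma queue_nonneg: "\<omega> \<in> space M \<Longrightarrow> 0 \<le> queue \<phi> m\<^sub>0 t \<omega> $ i"
  by (cases t) (simp_all add: queue_0 queue_Suc arrivals_nonneg)

lemma queue_growth:
  assumes "\<omega> \<in> space M"
  shows "queue \<phi> m\<^sub>0 (t + k) \<omega> $ i \<le> queue \<phi> m\<^sub>0 t \<omega> $ i + (\<Sum>s<k. A i (t + s) \<omega>)"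
proof (induction k)
  case (Suc k)
  have "queue \<phi> m\<^sub>0 (t + Suc k) \<omega> $ i \<le> queue \<phi> m\<^sub>0 (t + k) \<omega> $ i + A i (t + k) \<omega>"
    using queue_nonneg[OF assms, of \<phi> m\<^sub>0 "t + k" i] reward_bounds(1)[of i] by (simp add: queue_Suc)
  then show ?case using Suc by simp
qed simp

lemma queue_backlog:
  "(\<Sum>s<t. A i s \<omega>) - (\<Sum>s<t. service \<phi> m\<^sub>0 i s \<omega>) \<le> queue \<phi> m\<^sub>0 t \<omega> $ i"
proof (induction t)
  case (Suc t)
  have "queue \<phi> m\<^sub>0 t \<omega> $ i - service \<phi> m\<^sub>0 i t \<omega> + A i t \<omega> \<le> queue \<phi> m\<^sub>0 (Suc t) \<omega> $ i"
    unfolding queue_Suc by simp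
  then show ?case using Suc by simp
qed (simp add: queue_0)

text \<open>Using the services of a frame for the initial backlog only, and adding all arrivals on top, can
only overestimate the queue.\<close>

lemma queue_frame:
  assumes "\<omega> \<in> space M"
  shows "queue \<phi> m\<^sub>0 (t + k) \<omega> $ i
       \<le> max (queue \<phi> m\<^sub>0 t \<omega> $ i - (\<Sum>s<k. service \<phi> m\<^sub>0 i (t + s) \<omega>)) 0 + (\<Sum>s<k. A i (t + s) \<omega>)"
proof (induction k)
  case 0 then show ?case using queue_nonneg[OF assms] by simp
next
  case (Suc k)
  have "0 \<le> (\<Sum>s<k. A i (t + s) \<omega>)" using assms arrivals_nonneg by (intro sum_nonneg) auto
  then show ?case using Suc reward_bounds(1)[of i "state_at \<phi> m\<^sub>0 (t + k) \<omega>" "stays \<phi> m\<^sub>0 (t + k) \<omega>"]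
    by (simp add: queue_Suc)
qed

lemma measurable_state_at[measurable (raw)]:
  "admissible \<phi> \<Longrightarrow> (\<lambda>\<omega>. state_at \<phi> m\<^sub>0 t \<omega>) \<in> M \<rightarrow>\<^sub>M count_space UNIV"
  using measurable_compose[OF measurable_obs measurable_past_state(1)[of t t]] by simp

lemma measurable_stays:
  "admissible \<phi> \<Longrightarrow> (\<lambda>\<omega>. stays \<phi> m\<^sub>0 t \<omega>) \<in> M \<rightarrow>\<^sub>M count_space UNIV"
  using measurable_compose[OF measurable_Pair[OF measurable_obs measurable_coins] measurable_stay] by simp

lemma borel_measurable_state_action:
  fixes g :: "state \<Rightarrow> bool \<Rightarrow> real"
  assumes "admissible \<phi>"
  shows "(\<lambda>\<omega>. g (state_at \<phi> m\<^sub>0 t \<omega>) (stays \<phi> m\<^sub>0 t \<omega>)) \<in> borel_measurable M"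
  using measurable_compose[OF measurable_countable2[OF measurable_state_at[OF assms]
        measurable_stays[OF assms], of Pair], of "\<lambda>(s, b). g s b" borel] by simp

lemma measurable_queue:
  assumes "admissible \<phi>"
  shows "(\<lambda>\<omega>. queue \<phi> m\<^sub>0 t \<omega>) \<in> borel_measurable M"
  using measurable_compose[OF measurable_obs[OF assms] measurable_past_state(2)[of t t]] by simp

lemma measurable_queue_component:
  assumes "admissible \<phi>"
  shows "(\<lambda>\<omega>. queue \<phi> m\<^sub>0 t \<omega> $ i) \<in> borel_measurable M"
  by (rule measurable_compose[OF measurable_queue[OF assms] borel_measurable_nth])

lemma integrable_arrivals_square: "integrable M (\<lambda>\<omega>. (A i t \<omega>)\<^sup>2)"
  using arrivals_second_moment by blast

lemma integrable_arrivals: "integrable M (A i t)"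
  by (rule square_integrable_imp_integrable[OF _ integrable_arrivals_square]) simp

lemma arrivals_sum_square_le: "(\<Sum>s<k. A i (t + s) \<omega>)\<^sup>2 \<le> (\<Sum>s<k. (A i (t + s) \<omega>)\<^sup>2) * real k"
  using sum_squared_le_sum_of_squares[of "\<lambda>s. A i (t + s) \<omega>" "{..<k}"] by simp

lemma integrable_arrivals_sum_square: "integrable M (\<lambda>\<omega>. (\<Sum>s<k. A i (t + s) \<omega>)\<^sup>2)"
proof (rule Bochner_Integration.integrable_bound)
  show "integrable M (\<lambda>\<omega>. (\<Sum>s<k. (A i (t + s) \<omega>)\<^sup>2) * real k)"
    by (intro Bochner_Integration.integrable_mult_left Bochner_Integration.integrable_sum
        integrable_arrivals_square)
  show "AE \<omega> in M. norm ((\<Sum>s<k. A i (t + s) \<omega>)\<^sup>2) \<le> norm ((\<Sum>s<k. (A i (t + s) \<omega>)\<^sup>2) * real k)"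
    by (intro always_eventually allI order.trans[OF _ abs_ge_self[of "_ * real k"], simplified real_norm_def[symmetric]])
       (simp add: arrivals_sum_square_le)
qed simp

lemma integrable_queue_square:
  assumes "admissible \<phi>"
  shows "integrable M (\<lambda>\<omega>. (queue \<phi> m\<^sub>0 t \<omega> $ i)\<^sup>2)"
proof (rule Bochner_Integration.integrable_bound[OF integrable_arrivals_sum_square[where t = 0 and k = t and i = i]])
  show "AE \<omega> in M. norm ((queue \<phi> m\<^sub>0 t \<omega> $ i)\<^sup>2) \<le> norm ((\<Sum>s<t. A i (0 + s) \<omega>)\<^sup>2)"
  proof (rule AE_I2)
    fix \<omega> assume \<omega>: "\<omega> \<in> space M"
    have "queue \<phi> m\<^sub>0 t \<omega> $ i \<le> (\<Sum>s<t. A i (0 + s) \<omega>)"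
      using queue_growth[OF \<omega>, of \<phi> m\<^sub>0 0 t i] by (simp add: queue_0)
    then show "norm ((queue \<phi> m\<^sub>0 t \<omega> $ i)\<^sup>2) \<le> norm ((\<Sum>s<t. A i (0 + s) \<omega>)\<^sup>2)"
      using queue_nonneg[OF \<omega>] by (simp add: power_mono)
  qed
qed (use measurable_queue_component[OF assms] in simp)

lemma integrable_queue:
  assumes "admissible \<phi>"
  shows "integrable M (\<lambda>\<omega>. queue \<phi> m\<^sub>0 t \<omega> $ i)"
  by (rule square_integrable_imp_integrable[OF measurable_queue_component[OF assms] integrable_queue_square[OF assms]])

lemma nn_integral_queue_length:
  assumes "admissible \<phi>"
  shows "(\<integral>\<^sup>+\<omega>. ennreal (queue_length \<phi> m\<^sub>0 A C U i t \<omega>) \<partial>M) = ennreal (expectation (\<lambda>\<omega>. queue \<phi> m\<^sub>0 t \<omega> $ i))"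
  unfolding queue_length_eq using queue_nonneg
  by (intro nn_integral_eq_integral integrable_queue[OF assms]) auto

definition mean_backlog :: "policy \<Rightarrow> 2 \<Rightarrow> nat \<Rightarrow> real" where
  "mean_backlog \<phi> m\<^sub>0 t = (\<Sum>i\<in>UNIV. expectation (\<lambda>\<omega>. queue \<phi> m\<^sub>0 t \<omega> $ i))"

lemma expectation_queue_nonneg: "0 \<le> expectation (\<lambda>\<omega>. queue \<phi> m\<^sub>0 t \<omega> $ i)"
  using queue_nonneg by (intro integral_nonneg_AE) auto

lemma mean_backlog_nonneg: "0 \<le> mean_backlog \<phi> m\<^sub>0 t"
  unfolding mean_backlog_def by (intro sum_nonneg expectation_queue_nonneg)

lemma backlog_average_eq:
  assumes "admissible \<phi>" "0 < t"
  shows "(\<Sum>\<tau><t. \<Sum>i\<in>UNIV. \<integral>\<^sup>+\<omega>. ennreal (queue_length \<phi> m\<^sub>0 A C U i \<tau> \<omega>) \<partial>M) / of_nat t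
       = ennreal ((\<Sum>\<tau><t. mean_backlog \<phi> m\<^sub>0 \<tau>) / real t)"
  using assms(2) mean_backlog_nonneg
  by (simp add: nn_integral_queue_length[OF assms(1)] expectation_queue_nonneg sum_nonneg mean_backlog_def
      ennreal_of_nat_eq_real_of_nat divide_ennreal)

section \<open>Stabilizable rates are dominated by the saturated region\<close>

definition occupation :: "policy \<Rightarrow> 2 \<Rightarrow> nat \<Rightarrow> state \<Rightarrow> bool \<Rightarrow> real" where
  "occupation \<phi> m\<^sub>0 t s a = expectation (\<lambda>\<omega>. of_bool (state_at \<phi> m\<^sub>0 t \<omega> = s \<and> stays \<phi> m\<^sub>0 t \<omega> = a))"

lemma integrable_state_action:
  fixes g :: "state \<Rightarrow> bool \<Rightarrow> real"
  assumes "admissible \<phi>"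
  shows "integrable M (\<lambda>\<omega>. g (state_at \<phi> m\<^sub>0 t \<omega>) (stays \<phi> m\<^sub>0 t \<omega>))"
proof (rule integrable_const_bound)
  show "AE \<omega> in M. norm (g (state_at \<phi> m\<^sub>0 t \<omega>) (stays \<phi> m\<^sub>0 t \<omega>))
      \<le> Max (range (\<lambda>p. norm (g (fst p) (snd p))))"
    by (intro AE_I2 Max_ge) (auto intro!: image_eqI[of _ _ "(state_at \<phi> m\<^sub>0 t _, stays \<phi> m\<^sub>0 t _)"])
qed (rule borel_measurable_state_action[OF assms])

lemma expectation_state_action:
  fixes g :: "state \<Rightarrow> bool \<Rightarrow> real"
  assumes "admissible \<phi>"
  shows "expectation (\<lambda>\<omega>. g (state_at \<phi> m\<^sub>0 t \<omega>) (stays \<phi> m\<^sub>0 t \<omega>))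
       = (\<Sum>s\<in>UNIV. \<Sum>a\<in>UNIV. g s a * occupation \<phi> m\<^sub>0 t s a)"
proof -
  have eq: "g s' a' = (\<Sum>s\<in>UNIV. \<Sum>a\<in>UNIV. g s a * of_bool (s' = s \<and> a' = a))" for s' a'
  proof -
    have "(\<Sum>a\<in>UNIV. g s a * of_bool (s' = s \<and> a' = a)) = (if s' = s then g s a' else 0)" for s
      by (cases a') (auto simp: UNIV_bool)
    then show ?thesis by simp
  qed
  have int: "integrable M (\<lambda>\<omega>. g s a * of_bool (state_at \<phi> m\<^sub>0 t \<omega> = s \<and> stays \<phi> m\<^sub>0 t \<omega> = a))" for s a
    by (intro integrable_mult_right integrable_state_action[OF assms, of "\<lambda>s' a'. of_bool (s' = s \<and> a' = a)"])
  have "expectation (\<lambda>\<omega>. g (state_at \<phi> m\<^sub>0 t \<omega>) (stays \<phi> m\<^sub>0 t \<omega>))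
      = expectation (\<lambda>\<omega>. \<Sum>s\<in>UNIV. \<Sum>a\<in>UNIV. g s a * of_bool (state_at \<phi> m\<^sub>0 t \<omega> = s \<and> stays \<phi> m\<^sub>0 t \<omega> = a))"
    by (subst eq) (rule refl)
  also have "\<dots> = (\<Sum>s\<in>UNIV. expectation (\<lambda>\<omega>. \<Sum>a\<in>UNIV. g s a * of_bool (state_at \<phi> m\<^sub>0 t \<omega> = s \<and> stays \<phi> m\<^sub>0 t \<omega> = a)))"
    by (intro Bochner_Integration.integral_sum Bochner_Integration.integrable_sum int)
  also have "\<dots> = (\<Sum>s\<in>UNIV. \<Sum>a\<in>UNIV. expectation (\<lambda>\<omega>. g s a * of_bool (state_at \<phi> m\<^sub>0 t \<omega> = s \<and> stays \<phi> m\<^sub>0 t \<omega> = a)))"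
    by (intro sum.cong refl Bochner_Integration.integral_sum int)
  also have "\<dots> = (\<Sum>s\<in>UNIV. \<Sum>a\<in>UNIV. g s a * occupation \<phi> m\<^sub>0 t s a)"
    unfolding occupation_def by (intro sum.cong refl integral_mult_right_zero)
  finally show ?thesis .
qed

lemma occupation_flow_occupation:
  assumes \<phi>: "admissible \<phi>" and \<epsilon>: "0 < \<epsilon>" "\<epsilon> < 1"
  shows "occupation_flow \<epsilon> (occupation \<phi> m\<^sub>0)"
  unfolding occupation_flow_def
proof (intro conjI allI)
  show "0 \<le> occupation \<phi> m\<^sub>0 t s a" for t s a
    unfolding occupation_def by (rule integral_nonneg_AE) simp
  show "total_mass (occupation \<phi> m\<^sub>0 t) = 1" for t
    using expectation_state_action[OF \<phi>, of "\<lambda>_ _. 1" m\<^sub>0 t] prob_space by (simp add: total_mass_def)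
  fix t s
  have "(\<Sum>a\<in>UNIV. occupation \<phi> m\<^sub>0 (Suc t) s a)
      = (\<Sum>s'\<in>UNIV. \<Sum>a\<in>UNIV. of_bool (s' = s) * occupation \<phi> m\<^sub>0 (Suc t) s' a)"
  proof -
    have "(\<Sum>a\<in>UNIV. of_bool (s' = s) * occupation \<phi> m\<^sub>0 (Suc t) s' a)
        = (if s' = s then \<Sum>a\<in>UNIV. occupation \<phi> m\<^sub>0 (Suc t) s' a else 0)" for s'
      by simp
    then show ?thesis by simp
  qed
  also have "\<dots> = expectation (\<lambda>\<omega>. 1 * of_bool (state_at \<phi> m\<^sub>0 (Suc t) \<omega> = s))"
    using expectation_state_action[OF \<phi>, of "\<lambda>s' _. of_bool (s' = s)" m\<^sub>0 "Suc t"] by simp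
  also have "\<dots> = expectation (\<lambda>\<omega>. 1 * trans_prob \<epsilon> (state_at \<phi> m\<^sub>0 t \<omega>) (stays \<phi> m\<^sub>0 t \<omega>) s)"
    by (rule controlled_markov[OF \<phi> \<epsilon>, of "\<lambda>_. 1"]) auto
  also have "\<dots> = (\<Sum>s'\<in>UNIV. \<Sum>a\<in>UNIV. trans_prob \<epsilon> s' a s * occupation \<phi> m\<^sub>0 t s' a)"
    using expectation_state_action[OF \<phi>, of "\<lambda>s' a. trans_prob \<epsilon> s' a s" m\<^sub>0 t] by simp
  finally show "(\<Sum>a\<in>UNIV. occupation \<phi> m\<^sub>0 (Suc t) s a)
      = (\<Sum>s'\<in>UNIV. \<Sum>a\<in>UNIV. trans_prob \<epsilon> s' a s * occupation \<phi> m\<^sub>0 t s' a)" .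
qed

text \<open>Since \<open>Q\<^sub>i(t)\<close> is at least all arrivals minus all offered service, the gap between the arrival rate
and the average reward is covered by the mean backlog per slot.\<close>

lemma expectation_backlog:
  assumes \<phi>: "admissible \<phi>" and "0 < t"
  shows "rate $ i - (\<Sum>s\<in>UNIV. \<Sum>a\<in>UNIV. time_average (occupation \<phi> m\<^sub>0) t s a * reward i s a)
      \<le> expectation (\<lambda>\<omega>. queue \<phi> m\<^sub>0 t \<omega> $ i) / real t"
proof -
  have int: "integrable M (\<lambda>\<omega>. service \<phi> m\<^sub>0 i s \<omega>)" for s
    by (rule integrable_state_action[OF \<phi>])
  have "(\<Sum>s<t. expectation (service \<phi> m\<^sub>0 i s))
      = (\<Sum>\<tau><t. \<Sum>s\<in>UNIV. \<Sum>a\<in>UNIV. reward i s a * occupation \<phi> m\<^sub>0 \<tau> s a)"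
    by (simp add: expectation_state_action[OF \<phi>])
  also have "\<dots> = (\<Sum>s\<in>UNIV. \<Sum>\<tau><t. \<Sum>a\<in>UNIV. reward i s a * occupation \<phi> m\<^sub>0 \<tau> s a)"
    by (rule sum.swap)
  also have "\<dots> = (\<Sum>s\<in>UNIV. \<Sum>a\<in>UNIV. \<Sum>\<tau><t. reward i s a * occupation \<phi> m\<^sub>0 \<tau> s a)"
    by (intro sum.cong refl sum.swap)
  also have "\<dots> = real t * (\<Sum>s\<in>UNIV. \<Sum>a\<in>UNIV. time_average (occupation \<phi> m\<^sub>0) t s a * reward i s a)"
  proof -
    have "(\<Sum>\<tau><t. reward i s a * occupation \<phi> m\<^sub>0 \<tau> s a)
        = real t * (time_average (occupation \<phi> m\<^sub>0) t s a * reward i s a)" for s a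
      using \<open>0 < t\<close> by (simp add: time_average_def mult.commute flip: sum_distrib_left)
    then show ?thesis by (simp only: sum_distrib_left)
  qed
  finally have served: "(\<Sum>s<t. expectation (service \<phi> m\<^sub>0 i s))
      = real t * (\<Sum>s\<in>UNIV. \<Sum>a\<in>UNIV. time_average (occupation \<phi> m\<^sub>0) t s a * reward i s a)" .
  have "real t * rate $ i - (\<Sum>s<t. expectation (service \<phi> m\<^sub>0 i s))
      = expectation (\<lambda>\<omega>. (\<Sum>s<t. A i s \<omega>) - (\<Sum>s<t. service \<phi> m\<^sub>0 i s \<omega>))"
    by (simp add: int integrable_arrivals arrivals_mean)
  also have "\<dots> \<le> expectation (\<lambda>\<omega>. queue \<phi> m\<^sub>0 t \<omega> $ i)"
    by (intro integral_mono integrable_queue[OF \<phi>] Bochner_Integration.integrable_diff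
        Bochner_Integration.integrable_sum int integrable_arrivals queue_backlog)
  finally show ?thesis using \<open>0 < t\<close> unfolding served by (simp add: field_simps)
qed

end

text \<open>Staying above twice the bound on one half of a long horizon would already violate it.\<close>

lemma frequently_bounded_of_bounded_average:
  fixes Q :: "nat \<Rightarrow> real"
  assumes nn: "\<And>t. 0 \<le> Q t" and "0 \<le> K"
    and bound: "eventually (\<lambda>t. (\<Sum>\<tau><t. Q \<tau>) \<le> K * real t) sequentially"
  shows "\<exists>f :: nat \<Rightarrow> nat. strict_mono f \<and> (\<forall>n. Q (f n) \<le> 2 * K + 2)"
proof -
  have "\<not> eventually (\<lambda>t. \<not> Q t \<le> 2 * K + 2) sequentially"
  proof
    assume "eventually (\<lambda>t. \<not> Q t \<le> 2 * K + 2) sequentially"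
    then obtain N where N: "\<And>t. N \<le> t \<Longrightarrow> 2 * K + 2 \<le> Q t"
      unfolding eventually_sequentially by force
    obtain N' where N': "\<And>t. N' \<le> t \<Longrightarrow> (\<Sum>\<tau><t. Q \<tau>) \<le> K * real t"
      using bound unfolding eventually_sequentially by blast
    (* The window from n to 2 n alone outweighs the bound K at horizon 2 n. *)
    define n where "n = N + N' + 1"
    have "real n * (2 * K + 2) = (\<Sum>\<tau>\<in>{n..<2 * n}. 2 * K + 2)" by simp
    also have "\<dots> \<le> (\<Sum>\<tau>\<in>{n..<2 * n}. Q \<tau>)" by (intro sum_mono N) (auto simp: n_def)
    also have "\<dots> \<le> (\<Sum>\<tau><2 * n. Q \<tau>)" by (intro sum_mono2 nn) auto
    also have "\<dots> \<le> K * real (2 * n)" by (intro N') (simp add: n_def)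
    finally have "real n * 2 \<le> 0" by (simp add: algebra_simps)
    then show False by (simp add: n_def)
  qed
  then show ?thesis using not_eventually_sequentiallyD[of "\<lambda>t. \<not> Q t \<le> 2 * K + 2"] by simp
qed

context queueing_system
begin

text \<open>Stability bounds the mean backlog along a sequence of horizons.  Along it the
average reward catches up with the arrival rate, and a limit point of the time averages lies in the
occupation polytope.\<close>

lemma stable_rate_dominated:
  assumes \<phi>: "admissible \<phi>" and \<epsilon>: "0 < \<epsilon>" "\<epsilon> < 1" and stable: "queues_stable M \<phi> m\<^sub>0 A C U"
  shows "\<exists>r\<in>saturated_region \<epsilon>. \<forall>i. rate $ i \<le> r $ i"
proof -
  let ?Q = "mean_backlog \<phi> m\<^sub>0"
  let ?E = "\<lambda>i t. expectation (\<lambda>\<omega>. queue \<phi> m\<^sub>0 t \<omega> $ i)"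
  obtain K where K: "0 \<le> K" "eventually (\<lambda>t. (\<Sum>\<tau><t. ?Q \<tau>) \<le> K * real t) sequentially"
  proof -
    obtain c :: ennreal where c: "limsup (\<lambda>t. (\<Sum>\<tau><t. \<Sum>i\<in>UNIV. \<integral>\<^sup>+\<omega>. ennreal (queue_length \<phi> m\<^sub>0 A C U i \<tau> \<omega>) \<partial>M)
                 / of_nat t) < c" "c < \<infinity>"
      using dense[OF stable[unfolded queues_stable_def]] by blast
    obtain K where K: "0 \<le> K" "c = ennreal K" using c(2) by (cases c) auto
    have "eventually (\<lambda>t. (\<Sum>\<tau><t. ?Q \<tau>) \<le> K * real t) sequentially"
      using Limsup_lessD[OF c(1)] eventually_gt_at_top[of 0]
    proof eventually_elim
      case (elim t)
      then have "ennreal ((\<Sum>\<tau><t. ?Q \<tau>) / real t) < ennreal K"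
        using backlog_average_eq[OF \<phi>, of t m\<^sub>0] K(2) by simp
      then have "(\<Sum>\<tau><t. ?Q \<tau>) / real t \<le> K"
        using K(1) by (meson ennreal_leI leD linorder_le_cases)
      then show ?case using elim(2) by (simp add: field_simps)
    qed
    then show ?thesis using K(1) that by blast
  qed
  obtain f :: "nat \<Rightarrow> nat" where f: "strict_mono f" "\<And>n. ?Q (f n) \<le> 2 * K + 2"
    using frequently_bounded_of_bounded_average[OF mean_backlog_nonneg K] by blast
  have E_le: "?E i (f n) \<le> 2 * K + 2" for i n
  proof -
    have "?E i (f n) \<le> ?Q (f n)"
      unfolding mean_backlog_def by (intro member_le_sum[where f = "\<lambda>i. ?E i (f n)"] expectation_queue_nonneg) auto
    then show ?thesis using f(2)[of n] by linarith
  qed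
  obtain x g where x: "x \<in> occupation_polytope \<epsilon>" and g: "strict_mono g"
    and lim: "\<And>s a. (\<lambda>n. time_average (occupation \<phi> m\<^sub>0) (f (g n)) s a) \<longlonglongrightarrow> x s a"
    using time_average_limit_point[OF occupation_flow_occupation[OF \<phi> \<epsilon>] f(1)] by blast
  have fg: "strict_mono (f \<circ> g)" using f(1) g by (rule strict_mono_o)
  have fg_inf: "filterlim (\<lambda>n. real (f (g n))) at_top sequentially"
    using filterlim_compose[OF filterlim_real_sequentially filterlim_subseq[OF fg]] by (simp add: comp_def)
  have "rate $ i \<le> rate_vector x $ i" for i
  proof -
    let ?r = "\<lambda>n. \<Sum>s\<in>UNIV. \<Sum>a\<in>UNIV. time_average (occupation \<phi> m\<^sub>0) (f (g n)) s a * reward i s a"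
    (* Along the chosen horizons the mean backlog is bounded, so divided by the horizon it vanishes. *)
    have "(\<lambda>n. ?r n + (2 * K + 2) / real (f (g n))) \<longlonglongrightarrow> rate_vector x $ i + 0"
      by (intro tendsto_add real_tendsto_divide_at_top[OF tendsto_const fg_inf]
          tendsto_rate_vector[of "\<lambda>n. time_average (occupation \<phi> m\<^sub>0) (f (g n))"] lim)
    moreover have "eventually (\<lambda>n. rate $ i \<le> ?r n + (2 * K + 2) / real (f (g n))) sequentially"
      using eventually_gt_at_top[of 0]
    proof eventually_elim
      case (elim n)
      then have "0 < f (g n)" using seq_suble[OF fg, of n] by simp
      then have "rate $ i - ?r n \<le> ?E i (f (g n)) / real (f (g n))" by (rule expectation_backlog[OF \<phi>])
      also have "\<dots> \<le> (2 * K + 2) / real (f (g n))" by (intro divide_right_mono E_le) simp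
      finally show ?case by linarith
    qed
    ultimately show ?thesis using tendsto_lowerbound[of _ _ sequentially "rate $ i"] by fastforce
  qed
  moreover have "rate_vector x \<in> saturated_region \<epsilon>" using x by (simp add: saturated_region_def)
  ultimately show ?thesis by blast
qed

end

lemma stability_region_dominated:
  assumes \<epsilon>: "0 < \<epsilon>" "\<epsilon> < 1" and "r' \<in> stability_region \<epsilon>"
  shows "\<exists>r\<in>saturated_region \<epsilon>. \<forall>i. r' $ i \<le> r $ i"
  using assms(3) queueing_system.stable_rate_dominated[OF _ _ \<epsilon>] unfolding stability_region_def by blast

section \<open>Service during one frame\<close>

context queueing_system
begin

text \<open>A policy with probabilities \<open>0\<close> and \<open>1\<close> almost surely ignores the coin; the coin value \<open>1\<close>,
a null event, is the exception.\<close>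

lemma AE_coin_lt_of_bool: "AE \<omega> in M. U t \<omega> < of_bool b \<longleftrightarrow> b"
proof -
  have "AE u :: real in lborel. u \<in> {0..1} \<longrightarrow> (u < of_bool b \<longleftrightarrow> b)" for b
    using AE_lborel_singleton[of "1 :: real"] by (rule eventually_mono) (cases b; auto)
  then have "AE u :: real in uniform_measure lborel {0..1}. (u < of_bool b \<longleftrightarrow> b)"
    by (intro AE_uniform_measureI) auto
  then show ?thesis
    unfolding coins_uniform[of t, symmetric] by (rule AE_distrD[OF measurable_coins])
qed

lemma obs_stable: "s \<le> t \<Longrightarrow> obs \<phi> m\<^sub>0 t \<omega> s = obs \<phi> m\<^sub>0 s \<omega> s"
  unfolding obs_def by (rule history_stable)

text \<open>A weight \<open>W\<close> fixed by the observation in slot \<open>t\<close> plays the role of conditioning on it.  Where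
\<open>W\<close> is nonzero, the state at \<open>t\<close> is \<open>s0\<close> and \<open>\<pi>\<close> is applied, so the weighted state law \<open>k\<close> slots later
is the law of the chain of \<open>\<pi>\<close> started in \<open>s0\<close>.\<close>

lemma weighted_frame_service:
  fixes W :: "observation \<Rightarrow> real"
  assumes \<phi>: "admissible \<phi>" and \<epsilon>: "0 < \<epsilon>" "\<epsilon> < 1"
    and W: "W \<in> borel_measurable observation_space"
    and W_nn: "\<And>\<omega>. \<omega> \<in> space M \<Longrightarrow> 0 \<le> W (obs \<phi> m\<^sub>0 t \<omega> t)"
    and W_int: "integrable M (\<lambda>\<omega>. W (obs \<phi> m\<^sub>0 t \<omega> t))"
    and start: "\<And>\<omega>. \<omega> \<in> space M \<Longrightarrow> W (obs \<phi> m\<^sub>0 t \<omega> t) \<noteq> 0 \<Longrightarrow> state_at \<phi> m\<^sub>0 t \<omega> = s0"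
    and follow: "\<And>k. k < n \<Longrightarrow> AE \<omega> in M. W (obs \<phi> m\<^sub>0 t \<omega> t) \<noteq> 0 \<longrightarrow>
          stays \<phi> m\<^sub>0 (t + k) \<omega> = \<pi> (state_at \<phi> m\<^sub>0 (t + k) \<omega>)"
    and "k < n"
  shows "expectation (\<lambda>\<omega>. W (obs \<phi> m\<^sub>0 t \<omega> t) * service \<phi> m\<^sub>0 i (t + k) \<omega>)
           = expectation (\<lambda>\<omega>. W (obs \<phi> m\<^sub>0 t \<omega> t)) * mean_reward \<epsilon> \<pi> s0 i k"
proof -
  let ?W = "\<lambda>\<omega>. W (obs \<phi> m\<^sub>0 t \<omega> t)"
  have int: "integrable M (\<lambda>\<omega>. ?W \<omega> * of_bool (state_at \<phi> m\<^sub>0 t' \<omega> = s))" for t' s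
  proof (rule Bochner_Integration.integrable_bound[OF W_int])
    show "(\<lambda>\<omega>. ?W \<omega> * of_bool (state_at \<phi> m\<^sub>0 t' \<omega> = s)) \<in> borel_measurable M"
      using borel_measurable_state_action[OF \<phi>, of "\<lambda>s' _. of_bool (s' = s)"]
      by (intro borel_measurable_times borel_measurable_integrable[OF W_int]) auto
  qed (auto simp: of_bool_def)
  have act: "expectation (\<lambda>\<omega>. ?W \<omega> * g (state_at \<phi> m\<^sub>0 (t + k) \<omega>) (stays \<phi> m\<^sub>0 (t + k) \<omega>))
      = (\<Sum>s\<in>UNIV. expectation (\<lambda>\<omega>. ?W \<omega> * of_bool (state_at \<phi> m\<^sub>0 (t + k) \<omega> = s)) * g s (\<pi> s))"
    if "k < n" for g k
  proof -
    have "expectation (\<lambda>\<omega>. ?W \<omega> * g (state_at \<phi> m\<^sub>0 (t + k) \<omega>) (stays \<phi> m\<^sub>0 (t + k) \<omega>))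
        = expectation (\<lambda>\<omega>. \<Sum>s\<in>UNIV. ?W \<omega> * of_bool (state_at \<phi> m\<^sub>0 (t + k) \<omega> = s) * g s (\<pi> s))"
    proof (rule integral_cong_AE)
      have sum: "(\<Sum>s\<in>UNIV. ?W \<omega> * of_bool (state_at \<phi> m\<^sub>0 (t + k) \<omega> = s) * g s (\<pi> s))
          = ?W \<omega> * g (state_at \<phi> m\<^sub>0 (t + k) \<omega>) (\<pi> (state_at \<phi> m\<^sub>0 (t + k) \<omega>))" for \<omega>
        by (simp add: of_bool_def if_distrib if_distribR sum.delta cong: if_cong)
      show "AE \<omega> in M. ?W \<omega> * g (state_at \<phi> m\<^sub>0 (t + k) \<omega>) (stays \<phi> m\<^sub>0 (t + k) \<omega>)
          = (\<Sum>s\<in>UNIV. ?W \<omega> * of_bool (state_at \<phi> m\<^sub>0 (t + k) \<omega> = s) * g s (\<pi> s))"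
        unfolding sum using follow[OF that] by eventually_elim auto
      show "(\<lambda>\<omega>. ?W \<omega> * g (state_at \<phi> m\<^sub>0 (t + k) \<omega>) (stays \<phi> m\<^sub>0 (t + k) \<omega>)) \<in> borel_measurable M"
        by (intro borel_measurable_times borel_measurable_integrable[OF W_int] borel_measurable_state_action[OF \<phi>])
      show "(\<lambda>\<omega>. \<Sum>s\<in>UNIV. ?W \<omega> * of_bool (state_at \<phi> m\<^sub>0 (t + k) \<omega> = s) * g s (\<pi> s)) \<in> borel_measurable M"
        by (intro borel_measurable_sum borel_measurable_times borel_measurable_integrable[OF int]) auto
    qed
    also have "\<dots> = (\<Sum>s\<in>UNIV. expectation (\<lambda>\<omega>. ?W \<omega> * of_bool (state_at \<phi> m\<^sub>0 (t + k) \<omega> = s)) * g s (\<pi> s))"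
      by (simp add: Bochner_Integration.integral_sum int)
    finally show ?thesis .
  qed
  have chain: "expectation (\<lambda>\<omega>. ?W \<omega> * of_bool (state_at \<phi> m\<^sub>0 (t + k) \<omega> = s))
      = expectation ?W * chain_dist \<epsilon> \<pi> s0 k s" if "k \<le> n" for k s
    using that
  proof (induction k arbitrary: s)
    case 0
    have "expectation (\<lambda>\<omega>. ?W \<omega> * of_bool (state_at \<phi> m\<^sub>0 t \<omega> = s)) = expectation (\<lambda>\<omega>. ?W \<omega> * of_bool (s = s0))"
      using start by (intro Bochner_Integration.integral_cong) (auto simp: of_bool_def)
    then show ?case by simp
  next
    case (Suc k)
    have W_past: "(\<lambda>p. W (fst p t)) \<in> borel_measurable ((\<Pi>\<^sub>M s\<in>{..t + k}. observation_space) \<Otimes>\<^sub>M (borel :: real measure))"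
      by (intro measurable_compose[OF _ W] measurable_compose[OF measurable_fst measurable_component_singleton]) simp
    have past: "obs \<phi> m\<^sub>0 (t + k) \<omega> t = obs \<phi> m\<^sub>0 t \<omega> t" for \<omega> by (rule obs_stable) simp
    have "expectation (\<lambda>\<omega>. ?W \<omega> * of_bool (state_at \<phi> m\<^sub>0 (t + Suc k) \<omega> = s))
        = expectation (\<lambda>\<omega>. ?W \<omega> * trans_prob \<epsilon> (state_at \<phi> m\<^sub>0 (t + k) \<omega>) (stays \<phi> m\<^sub>0 (t + k) \<omega>) s)"
      using controlled_markov[OF \<phi> \<epsilon> W_past, of m\<^sub>0 s] W_nn by (simp add: past)
    also have "\<dots> = (\<Sum>s'\<in>UNIV. expectation (\<lambda>\<omega>. ?W \<omega> * of_bool (state_at \<phi> m\<^sub>0 (t + k) \<omega> = s')) * trans_prob \<epsilon> s' (\<pi> s') s)"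
      using Suc.prems act[of k "\<lambda>s' a. trans_prob \<epsilon> s' a s"] by simp
    also have "\<dots> = expectation ?W * chain_dist \<epsilon> \<pi> s0 (Suc k) s"
      using Suc.prems by (simp add: Suc.IH sum_distrib_left mult.assoc)
    finally show ?case .
  qed
  show ?thesis
    using act[OF \<open>k < n\<close>, of "reward i"] chain \<open>k < n\<close> by (simp add: mean_reward_def sum_distrib_left mult.assoc)
qed

end

text \<open>Meaningful for policies with a single recurrent class that attain some rate; this rate is then unique.\<close>

definition attained_rate :: "real \<Rightarrow> (state \<Rightarrow> bool) \<Rightarrow> real ^ 2" where
  "attained_rate \<epsilon> \<pi> = (SOME r. attains \<epsilon> \<pi> r)"

lemma fbdc_choice_attained_rate:
  assumes \<epsilon>: "0 < \<epsilon>" "\<epsilon> < 1" and choice: "fbdc_choice \<epsilon> q \<pi>"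
  shows "attains \<epsilon> \<pi> (attained_rate \<epsilon> \<pi>)"
    and "r' \<in> saturated_region \<epsilon> \<Longrightarrow> q \<bullet> r' \<le> q \<bullet> attained_rate \<epsilon> \<pi>"
proof -
  obtain r where r: "\<forall>r'\<in>saturated_region \<epsilon>. q \<bullet> r' \<le> q \<bullet> r" "attains \<epsilon> \<pi> r"
    using choice by (auto simp: fbdc_choice_def)
  show att: "attains \<epsilon> \<pi> (attained_rate \<epsilon> \<pi>)"
    unfolding attained_rate_def using r(2) by (rule someI)
  have uniq: "\<exists>!R. recurrent_class \<epsilon> \<pi> R" using choice unfolding fbdc_choice_def by (rule conjunct2)
  have "attained_rate \<epsilon> \<pi> = r" by (rule attained_rate_unique[OF \<epsilon> uniq att r(2)])
  then show "q \<bullet> r' \<le> q \<bullet> attained_rate \<epsilon> \<pi>" if "r' \<in> saturated_region \<epsilon>"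
    using r(1) that by blast
qed

definition frame_policy :: "(nat \<Rightarrow> real ^ 2 \<Rightarrow> state \<Rightarrow> bool) \<Rightarrow> nat \<Rightarrow> policy" where
  "frame_policy sel T = (\<lambda>t h. of_bool (sel (t div T) (snd (h (T * (t div T)))) (fst (h t))))"

lemma admissible_frame_policy:
  assumes sel: "\<And>j. sel j \<in> borel \<rightarrow>\<^sub>M count_space UNIV"
  shows "admissible (frame_policy sel T)"
  unfolding admissible_def
proof (intro allI conjI ballI)
  fix t :: nat
  let ?N = "\<Pi>\<^sub>M s\<in>{..t}. observation_space"
  have le: "T * (t div T) \<le> t" by simp
  have \<pi>: "(\<lambda>h. sel (t div T) (snd (h (T * (t div T))))) \<in> ?N \<rightarrow>\<^sub>M count_space UNIV"
    by (rule measurable_compose[OF measurable_past_state(2)[OF le] sel])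
  show "frame_policy sel T t \<in> borel_measurable ?N"
    unfolding frame_policy_def
    using measurable_compose[OF measurable_countable2[OF \<pi> measurable_past_state(1)[OF order_refl], of "\<lambda>\<pi> s. \<pi> s"],
        of "of_bool" borel] by simp
qed (auto simp: frame_policy_def)

context queueing_system
begin

text \<open>Splitting by the policy of the frame and the state at its start reduces the claim to the
choice of the frame length, applied to each of the finitely many cases.\<close>

lemma frame_service:
  fixes sel :: "nat \<Rightarrow> real ^ 2 \<Rightarrow> state \<Rightarrow> bool"
  assumes \<epsilon>: "0 < \<epsilon>" "\<epsilon> < 1"
    and sel: "\<And>j. sel j \<in> borel \<rightarrow>\<^sub>M count_space UNIV"
    and choice: "\<And>j q. (\<forall>i. 0 \<le> q $ i) \<Longrightarrow> fbdc_choice \<epsilon> q (sel j q)"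
    and T: "0 < T"
      "\<And>\<pi> r s0 i. \<exists>!R. recurrent_class \<epsilon> \<pi> R \<Longrightarrow> attains \<epsilon> \<pi> r \<Longrightarrow>
         real T * (r $ i - \<eta>) \<le> (\<Sum>k<T. mean_reward \<epsilon> \<pi> s0 i k)"
    and \<phi>_def: "\<phi> = frame_policy sel T"
  shows "real T * expectation (\<lambda>\<omega>. queue \<phi> m\<^sub>0 (T * j) \<omega> $ i *
            (attained_rate \<epsilon> (sel j (queue \<phi> m\<^sub>0 (T * j) \<omega>)) $ i - \<eta>))
       \<le> (\<Sum>k<T. expectation (\<lambda>\<omega>. queue \<phi> m\<^sub>0 (T * j) \<omega> $ i * service \<phi> m\<^sub>0 i (T * j + k) \<omega>))"
proof -
  let ?t = "T * j"
  let ?q = "\<lambda>\<omega>. queue \<phi> m\<^sub>0 ?t \<omega>"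
  have \<phi>: "admissible \<phi>" unfolding \<phi>_def by (rule admissible_frame_policy[OF sel])
  (* One weight for each frame policy and each state at the start of the frame; the weights add up to
     the length of queue i. *)
  define W where "W p o' = snd o' $ i * of_bool (sel j (snd o') = fst p \<and> fst o' = snd p)"
    for p :: "(state \<Rightarrow> bool) \<times> state" and o' :: observation
  let ?W = "\<lambda>p \<omega>. W p (obs \<phi> m\<^sub>0 ?t \<omega> ?t)"
  have W_meas: "W p \<in> borel_measurable observation_space" for p
  proof -
    have \<pi>: "(\<lambda>o'. sel j (snd o')) \<in> count_space UNIV \<Otimes>\<^sub>M borel \<rightarrow>\<^sub>M count_space UNIV"
      by (rule measurable_compose[OF measurable_snd sel])
    have "(\<lambda>o'. of_bool (sel j (snd o') = fst p \<and> fst o' = snd p) :: real) \<in> borel_measurable (count_space UNIV \<Otimes>\<^sub>M borel)"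
      using measurable_compose[OF measurable_countable2[OF \<pi> measurable_fst, of "\<lambda>\<pi> s. \<pi> = fst p \<and> s = snd p"],
          of of_bool "borel :: real measure"] by simp
    then show ?thesis
      unfolding W_def[abs_def] observation_space_def
      by (intro borel_measurable_times measurable_compose[OF measurable_snd borel_measurable_nth])
  qed
  have W_bound: "0 \<le> ?W p \<omega>" "?W p \<omega> \<le> ?q \<omega> $ i" if "\<omega> \<in> space M" for p \<omega>
    using queue_nonneg[OF that] by (auto simp: W_def)
  have W_int: "integrable M (?W p)" for p
  proof (rule Bochner_Integration.integrable_bound[OF integrable_queue[OF \<phi>, of m\<^sub>0 ?t i]])
    show "?W p \<in> borel_measurable M"
      by (rule measurable_compose[OF measurable_compose[OF measurable_obs[OF \<phi>] measurable_component_singleton] W_meas]) simp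
    show "AE \<omega> in M. norm (?W p \<omega>) \<le> norm (?q \<omega> $ i)"
    proof (rule AE_I2)
      fix \<omega> assume "\<omega> \<in> space M"
      from W_bound[OF this, of p] show "norm (?W p \<omega>) \<le> norm (?q \<omega> $ i)"
        unfolding real_norm_def by linarith
    qed
  qed
  have W_sum: "(\<Sum>p\<in>UNIV. ?W p \<omega> * g p) = ?q \<omega> $ i * g (sel j (?q \<omega>), state_at \<phi> m\<^sub>0 ?t \<omega>)" for g \<omega>
  proof -
    let ?p = "(sel j (?q \<omega>), state_at \<phi> m\<^sub>0 ?t \<omega>)"
    have "(sel j (?q \<omega>) = fst p \<and> state_at \<phi> m\<^sub>0 ?t \<omega> = snd p) \<longleftrightarrow> p = ?p" for p
      unfolding prod_eq_iff fst_conv snd_conv by (intro arg_cong2[where f = "(\<and>)"] eq_commute)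
    then have "?W p \<omega> * g p = (if p = ?p then ?q \<omega> $ i * g p else 0)" for p
      unfolding W_def by simp
    then have "(\<Sum>p\<in>UNIV. ?W p \<omega> * g p) = (\<Sum>p\<in>UNIV. if p = ?p then ?q \<omega> $ i * g p else 0)"
      by (intro sum.cong refl)
    also have "\<dots> = ?q \<omega> $ i * g ?p" by (subst sum.delta) (rule finite, rule if_P, rule UNIV_I)
    finally show ?thesis .
  qed
  have follow: "AE \<omega> in M. ?W p \<omega> \<noteq> 0 \<longrightarrow> stays \<phi> m\<^sub>0 (?t + k) \<omega> = fst p (state_at \<phi> m\<^sub>0 (?t + k) \<omega>)"
    if "k < T" for p k
  proof -
    have "(?t + k) div T = j" using that by simp
    then have \<phi>_slot: "\<phi> (?t + k) h = of_bool (sel j (snd (h ?t)) (fst (h (?t + k))))" for h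
      by (simp add: \<phi>_def frame_policy_def)
    have "AE \<omega> in M. \<forall>b. U (?t + k) \<omega> < of_bool b \<longleftrightarrow> b"
      unfolding AE_all_countable by (intro allI AE_coin_lt_of_bool)
    then show ?thesis
    proof eventually_elim
      case (elim \<omega>)
      have "\<phi> (?t + k) (obs \<phi> m\<^sub>0 (?t + k) \<omega>) = of_bool (sel j (?q \<omega>) (state_at \<phi> m\<^sub>0 (?t + k) \<omega>))"
        unfolding \<phi>_slot obs_stable[OF le_add1] ..
      then have "stays \<phi> m\<^sub>0 (?t + k) \<omega> = sel j (?q \<omega>) (state_at \<phi> m\<^sub>0 (?t + k) \<omega>)"
        using elim by (simp only:)
      moreover have "sel j (?q \<omega>) = fst p" if "?W p \<omega> \<noteq> 0"
        using that by (auto simp: W_def of_bool_def split: if_splits)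
      ultimately show ?case by (intro impI) simp
    qed
  qed
  have W_service: "expectation (\<lambda>\<omega>. ?W p \<omega> * service \<phi> m\<^sub>0 i (?t + k) \<omega>)
      = expectation (?W p) * mean_reward \<epsilon> (fst p) (snd p) i k" if "k < T" for p k
  proof (rule weighted_frame_service[where W = "W p" and n = T and \<pi> = "fst p", OF \<phi> \<epsilon> W_meas W_bound(1) W_int])
    show "state_at \<phi> m\<^sub>0 ?t \<omega> = snd p" if "?W p \<omega> \<noteq> 0" for \<omega>
      using that by (simp add: W_def)
  qed (use follow that in simp_all)
  have W_service_int: "integrable M (\<lambda>\<omega>. ?W p \<omega> * service \<phi> m\<^sub>0 i (?t + k) \<omega>)" for p k
  proof (rule Bochner_Integration.integrable_bound[OF W_int[of p]])
    show "(\<lambda>\<omega>. ?W p \<omega> * service \<phi> m\<^sub>0 i (?t + k) \<omega>) \<in> borel_measurable M"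
      by (intro borel_measurable_times borel_measurable_integrable[OF W_int] borel_measurable_state_action[OF \<phi>])
  qed (auto simp: reward_def)
  (* A policy of nonzero weight is chosen for some nonnegative queue vector and so has a unique
     recurrent class. *)
  have lower: "expectation (?W p) * (real T * (attained_rate \<epsilon> (fst p) $ i - \<eta>))
      \<le> expectation (?W p) * (\<Sum>k<T. mean_reward \<epsilon> (fst p) (snd p) i k)" for p
  proof (cases "\<exists>\<omega>\<in>space M. ?W p \<omega> \<noteq> 0")
    case True
    then obtain \<omega> where \<omega>: "\<omega> \<in> space M" "fst p = sel j (?q \<omega>)" by (auto simp: W_def)
    then have ch: "fbdc_choice \<epsilon> (?q \<omega>) (fst p)"
      unfolding \<omega>(2) by (intro choice allI queue_nonneg)
    then have uniq: "\<exists>!R. recurrent_class \<epsilon> (fst p) R" unfolding fbdc_choice_def by (rule conjunct2)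
    show ?thesis
    proof (rule mult_left_mono)
      show "real T * (attained_rate \<epsilon> (fst p) $ i - \<eta>) \<le> (\<Sum>k<T. mean_reward \<epsilon> (fst p) (snd p) i k)"
        by (rule T(2)[OF uniq fbdc_choice_attained_rate(1)[OF \<epsilon> ch]])
      show "0 \<le> expectation (?W p)" by (intro integral_nonneg_AE AE_I2 W_bound(1))
    qed
  next
    case False
    then have "expectation (?W p) = expectation (\<lambda>_. 0)"
      by (intro Bochner_Integration.integral_cong) auto
    then show ?thesis by simp
  qed
  have "expectation (\<lambda>\<omega>. ?q \<omega> $ i * (attained_rate \<epsilon> (sel j (?q \<omega>)) $ i - \<eta>))
      = expectation (\<lambda>\<omega>. \<Sum>p\<in>UNIV. ?W p \<omega> * (attained_rate \<epsilon> (fst p) $ i - \<eta>))"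
    by (subst W_sum) simp
  also have "\<dots> = (\<Sum>p\<in>UNIV. expectation (?W p) * (attained_rate \<epsilon> (fst p) $ i - \<eta>))"
    by (simp add: Bochner_Integration.integral_sum W_int)
  finally have "real T * expectation (\<lambda>\<omega>. ?q \<omega> $ i * (attained_rate \<epsilon> (sel j (?q \<omega>)) $ i - \<eta>))
      = (\<Sum>p\<in>UNIV. expectation (?W p) * (real T * (attained_rate \<epsilon> (fst p) $ i - \<eta>)))"
    by (simp add: sum_distrib_left mult.left_commute)
  also have "\<dots> \<le> (\<Sum>p\<in>UNIV. expectation (?W p) * (\<Sum>k<T. mean_reward \<epsilon> (fst p) (snd p) i k))"
    by (intro sum_mono lower)
  also have "\<dots> = (\<Sum>p\<in>UNIV. \<Sum>k<T. expectation (\<lambda>\<omega>. ?W p \<omega> * service \<phi> m\<^sub>0 i (?t + k) \<omega>))"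
    by (simp add: W_service sum_distrib_left)
  also have "\<dots> = (\<Sum>k<T. \<Sum>p\<in>UNIV. expectation (\<lambda>\<omega>. ?W p \<omega> * service \<phi> m\<^sub>0 i (?t + k) \<omega>))"
    by (rule sum.swap)
  also have "\<dots> = (\<Sum>k<T. expectation (\<lambda>\<omega>. \<Sum>p\<in>UNIV. ?W p \<omega> * service \<phi> m\<^sub>0 i (?t + k) \<omega>))"
    by (intro sum.cong refl Bochner_Integration.integral_sum[symmetric] W_service_int)
  also have "\<dots> = (\<Sum>k<T. expectation (\<lambda>\<omega>. ?q \<omega> $ i * service \<phi> m\<^sub>0 i (?t + k) \<omega>))"
    by (subst W_sum) (rule refl)
  finally show ?thesis .
qed

text \<open>The past queue and the new arrivals are independent.\<close>

lemma expectation_queue_arrivals: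
  assumes \<phi>: "admissible \<phi>"
  shows "integrable M (\<lambda>\<omega>. queue \<phi> m\<^sub>0 t \<omega> $ i * A i (t + k) \<omega>)"
    and "expectation (\<lambda>\<omega>. queue \<phi> m\<^sub>0 t \<omega> $ i * A i (t + k) \<omega>) = rate $ i * expectation (\<lambda>\<omega>. queue \<phi> m\<^sub>0 t \<omega> $ i)"
proof -
  let ?f = "\<lambda>\<omega>. queue \<phi> m\<^sub>0 t \<omega> $ i * A i (t + k) \<omega>"
  have rate_nn: "0 \<le> rate $ i"
    using arrivals_nonneg integral_nonneg_AE[of "A i 0" M] arrivals_mean[of i 0] by auto
  have G: "(\<lambda>h. ennreal (snd (h t) $ i)) \<in> borel_measurable (\<Pi>\<^sub>M s\<in>{..t}. observation_space)"
    by (intro measurable_compose[OF _ measurable_ennreal] measurable_compose[OF measurable_past_state(2)[OF order_refl] borel_measurable_nth])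
  have "(\<integral>\<^sup>+\<omega>. ennreal (?f \<omega>) \<partial>M) = (\<integral>\<^sup>+\<omega>. ennreal (queue \<phi> m\<^sub>0 t \<omega> $ i) * ennreal (A i (t + k) \<omega>) \<partial>M)"
    using queue_nonneg arrivals_nonneg by (intro nn_integral_cong) (simp add: ennreal_mult)
  also have "\<dots> = (\<integral>\<^sup>+\<omega>. ennreal (queue \<phi> m\<^sub>0 t \<omega> $ i) \<partial>M) * ennreal (rate $ i)"
    using future_arrivals_independent[OF \<phi> _ G, of "t + k" m\<^sub>0 i] arrivals_nn_mean[OF integrable_arrivals] by simp
  also have "\<dots> = ennreal (rate $ i * expectation (\<lambda>\<omega>. queue \<phi> m\<^sub>0 t \<omega> $ i))"
    using nn_integral_queue_length[OF \<phi>, of m\<^sub>0 i t] rate_nn expectation_queue_nonneg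
    by (simp add: queue_length_eq ennreal_mult mult.commute)
  finally have nn: "(\<integral>\<^sup>+\<omega>. ennreal (?f \<omega>) \<partial>M) = ennreal (rate $ i * expectation (\<lambda>\<omega>. queue \<phi> m\<^sub>0 t \<omega> $ i))" .
  have f_nn: "AE \<omega> in M. 0 \<le> ?f \<omega>" using queue_nonneg arrivals_nonneg by (intro AE_I2) simp
  have f_meas: "?f \<in> borel_measurable M"
    by (intro borel_measurable_times measurable_queue_component[OF \<phi>] measurable_arrivals)
  show "integrable M ?f"
    by (rule integrableI_nn_integral_finite[OF f_meas f_nn nn])
  show "expectation ?f = rate $ i * expectation (\<lambda>\<omega>. queue \<phi> m\<^sub>0 t \<omega> $ i)"
    using nn rate_nn expectation_queue_nonneg by (simp add: integral_eq_nn_integral[OF f_meas f_nn])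
qed

section \<open>Drift over a frame\<close>

lemma frame_drift_pointwise:
  fixes q d a q' :: real
  assumes "0 \<le> q'" "q' \<le> max (q - d) 0 + a" "0 \<le> d" "0 \<le> a" "0 \<le> q"
  shows "q'\<^sup>2 \<le> q\<^sup>2 + d\<^sup>2 + a\<^sup>2 - 2 * q * d + 2 * q * a"
proof -
  have "q'\<^sup>2 \<le> (max (q - d) 0 + a)\<^sup>2" using assms by (intro power_mono) auto
  also have "\<dots> = (max (q - d) 0)\<^sup>2 + 2 * max (q - d) 0 * a + a\<^sup>2" by (simp add: power2_sum)
  also have "\<dots> \<le> (q - d)\<^sup>2 + 2 * q * a + a\<^sup>2"
  proof -
    have "(max (q - d) 0)\<^sup>2 \<le> (q - d)\<^sup>2" by (simp add: max_def)
    moreover have "max (q - d) 0 * a \<le> q * a" using assms by (intro mult_right_mono) auto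
    ultimately show ?thesis by simp
  qed
  finally show ?thesis by (simp add: power2_diff)
qed

text \<open>The quadratic drift with the cross terms kept exact; services contribute at most \<open>T\<^sup>2\<close> and
arrivals at most \<open>T\<^sup>2 * a\<^sup>2\<close> to the constant.\<close>

lemma frame_drift:
  assumes \<phi>: "admissible \<phi>"
    and moment: "\<And>i t. expectation (\<lambda>\<omega>. (A i t \<omega>)\<^sup>2) \<le> a\<^sup>2"
  shows "expectation (\<lambda>\<omega>. (queue \<phi> m\<^sub>0 (t + T) \<omega> $ i)\<^sup>2) \<le> expectation (\<lambda>\<omega>. (queue \<phi> m\<^sub>0 t \<omega> $ i)\<^sup>2)
      + (real T)\<^sup>2 * (1 + a\<^sup>2)
      - 2 * (\<Sum>k<T. expectation (\<lambda>\<omega>. queue \<phi> m\<^sub>0 t \<omega> $ i * service \<phi> m\<^sub>0 i (t + k) \<omega>))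
      + 2 * real T * rate $ i * expectation (\<lambda>\<omega>. queue \<phi> m\<^sub>0 t \<omega> $ i)"
proof -
  let ?q = "\<lambda>\<omega>. queue \<phi> m\<^sub>0 t \<omega> $ i"
  let ?d = "\<lambda>k \<omega>. service \<phi> m\<^sub>0 i (t + k) \<omega>"
  let ?a = "\<lambda>k \<omega>. A i (t + k) \<omega>"
  have d_int: "integrable M (\<lambda>\<omega>. ?q \<omega> * ?d k \<omega>)" for k
  proof (rule Bochner_Integration.integrable_bound[OF integrable_queue[OF \<phi>, of m\<^sub>0 t i]])
    show "(\<lambda>\<omega>. ?q \<omega> * ?d k \<omega>) \<in> borel_measurable M"
      by (intro borel_measurable_times measurable_queue_component[OF \<phi>] borel_measurable_state_action[OF \<phi>])
  qed (auto simp: reward_def)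
  note ints = integrable_queue_square[OF \<phi>] d_int expectation_queue_arrivals(1)[OF \<phi>]
    integrable_arrivals_sum_square
  have ptw: "(queue \<phi> m\<^sub>0 (t + T) \<omega> $ i)\<^sup>2 \<le> (?q \<omega>)\<^sup>2 + (real T)\<^sup>2 + (\<Sum>k<T. ?a k \<omega>)\<^sup>2
      - 2 * (\<Sum>k<T. ?q \<omega> * ?d k \<omega>) + 2 * (\<Sum>k<T. ?q \<omega> * ?a k \<omega>)" if \<omega>: "\<omega> \<in> space M" for \<omega>
  proof -
    have D: "0 \<le> (\<Sum>k<T. ?d k \<omega>)" "(\<Sum>k<T. ?d k \<omega>) \<le> real T"
      using sum_mono[of "{..<T}" "\<lambda>k. ?d k \<omega>" "\<lambda>_. 1"] by (simp_all add: reward_bounds sum_nonneg)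
    have "0 \<le> (\<Sum>k<T. ?a k \<omega>)" using arrivals_nonneg[OF \<omega>] by (intro sum_nonneg) auto
    from frame_drift_pointwise[OF queue_nonneg[OF \<omega>] queue_frame[OF \<omega>] D(1) this queue_nonneg[OF \<omega>]]
    have "(queue \<phi> m\<^sub>0 (t + T) \<omega> $ i)\<^sup>2 \<le> (?q \<omega>)\<^sup>2 + (\<Sum>k<T. ?d k \<omega>)\<^sup>2 + (\<Sum>k<T. ?a k \<omega>)\<^sup>2
        - 2 * ?q \<omega> * (\<Sum>k<T. ?d k \<omega>) + 2 * ?q \<omega> * (\<Sum>k<T. ?a k \<omega>)" .
    moreover have "(\<Sum>k<T. ?d k \<omega>)\<^sup>2 \<le> (real T)\<^sup>2" using D by (intro power_mono) auto
    ultimately show ?thesis by (simp add: sum_distrib_left mult.assoc)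
  qed
  have "expectation (\<lambda>\<omega>. (queue \<phi> m\<^sub>0 (t + T) \<omega> $ i)\<^sup>2)
      \<le> expectation (\<lambda>\<omega>. (?q \<omega>)\<^sup>2 + (real T)\<^sup>2 + (\<Sum>k<T. ?a k \<omega>)\<^sup>2
          - 2 * (\<Sum>k<T. ?q \<omega> * ?d k \<omega>) + 2 * (\<Sum>k<T. ?q \<omega> * ?a k \<omega>))"
    using ptw by (intro integral_mono Bochner_Integration.integrable_add Bochner_Integration.integrable_diff
        integrable_mult_right Bochner_Integration.integrable_sum ints) auto
  also have "\<dots> = expectation (\<lambda>\<omega>. (?q \<omega>)\<^sup>2) + (real T)\<^sup>2 + expectation (\<lambda>\<omega>. (\<Sum>k<T. ?a k \<omega>)\<^sup>2)
      - 2 * (\<Sum>k<T. expectation (\<lambda>\<omega>. ?q \<omega> * ?d k \<omega>)) + 2 * (\<Sum>k<T. expectation (\<lambda>\<omega>. ?q \<omega> * ?a k \<omega>))"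
    by (simp add: ints prob_space)
  also have "(\<Sum>k<T. expectation (\<lambda>\<omega>. ?q \<omega> * ?a k \<omega>)) = real T * rate $ i * expectation ?q"
    by (simp add: expectation_queue_arrivals(2)[OF \<phi>])
  also have "expectation (\<lambda>\<omega>. (\<Sum>k<T. ?a k \<omega>)\<^sup>2) \<le> (real T)\<^sup>2 * a\<^sup>2"
  proof -
    have "expectation (\<lambda>\<omega>. (\<Sum>k<T. ?a k \<omega>)\<^sup>2) \<le> expectation (\<lambda>\<omega>. (\<Sum>k<T. (?a k \<omega>)\<^sup>2) * real T)"
      by (intro integral_mono ints Bochner_Integration.integrable_mult_left Bochner_Integration.integrable_sum
          integrable_arrivals_square arrivals_sum_square_le)
    also have "\<dots> = (\<Sum>k<T. expectation (\<lambda>\<omega>. (?a k \<omega>)\<^sup>2)) * real T"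
      by (simp add: integrable_arrivals_square)
    also have "\<dots> \<le> (\<Sum>k<T. a\<^sup>2) * real T"
      by (intro mult_right_mono sum_mono moment) simp
    finally show ?thesis by (simp add: power2_eq_square mult_ac)
  qed
  finally show ?thesis by (simp add: algebra_simps)
qed

end

lemma sum_bounded_of_drift:
  fixes V w :: "nat \<Rightarrow> real"
  assumes "V 0 = 0" and nn: "\<And>j. 0 \<le> V j" and drift: "\<And>j. V (Suc j) \<le> V j + B - c * w j" and "0 < c"
  shows "(\<Sum>j<J. w j) \<le> real J * (B / c)"
proof -
  have "V J \<le> real J * B - c * (\<Sum>j<J. w j)"
  proof (induction J)
    case (Suc J)
    then show ?case using drift[of J] by (simp add: algebra_simps)
  qed (simp add: assms(1))
  with nn[of J] have "c * (\<Sum>j<J. w j) \<le> real J * B" by linarith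
  then show ?thesis using \<open>0 < c\<close> by (simp add: field_simps)
qed

text \<open>Bounded averages at the frame boundaries extend to all slots, since the sequence grows by at most
\<open>L\<close> within a frame.\<close>

lemma average_bounded_of_frames:
  fixes u :: "nat \<Rightarrow> real"
  assumes T: "0 < T" and nn: "\<And>t. 0 \<le> u t" and "0 \<le> K" "0 \<le> L"
    and frames: "\<And>J. (\<Sum>j<J. u (T * j)) \<le> real J * K"
    and within: "\<And>j k. k < T \<Longrightarrow> u (T * j + k) \<le> u (T * j) + L"
    and "0 < t"
  shows "(\<Sum>\<tau><t. u \<tau>) \<le> real t * ((1 + real T) * (K + L))"
proof -
  (* The first J frames cover all slots before t. *)
  define J where "J = t div T + 1"
  have "t < J * T" using dividend_less_times_div[OF T, of t] by (simp add: J_def algebra_simps)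
  then have "(\<Sum>\<tau><t. u \<tau>) \<le> (\<Sum>\<tau><J * T. u \<tau>)" by (intro sum_mono2 nn) auto
  also have "\<dots> = (\<Sum>j<J. sum u {j * T..<j * T + T})" by (rule sum.nat_group[symmetric])
  also have "\<dots> \<le> (\<Sum>j<J. real T * (u (T * j) + L))"
  proof (intro sum_mono)
    fix j
    have "u \<tau> \<le> u (T * j) + L" if "\<tau> \<in> {j * T..<j * T + T}" for \<tau>
    proof -
      have "\<tau> - T * j < T" "T * j + (\<tau> - T * j) = \<tau>" using that by (auto simp: mult.commute)
      then show ?thesis using within[of "\<tau> - T * j" j] by simp
    qed
    then have "sum u {j * T..<j * T + T} \<le> (\<Sum>\<tau>\<in>{j * T..<j * T + T}. u (T * j) + L)" by (rule sum_mono)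
    then show "sum u {j * T..<j * T + T} \<le> real T * (u (T * j) + L)" by simp
  qed
  also have "\<dots> = real T * ((\<Sum>j<J. u (T * j)) + real J * L)"
    by (simp add: sum.distrib flip: sum_distrib_left)
  also have "\<dots> \<le> real T * (real J * K + real J * L)"
    by (intro mult_left_mono add_right_mono frames) simp
  also have "\<dots> = real (T * J) * (K + L)" by (simp add: algebra_simps)
  also have "\<dots> \<le> (real t * (1 + real T)) * (K + L)"
  proof (rule mult_right_mono)
    have "T * J \<le> t + T" by (simp add: J_def)
    also have "t + T \<le> t * (1 + T)" using \<open>0 < t\<close> by (simp add: algebra_simps)
    finally have "real (T * J) \<le> real (t * (1 + T))" by (rule of_nat_mono)
    then show "real (T * J) \<le> real t * (1 + real T)" by (simp add: algebra_simps)
  qed (use assms in simp)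
  finally show ?thesis by (simp add: mult.assoc)
qed

section \<open>Throughput optimality\<close>

context queueing_system
begin

lemma stable_of_average_bound:
  assumes \<phi>: "admissible \<phi>" and bound: "\<And>t. 0 < t \<Longrightarrow> (\<Sum>\<tau><t. mean_backlog \<phi> m\<^sub>0 \<tau>) \<le> real t * K"
  shows "queues_stable M \<phi> m\<^sub>0 A C U"
proof -
  have "limsup (\<lambda>t. (\<Sum>\<tau><t. \<Sum>i\<in>UNIV. \<integral>\<^sup>+\<omega>. ennreal (queue_length \<phi> m\<^sub>0 A C U i \<tau> \<omega>) \<partial>M) / of_nat t) \<le> ennreal K"
  proof (rule Limsup_bounded)
    show "eventually (\<lambda>t. (\<Sum>\<tau><t. \<Sum>i\<in>UNIV. \<integral>\<^sup>+\<omega>. ennreal (queue_length \<phi> m\<^sub>0 A C U i \<tau> \<omega>) \<partial>M) / of_nat t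
        \<le> ennreal K) sequentially"
      using eventually_gt_at_top[of 0]
    proof eventually_elim
      case (elim t)
      then show ?case
        unfolding backlog_average_eq[OF \<phi> elim] using bound[OF elim]
        by (intro ennreal_leI) (simp add: field_simps)
    qed
  qed
  also have "\<dots> < \<infinity>" by simp
  finally show ?thesis unfolding queues_stable_def .
qed

lemma mean_backlog_within_frame:
  assumes \<phi>: "admissible \<phi>" and "k < T"
  shows "mean_backlog \<phi> m\<^sub>0 (t + k) \<le> mean_backlog \<phi> m\<^sub>0 t + real T * (\<Sum>i\<in>UNIV. rate $ i)"
proof -
  have rate_nn: "0 \<le> rate $ i" for i
    using arrivals_nonneg integral_nonneg_AE[of "A i 0" M] arrivals_mean[of i 0] by auto
  have "expectation (\<lambda>\<omega>. queue \<phi> m\<^sub>0 (t + k) \<omega> $ i) \<le> expectation (\<lambda>\<omega>. queue \<phi> m\<^sub>0 t \<omega> $ i) + real T * rate $ i" for i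
  proof -
    have "expectation (\<lambda>\<omega>. queue \<phi> m\<^sub>0 (t + k) \<omega> $ i)
        \<le> expectation (\<lambda>\<omega>. queue \<phi> m\<^sub>0 t \<omega> $ i + (\<Sum>s<k. A i (t + s) \<omega>))"
      by (intro integral_mono integrable_queue[OF \<phi>] Bochner_Integration.integrable_add
          Bochner_Integration.integrable_sum integrable_arrivals queue_growth)
    also have "\<dots> = expectation (\<lambda>\<omega>. queue \<phi> m\<^sub>0 t \<omega> $ i) + real k * rate $ i"
      by (simp add: integrable_queue[OF \<phi>] integrable_arrivals arrivals_mean)
    also have "real k * rate $ i \<le> real T * rate $ i"
      using \<open>k < T\<close> rate_nn by (intro mult_right_mono) auto
    finally show ?thesis by simp
  qed
  then have "mean_backlog \<phi> m\<^sub>0 (t + k) \<le> (\<Sum>i\<in>UNIV. expectation (\<lambda>\<omega>. queue \<phi> m\<^sub>0 t \<omega> $ i) + real T * rate $ i)"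
    unfolding mean_backlog_def by (intro sum_mono)
  then show ?thesis by (simp add: mean_backlog_def sum.distrib sum_distrib_left)
qed

text \<open>The policy of a frame maximizes \<open>Q \<bullet> r\<close> and so beats \<open>Q \<bullet> (\<lambda> + \<delta>)\<close>.  Half of \<open>\<delta>\<close> pays for
the finite frame length, the other half is the negative drift.\<close>

lemma fbdc_stable:
  assumes \<epsilon>: "0 < \<epsilon>" "\<epsilon> < 1" and "0 < \<delta>" and "0 < T"
    and good: "\<And>\<pi> r s0 i. \<exists>!R. recurrent_class \<epsilon> \<pi> R \<Longrightarrow> attains \<epsilon> \<pi> r \<Longrightarrow>
         real T * (r $ i - \<delta> / 2) \<le> (\<Sum>k<T. mean_reward \<epsilon> \<pi> s0 i k)"
    and fbdc: "fbdc_policy \<epsilon> T \<phi>"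
    and slack: "r' \<in> saturated_region \<epsilon>" "\<And>i. rate $ i + \<delta> \<le> r' $ i"
  shows "queues_stable M \<phi> m\<^sub>0 A C U"
proof -
  obtain sel where sel: "\<And>j. sel j \<in> borel \<rightarrow>\<^sub>M count_space UNIV"
    and choice: "\<And>j q. (\<forall>i. 0 \<le> q $ i) \<Longrightarrow> fbdc_choice \<epsilon> q (sel j q)"
    and \<phi>_eq: "\<phi> = frame_policy sel T"
    using fbdc unfolding fbdc_policy_def frame_policy_def by blast
  have \<phi>: "admissible \<phi>" unfolding \<phi>_eq by (rule admissible_frame_policy[OF sel])
  obtain a where a: "\<And>i t. expectation (\<lambda>\<omega>. (A i t \<omega>)\<^sup>2) \<le> a\<^sup>2"
    using arrivals_second_moment by blast
  let ?q = "\<lambda>j \<omega>. queue \<phi> m\<^sub>0 (T * j) \<omega>"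
  let ?E = "\<lambda>i j. expectation (\<lambda>\<omega>. ?q j \<omega> $ i)"
  let ?\<rho> = "\<lambda>j \<omega>. attained_rate \<epsilon> (sel j (?q j \<omega>))"
  let ?S = "\<lambda>i j. \<Sum>k<T. expectation (\<lambda>\<omega>. ?q j \<omega> $ i * service \<phi> m\<^sub>0 i (T * j + k) \<omega>)"
  define V where "V j = (\<Sum>i\<in>UNIV. expectation (\<lambda>\<omega>. (?q j \<omega> $ i)\<^sup>2))" for j
  define w where "w j = mean_backlog \<phi> m\<^sub>0 (T * j)" for j
  define B where "B = 2 * ((real T)\<^sup>2 * (1 + a\<^sup>2))"
  have served: "real T * (\<Sum>i\<in>UNIV. (rate $ i + \<delta> / 2) * ?E i j) \<le> (\<Sum>i\<in>UNIV. ?S i j)" for j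
  proof -
    have \<rho>_meas: "(\<lambda>\<omega>. ?\<rho> j \<omega> $ i) \<in> borel_measurable M" for i
      using measurable_compose[OF measurable_compose[OF measurable_queue[OF \<phi>] sel],
          of "\<lambda>\<pi>. attained_rate \<epsilon> \<pi> $ i" borel] by simp
    have int: "integrable M (\<lambda>\<omega>. ?q j \<omega> $ i * (?\<rho> j \<omega> $ i - \<delta> / 2))" for i
    proof (rule Bochner_Integration.integrable_bound)
      let ?c = "Max (range (\<lambda>\<pi>. \<bar>attained_rate \<epsilon> \<pi> $ i - \<delta> / 2\<bar>))"
      show "integrable M (\<lambda>\<omega>. ?q j \<omega> $ i * ?c)"
        by (intro integrable_mult_left integrable_queue[OF \<phi>])
      show "(\<lambda>\<omega>. ?q j \<omega> $ i * (?\<rho> j \<omega> $ i - \<delta> / 2)) \<in> borel_measurable M"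
        by (intro borel_measurable_times borel_measurable_diff measurable_queue_component[OF \<phi>] \<rho>_meas) simp
      have "\<bar>?\<rho> j \<omega> $ i - \<delta> / 2\<bar> \<le> \<bar>?c\<bar>" for \<omega>
        by (rule order.trans[OF Max_ge abs_ge_self]) auto
      then show "AE \<omega> in M. norm (?q j \<omega> $ i * (?\<rho> j \<omega> $ i - \<delta> / 2)) \<le> norm (?q j \<omega> $ i * ?c)"
        by (intro AE_I2) (simp add: abs_mult mult_left_mono)
    qed
    have "(\<Sum>i\<in>UNIV. (rate $ i + \<delta> / 2) * ?E i j)
        = expectation (\<lambda>\<omega>. \<Sum>i\<in>UNIV. ?q j \<omega> $ i * (rate $ i + \<delta> / 2))"
      by (simp add: integrable_queue[OF \<phi>] mult.commute)
    also have "\<dots> \<le> expectation (\<lambda>\<omega>. \<Sum>i\<in>UNIV. ?q j \<omega> $ i * (?\<rho> j \<omega> $ i - \<delta> / 2))"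
    proof (intro integral_mono Bochner_Integration.integrable_sum int integrable_mult_left integrable_queue[OF \<phi>])
      fix \<omega> assume \<omega>: "\<omega> \<in> space M"
      have ch: "fbdc_choice \<epsilon> (?q j \<omega>) (sel j (?q j \<omega>))"
        using queue_nonneg[OF \<omega>] by (intro choice) simp
      have "(\<Sum>i\<in>UNIV. ?q j \<omega> $ i * (rate $ i + \<delta>)) \<le> (\<Sum>i\<in>UNIV. ?q j \<omega> $ i * r' $ i)"
        using slack(2) queue_nonneg[OF \<omega>] by (intro sum_mono mult_left_mono)
      also have "\<dots> = ?q j \<omega> \<bullet> r'" by (simp add: inner_vec_def)
      also have "\<dots> \<le> ?q j \<omega> \<bullet> ?\<rho> j \<omega>" by (rule fbdc_choice_attained_rate(2)[OF \<epsilon> ch slack(1)])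
      also have "\<dots> = (\<Sum>i\<in>UNIV. ?q j \<omega> $ i * ?\<rho> j \<omega> $ i)" by (simp add: inner_vec_def)
      finally show "(\<Sum>i\<in>UNIV. ?q j \<omega> $ i * (rate $ i + \<delta> / 2)) \<le> (\<Sum>i\<in>UNIV. ?q j \<omega> $ i * (?\<rho> j \<omega> $ i - \<delta> / 2))"
        by (simp add: sum_2 field_simps)
    qed
    also have "\<dots> = (\<Sum>i\<in>UNIV. expectation (\<lambda>\<omega>. ?q j \<omega> $ i * (?\<rho> j \<omega> $ i - \<delta> / 2)))"
      by (intro Bochner_Integration.integral_sum int)
    finally have "real T * (\<Sum>i\<in>UNIV. (rate $ i + \<delta> / 2) * ?E i j)
        \<le> (\<Sum>i\<in>UNIV. real T * expectation (\<lambda>\<omega>. ?q j \<omega> $ i * (?\<rho> j \<omega> $ i - \<delta> / 2)))"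
      unfolding sum_distrib_left[symmetric] by (rule mult_left_mono) simp
    also have "\<dots> \<le> (\<Sum>i\<in>UNIV. ?S i j)"
      by (intro sum_mono frame_service[OF \<epsilon> sel choice \<open>0 < T\<close> good \<phi>_eq])
    finally show ?thesis .
  qed
  have drift: "V (Suc j) \<le> V j + B - (real T * \<delta>) * w j" for j
  proof -
    have "V (Suc j) \<le> (\<Sum>i\<in>UNIV. expectation (\<lambda>\<omega>. (?q j \<omega> $ i)\<^sup>2) + (real T)\<^sup>2 * (1 + a\<^sup>2)
        - 2 * ?S i j + 2 * real T * rate $ i * ?E i j)"
      unfolding V_def using frame_drift[OF \<phi> a, of m\<^sub>0 "T * j" T] by (intro sum_mono) (simp add: add.commute)
    also have "\<dots> = V j + B - 2 * (\<Sum>i\<in>UNIV. ?S i j) + 2 * real T * (\<Sum>i\<in>UNIV. rate $ i * ?E i j)"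
      by (simp add: V_def B_def sum_2 algebra_simps)
    also have "\<dots> \<le> V j + B - 2 * (real T * (\<Sum>i\<in>UNIV. (rate $ i + \<delta> / 2) * ?E i j))
        + 2 * real T * (\<Sum>i\<in>UNIV. rate $ i * ?E i j)"
      using served[of j] by linarith
    also have "\<dots> = V j + B - (real T * \<delta>) * w j"
      by (simp add: w_def mean_backlog_def sum_2 algebra_simps)
    finally show ?thesis .
  qed
  have frames: "(\<Sum>j<J. mean_backlog \<phi> m\<^sub>0 (T * j)) \<le> real J * (B / (real T * \<delta>))" for J
    unfolding w_def[symmetric]
  proof (rule sum_bounded_of_drift[where V = V and w = w])
    show "V (Suc j) \<le> V j + B - real T * \<delta> * w j" for j by (rule drift)
    show "V 0 = 0" by (simp add: V_def queue_0)
    show "0 \<le> V j" for j unfolding V_def by (intro sum_nonneg integral_nonneg_AE) simp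
  qed (use \<open>0 < T\<close> \<open>0 < \<delta>\<close> in simp)
  have L: "0 \<le> real T * (\<Sum>i\<in>UNIV. rate $ i)"
    using arrivals_nonneg integral_nonneg_AE[of "A _ 0" M] arrivals_mean[of _ 0]
    by (intro mult_nonneg_nonneg sum_nonneg) auto
  have K: "0 \<le> B / (real T * \<delta>)" using \<open>0 < \<delta>\<close> by (simp add: B_def)
  show ?thesis
    using average_bounded_of_frames[OF \<open>0 < T\<close> mean_backlog_nonneg K L frames mean_backlog_within_frame[OF \<phi>]]
    by (intro stable_of_average_bound[OF \<phi>])
qed

end

theorem corollary2:
  fixes \<epsilon> :: real
  assumes "0 < \<epsilon>" and "\<epsilon> \<le> 1 / 2"
  shows "\<forall>\<delta>>0. \<exists>T>0.
    (\<exists>\<phi>. fbdc_policy \<epsilon> T \<phi>) \<and>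
    (\<forall>\<phi>. fbdc_policy \<epsilon> T \<phi> \<longrightarrow>
      (\<forall>rate :: real ^ 2.
        (\<forall>i. 0 \<le> rate $ i) \<and> (\<chi> i. rate $ i + \<delta>) \<in> stability_region \<epsilon> \<longrightarrow>
        (\<forall>(M :: 'w measure) A C U m\<^sub>0.
          queueing_system M \<epsilon> rate A C U \<longrightarrow> queues_stable M \<phi> m\<^sub>0 A C U)))"
proof (intro allI impI)
  fix \<delta> :: real assume "0 < \<delta>"
  have \<epsilon>: "0 < \<epsilon>" "\<epsilon> < 1" using assms by auto
  obtain T where T: "0 < T" and good: "\<And>\<pi> r s0 i. \<exists>!R. recurrent_class \<epsilon> \<pi> R \<Longrightarrow> attains \<epsilon> \<pi> r \<Longrightarrow>
         real T * (r $ i - \<delta> / 2) \<le> (\<Sum>k<T. mean_reward \<epsilon> \<pi> s0 i k)"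
    using ex_good_frame_length[OF \<epsilon>, of "\<delta> / 2"] \<open>0 < \<delta>\<close> by auto
  obtain sel where sel: "sel \<in> borel \<rightarrow>\<^sub>M count_space UNIV" "\<And>q. fbdc_choice \<epsilon> q (sel q)"
    using ex_measurable_fbdc_selection[OF \<epsilon>] by blast
  have "fbdc_policy \<epsilon> T (frame_policy (\<lambda>_. sel) T)"
    unfolding fbdc_policy_def frame_policy_def using sel by (intro exI[of _ "\<lambda>_. sel"]) simp
  moreover have "queues_stable M \<phi> m\<^sub>0 A C U"
    if fbdc: "fbdc_policy \<epsilon> T \<phi>" and stabilizable: "(\<chi> i. rate $ i + \<delta>) \<in> stability_region \<epsilon>"
      and system: "queueing_system M \<epsilon> rate A C U"
    for \<phi> rate and M :: "'w measure" and A C U m\<^sub>0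
  proof -
    obtain r' where r': "r' \<in> saturated_region \<epsilon>" "\<And>i. rate $ i + \<delta> \<le> r' $ i"
      using stability_region_dominated[OF \<epsilon> stabilizable] by auto
    show ?thesis
      by (rule queueing_system.fbdc_stable[OF system \<epsilon> \<open>0 < \<delta>\<close> T good fbdc r'])
  qed
  ultimately show "\<exists>T>0. (\<exists>\<phi>. fbdc_policy \<epsilon> T \<phi>) \<and>
    (\<forall>\<phi>. fbdc_policy \<epsilon> T \<phi> \<longrightarrow>
      (\<forall>rate :: real ^ 2.
        (\<forall>i. 0 \<le> rate $ i) \<and> (\<chi> i. rate $ i + \<delta>) \<in> stability_region \<epsilon> \<longrightarrow>
        (\<forall>(M :: 'w measure) A C U m\<^sub>0.
          queueing_system M \<epsilon> rate A C U \<longrightarrow> queues_stable M \<phi> m\<^sub>0 A C U)))"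
    using T by blast
qed

end
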